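(* Let $\mathbb K$ be either $\mathbb Z$ or $\mathbb R$, let $k\ge2$ be an integer and $j\in[k]$. Let $\mathcal P=(P_1,\ldots,P_k)$ with $P_1,\ldots,P_k\in\mathbb K[\mathrm n]$ of degrees $d_i=\deg P_i\ge1$ (not necessarily distinct), and put $D=d_1+\cdots+d_k$. Then there exist exponents $1<p<q<2$ and $1<p_1,\ldots,p_k<\infty$ with $\frac1{p_1}+\cdots+\frac1{p_k}=\frac1p$ and $p_j=2$ such that, for all $N\ge1$ and all $f_i\in L^{p_i}(\mathbb K^k)$, $i\in[k]$, $$\big\|A^{\mathcal P}_{N;\mathbb K^k}(f_1,\ldots,f_k)\big\|_{L^q(\mathbb K^k)}\lesssim_{\mathcal P}N^{-D(\frac1p-\frac1q)}\prod_{i\in[k]}\|f_i\|_{L^{p_i}(\mathbb K^k)}.$$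
   Context: $[k]=\{1,\ldots,k\}$. $\mathbb K$ is equipped with counting measure if $\mathbb K=\mathbb Z$ and Lebesgue measure if $\mathbb K=\mathbb R$, denoted $\lambda_{\mathbb K}$; $\mathbb K^k$ carries the product measure. $[N]_{\mathbb K}=(0,N]\cap\mathbb K$, $e_1,\ldots,e_k$ is the standard basis, and $$A^{\mathcal P}_{N;\mathbb K^k}(f_1,\ldots,f_k)(x)=\frac1{\lambda_{\mathbb K}([N]_{\mathbb K})}\int_{[N]_{\mathbb K}}\prod_{i\in[k]}f_i(x-P_i(t)e_i)\,d\lambda_{\mathbb K}(t),\qquad x\in\mathbb K^k.$$ $\lesssim_{\mathcal P}$ means that the implicit constant may depend on $\mathcal P$ (and the exponents) but not on $N$ or the $f_i$. *)

theory Defs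
  imports "HOL-Analysis.Analysis" "HOL-Computational_Algebra.Polynomial"
begin

definition Lp_space :: "'a measure \<Rightarrow> real \<Rightarrow> ('a \<Rightarrow> complex) set" where
  "Lp_space M p = {f \<in> borel_measurable M. integrable M (\<lambda>x. norm (f x) powr p)}"

(* Only meaningful on Lp_space M p: elsewhere the Bochner integral may default to 0. *)
definition Lp_norm :: "'a measure \<Rightarrow> real \<Rightarrow> ('a \<Rightarrow> complex) \<Rightarrow> real" where
  "Lp_norm M p f = (LINT x|M. norm (f x) powr p) powr (1 / p)"

definition int_window :: "real \<Rightarrow> int set" where
  "int_window N = {t. 0 < t \<and> real_of_int t \<le> N}"

definition real_window :: "real \<Rightarrow> real set" where
  "real_window N = {0<..N}"

definition avg_integrand ::
    "('k \<Rightarrow> 'a poly) \<Rightarrow> ('k \<Rightarrow> 'a ^ 'k \<Rightarrow> complex) \<Rightarrow> 'a ^ 'k \<Rightarrow> 'a::comm_ring_1 \<Rightarrow> complex" where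
  "avg_integrand P f x t = (\<Prod>i\<in>UNIV. f i (x - axis i (poly (P i) t)))"

(* The measure lam and the window I are parameters, so that one definition serves both base rings:
   (count_space UNIV, int_window N) for the integers, (lebesgue, real_window N) for the reals.
   On the k-th powers the corresponding product measures are count_space UNIV and
   (after completion) lebesgue. *)
definition poly_avg ::
    "'a::comm_ring_1 measure \<Rightarrow> 'a set \<Rightarrow> ('k \<Rightarrow> 'a poly) \<Rightarrow> ('k \<Rightarrow> 'a ^ 'k \<Rightarrow> complex)
      \<Rightarrow> 'a ^ 'k \<Rightarrow> complex" where
  "poly_avg lam I P f x = (1 / measure lam I) *\<^sub>R (LINT t:I|lam. avg_integrand P f x t)"

end

theory Submission
  imports Defs "HOL-Library.Multiset"
begin

text \<open>
  The multilinear average is controlled by averages in one variable. For fixed \<open>x\<close>, Hoelder's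
  inequality in \<open>t\<close> with weights \<open>w i = a i / r i\<close> of total mass one bounds the average of
  \<open>\<Prod>i. f i (x - P i (t) e i)\<close> by the product of the \<open>w i\<close>-th powers of \<open>A i (\<bar>f i\<bar> ^ (r i / a i))\<close>, where
  \<open>A i\<close> averages over the shifts by \<open>P i (t)\<close> of the \<open>i\<close>-th coordinate alone. If \<open>A i\<close> maps \<open>L\<^sup>a\<close> to
  \<open>L\<^sup>b\<close> on the line, with \<open>a = a i\<close> slightly smaller than a fixed \<open>b\<close>, then the \<open>i\<close>-th factor keeps its
  exponent \<open>r i\<close> in all coordinates but the \<open>i\<close>-th one, where \<open>1 / r i\<close> drops by \<open>\<delta>\<close>. Thus in every
  coordinate direction exactly one factor gains \<open>\<delta>\<close>, all directions have the same total exponent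
  \<open>1 / p - \<delta> = 1 / q\<close>, and the factors can be multiplied together by a mixed norm Hoelder
  inequality, here obtained from Finner's inequality (\<open>multilinear_bound\<close>). The scale invariant
  constant of the \<open>i\<close>-th gain is \<open>N powr (- d i * \<delta>)\<close>, so the product of all of them is
  \<open>N powr (- D * \<delta>)\<close>, as required. An arbitrarily small \<open>\<delta> > 0\<close> suffices, and \<open>b = 4 / 3\<close>,
  \<open>1 / p = 3 / 4 + k * \<delta>\<close> and \<open>r j = 2\<close> leave room for it (\<open>improving_bound\<close>).

  What remains is an \<open>L\<^sup>a\<close> improving estimate on the line with the sharp power of \<open>N\<close>. Since \<open>a < b\<close>, it
  follows by a layer cake decomposition from an estimate for indicator functions that gains any
  positive power of \<open>N powr (- d) * \<bar>E\<bar>\<close> over the trivial bound (\<open>strong_type_of_restricted_type\<close>).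

  Over the reals this gain comes from \<open>\<bar>{t. P(t) \<in> E}\<bar> \<le> C * \<bar>E\<bar> powr (1 / d)\<close>, proved by
  induction on the degree: where \<open>P'\<close> is large a change of variables on the monotone pieces of \<open>P\<close>
  bounds the set, and where \<open>P'\<close> is small the induction hypothesis does
  (\<open>measure_poly_preimage_le\<close>).

  Over the integers it comes from the mean value estimate
  \<open>\<integral>\<bar>S(\<alpha>)\<bar>\<^sup>2\<^sup>s d\<alpha> \<le> C * N ^ (2s - d)\<close> for the Weyl sum \<open>S\<close> of \<open>P\<close> and a large \<open>s\<close>
  (\<open>mean_value_bound_exists\<close>). It must not lose a factor \<open>N\<^sup>\<epsilon>\<close>, for such a factor would survive in the
  theorem. The elementary method of Hua and Linnik gives this: differencing writes
  \<open>\<bar>S\<bar>\<^sup>2\<close> through sums of \<open>h * \<phi>(y)\<close> with \<open>\<phi>\<close> of smaller degree, by induction no integer is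
  represented too often by sums of values of \<open>\<phi>\<close>, and \<open>h1 * m1 + h2 * m2 + h3 * m3 = 0\<close> has no more solutions than expected
  (\<open>card_bilinear_solutions_le\<close>).
\<close>

section \<open>Powers of extended nonnegative numbers and the Hoelder inequality\<close>

text \<open>Powers with a positive exponent, so that \<open>0\<close> and \<open>\<infinity>\<close> are fixed points; iterated integrals of
  finite functions may well be infinite at some points.\<close>
definition epow :: "ennreal \<Rightarrow> real \<Rightarrow> ennreal" where
  "epow x w = (if x = \<infinity> then \<infinity> else ennreal (enn2real x powr w))"

abbreviation pow_integral :: "'a measure \<Rightarrow> real \<Rightarrow> ('a \<Rightarrow> ennreal) \<Rightarrow> ennreal" where
  "pow_integral M p f \<equiv> \<integral>\<^sup>+x. epow (f x) p \<partial>M"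

abbreviation cube :: "'a measure \<Rightarrow> ('k \<Rightarrow> 'a) measure" where
  "cube M \<equiv> Pi\<^sub>M UNIV (\<lambda>_. M)"

abbreviation shift_avg :: "'t measure \<Rightarrow> ('a \<Rightarrow> 't \<Rightarrow> 'a) \<Rightarrow> ('a \<Rightarrow> ennreal) \<Rightarrow> 'a \<Rightarrow> ennreal" where
  "shift_avg \<nu> \<phi> h x \<equiv> \<integral>\<^sup>+t. h (\<phi> x t) \<partial>\<nu>"

lemma epow_ennreal [simp]: "0 \<le> x \<Longrightarrow> epow (ennreal x) w = ennreal (x powr w)"
  by (simp add: epow_def)

lemma epow_top [simp]: "epow top w = top"
  by (simp add: epow_def)

lemma epow_0 [simp]: "epow 0 w = 0"
  by (simp add: epow_def)

lemma epow_1_left [simp]: "epow 1 w = 1"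
  by (simp add: epow_def)

lemma epow_1 [simp]: "epow x 1 = x"
  by (cases x) (auto simp: epow_def)

lemma epow_eq_0_iff [simp]: "epow x w = 0 \<longleftrightarrow> x = 0"
  by (cases x) (auto simp: epow_def ennreal_eq_0_iff)

lemma epow_eq_top_iff [simp]: "epow x w = top \<longleftrightarrow> x = top"
  by (cases x) (auto simp: epow_def)

lemma epow_mono: "x \<le> y \<Longrightarrow> 0 \<le> w \<Longrightarrow> epow x w \<le> epow y w"
  by (cases x; cases y) (auto simp: top_unique intro: ennreal_leI powr_mono2)

lemma epow_mult: "epow (x * y) w = epow x w * epow y w"
proof (cases x; cases y)
  fix a b :: real assume "x = ennreal a" "y = ennreal b" "0 \<le> a" "0 \<le> b"
  then show ?thesis by (simp add: ennreal_mult[symmetric] powr_mult)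
next
  fix a :: real assume "x = ennreal a" "0 \<le> a" "y = top"
  then show ?thesis by (cases "a = 0") (auto simp: ennreal_mult_top)
next
  fix a :: real assume "y = ennreal a" "0 \<le> a" "x = top"
  then show ?thesis by (cases "a = 0") (auto simp: ennreal_top_mult)
qed auto

lemma epow_prod: "finite A \<Longrightarrow> epow (\<Prod>a\<in>A. f a) w = (\<Prod>a\<in>A. epow (f a) w)"
  by (induction A rule: finite_induct) (auto simp: epow_mult)

lemma epow_epow: "epow (epow x u) w = epow x (u * w)"
  by (cases x) (auto simp: powr_powr)

lemma epow_add: "epow x u * epow x w = epow x (u + w)"
  by (cases x) (auto simp: ennreal_mult[symmetric] powr_add)

lemma prod_mono_ennreal:
  fixes f g :: "'b \<Rightarrow> ennreal"
  assumes "\<And>a. a \<in> A \<Longrightarrow> f a \<le> g a"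
  shows "(\<Prod>a\<in>A. f a) \<le> (\<Prod>a\<in>A. g a)"
  using assms by (induction A rule: infinite_finite_induct) (auto intro!: mult_mono)

lemma measurable_epow [measurable]:
  assumes [measurable]: "f \<in> borel_measurable M"
  shows "(\<lambda>x. epow (f x) w) \<in> borel_measurable M"
  unfolding epow_def by measurable

text \<open>Convexity of the exponential function, applied to the logarithms of the factors.\<close>
lemma weighted_am_gm_ennreal:
  fixes w :: "'b \<Rightarrow> real" and f :: "'b \<Rightarrow> ennreal"
  assumes A: "finite A" "\<And>a. a \<in> A \<Longrightarrow> 0 < w a" "(\<Sum>a\<in>A. w a) = 1"
  shows "(\<Prod>a\<in>A. epow (f a) (w a)) \<le> (\<Sum>a\<in>A. ennreal (w a) * f a)"
proof (cases "\<exists>a\<in>A. f a = top")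
  case True
  then obtain a where a: "a \<in> A" "f a = top" by auto
  have "ennreal (w a) * f a = top" using a A(2)[of a] by (simp add: ennreal_mult_top)
  then have "(\<Sum>a\<in>A. ennreal (w a) * f a) = top"
    using a A(1) sum.remove[of A a "\<lambda>a. ennreal (w a) * f a"] by simp
  then show ?thesis by simp
next
  case fin: False
  define g where "g a = enn2real (f a)" for a
  have g: "f a = ennreal (g a)" "0 \<le> g a" if "a \<in> A" for a
    using fin that by (auto simp: g_def less_top)
  have "(\<Prod>a\<in>A. g a powr w a) \<le> (\<Sum>a\<in>A. w a * g a)"
  proof (cases "\<exists>a\<in>A. g a = 0")
    case True
    then have "(\<Prod>a\<in>A. g a powr w a) = 0" using A(1) by (auto intro!: prod_zero)
    moreover have "0 \<le> (\<Sum>a\<in>A. w a * g a)"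
      using A(2) g by (intro sum_nonneg mult_nonneg_nonneg) (auto intro: less_imp_le)
    ultimately show ?thesis by simp
  next
    case False
    then have pos: "0 < g a" if "a \<in> A" for a using g[OF that] that by (auto simp: less_le)
    have ne: "A \<noteq> {}" using A(3) by auto
    have "exp (\<Sum>a\<in>A. w a *\<^sub>R ln (g a)) \<le> (\<Sum>a\<in>A. w a * exp (ln (g a)))"
      by (rule convex_on_sum[OF A(1) ne exp_convex A(3)]) (use A(2) in \<open>auto intro: less_imp_le\<close>)
    also have "exp (\<Sum>a\<in>A. w a *\<^sub>R ln (g a)) = (\<Prod>a\<in>A. g a powr w a)"
      unfolding exp_sum[OF A(1)] using pos by (intro prod.cong) (force simp: powr_def)+
    also have "(\<Sum>a\<in>A. w a * exp (ln (g a))) = (\<Sum>a\<in>A. w a * g a)"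
      using pos by (intro sum.cong) auto
    finally show ?thesis .
  qed
  then have "ennreal (\<Prod>a\<in>A. g a powr w a) \<le> ennreal (\<Sum>a\<in>A. w a * g a)"
    by (rule ennreal_leI)
  also have "ennreal (\<Prod>a\<in>A. g a powr w a) = (\<Prod>a\<in>A. epow (f a) (w a))"
    by (subst prod_ennreal[symmetric]) (auto intro!: prod.cong simp: g)
  also have "ennreal (\<Sum>a\<in>A. w a * g a) = (\<Sum>a\<in>A. ennreal (w a) * f a)"
    using A(2) g by (subst sum_ennreal[symmetric])
      (auto intro!: sum.cong mult_nonneg_nonneg simp: ennreal_mult less_imp_le)
  finally show ?thesis .
qed

text \<open>Normalising every factor to have integral one reduces the claim to the weighted inequality of
  arithmetic and geometric means under the integral sign.\<close>
lemma nn_integral_Hoelder: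
  fixes w :: "'b \<Rightarrow> real" and f :: "'b \<Rightarrow> 'a \<Rightarrow> ennreal"
  assumes A: "finite A" "\<And>a. a \<in> A \<Longrightarrow> 0 < w a" "(\<Sum>a\<in>A. w a) = 1"
    and f [measurable]: "\<And>a. a \<in> A \<Longrightarrow> f a \<in> borel_measurable M"
  shows "(\<integral>\<^sup>+x. (\<Prod>a\<in>A. epow (f a x) (w a)) \<partial>M) \<le> (\<Prod>a\<in>A. epow (\<integral>\<^sup>+x. f a x \<partial>M) (w a))"
proof (cases "\<exists>a\<in>A. (\<integral>\<^sup>+x. f a x \<partial>M) = 0")
  case True
  then obtain a where a: "a \<in> A" "(\<integral>\<^sup>+x. f a x \<partial>M) = 0" by auto
  then have "AE x in M. f a x = 0" by (subst (asm) nn_integral_0_iff_AE) auto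
  then have "AE x in M. (\<Prod>a\<in>A. epow (f a x) (w a)) = 0"
    by eventually_elim (use a A(1) in \<open>auto intro!: prod_zero\<close>)
  then have "(\<integral>\<^sup>+x. (\<Prod>a\<in>A. epow (f a x) (w a)) \<partial>M) = 0"
    by (subst nn_integral_0_iff_AE) auto
  then show ?thesis by simp
next
  case nz: False
  define F where "F a = (\<integral>\<^sup>+x. f a x \<partial>M)" for a
  show ?thesis
  proof (cases "\<exists>a\<in>A. F a = top")
    case True
    then obtain a where a: "a \<in> A" "F a = top" by auto
    have "(\<Prod>a\<in>A. epow (F a) (w a)) = epow (F a) (w a) * (\<Prod>a\<in>A - {a}. epow (F a) (w a))"
      using a A(1) by (simp add: prod.remove)
    also have "\<dots> = top"
      using a nz A(1) by (auto simp: ennreal_top_mult F_def)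
    finally show ?thesis by (simp add: F_def)
  next
    case False
    then have F: "F a \<noteq> 0" "F a \<noteq> top" if "a \<in> A" for a
      using nz that by (auto simp: F_def)
    have eq: "epow (f a x) (w a) = epow (F a) (w a) * epow (f a x / F a) (w a)" if "a \<in> A" for a x
    proof -
      have "f a x = F a * (f a x / F a)"
        using F[OF that] by (metis ennreal_times_divide mult.commute mult_divide_eq_ennreal)
      then show ?thesis by (metis epow_mult)
    qed
    have "(\<integral>\<^sup>+x. (\<Prod>a\<in>A. epow (f a x) (w a)) \<partial>M)
        = (\<integral>\<^sup>+x. (\<Prod>a\<in>A. epow (F a) (w a)) * (\<Prod>a\<in>A. epow (f a x / F a) (w a)) \<partial>M)"
      by (intro nn_integral_cong) (simp add: eq prod.distrib[symmetric] cong: prod.cong)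
    also have "\<dots> = (\<Prod>a\<in>A. epow (F a) (w a)) * (\<integral>\<^sup>+x. (\<Prod>a\<in>A. epow (f a x / F a) (w a)) \<partial>M)"
      by (subst nn_integral_cmult) auto
    also have "(\<integral>\<^sup>+x. (\<Prod>a\<in>A. epow (f a x / F a) (w a)) \<partial>M)
        \<le> (\<integral>\<^sup>+x. (\<Sum>a\<in>A. ennreal (w a) * (f a x / F a)) \<partial>M)"
      by (intro nn_integral_mono weighted_am_gm_ennreal A)
    also have "\<dots> = (\<Sum>a\<in>A. ennreal (w a) * ((\<integral>\<^sup>+x. f a x \<partial>M) / F a))"
      by (subst nn_integral_sum) (auto intro!: sum.cong simp: nn_integral_cmult nn_integral_divide)
    also have "\<dots> = (\<Sum>a\<in>A. ennreal (w a))"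
      using F by (intro sum.cong) (auto simp: F_def[symmetric] less_top)
    also have "\<dots> = 1" using A by (subst sum_ennreal) (auto simp: less_imp_le)
    finally show ?thesis by (simp add: F_def mult_left_mono)
  qed
qed

section \<open>The Finner inequality\<close>

lemma restrict_fun_upd_in: "i \<in> J \<Longrightarrow> restrict (x(i := u)) J = (restrict x (J - {i}))(i := u)"
  by (auto simp: restrict_def fun_eq_iff)

lemma restrict_fun_upd_notin: "i \<notin> J \<Longrightarrow> restrict (x(i := u)) J = restrict x J"
  by (auto simp: restrict_def fun_eq_iff)

context product_sigma_finite
begin

lemma borel_measurable_partial_nn_integral:
  assumes i: "i \<in> J" and f: "f \<in> borel_measurable (Pi\<^sub>M J M)"
  shows "(\<lambda>y. \<integral>\<^sup>+u. f (y(i := u)) \<partial>M i) \<in> borel_measurable (Pi\<^sub>M (J - {i}) M)"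
proof -
  interpret sigma_finite_measure "M i" by (rule sigma_finite_measures)
  have J: "insert i (J - {i}) = J" using i by auto
  have "(\<lambda>(y, u). y(i := u)) \<in> Pi\<^sub>M (J - {i}) M \<Otimes>\<^sub>M M i \<rightarrow>\<^sub>M Pi\<^sub>M J M"
    using measurable_add_dim[of i "J - {i}" M] unfolding J .
  from measurable_comp[OF this f]
  have "(\<lambda>(y, u). f (y(i := u))) \<in> borel_measurable (Pi\<^sub>M (J - {i}) M \<Otimes>\<^sub>M M i)"
    by (simp add: comp_def case_prod_unfold)
  then show ?thesis by (rule borel_measurable_nn_integral)
qed

text \<open>Integrating out one coordinate \<open>i\<close> only affects the functions whose coordinate set contains \<open>i\<close>.
  Their weights sum up to one, so Hoelder's inequality in this coordinate replaces each of them by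
  its partial integral, and the covering condition persists for the remaining coordinates.\<close>
theorem Finner_inequality:
  fixes w :: "'b \<Rightarrow> real" and f :: "'b \<Rightarrow> ('i \<Rightarrow> 'a) \<Rightarrow> ennreal"
  assumes A: "finite A" "\<And>a. a \<in> A \<Longrightarrow> 0 < w a"
    and I: "finite I"
    and S: "\<And>a. a \<in> A \<Longrightarrow> S a \<subseteq> I"
    and cover: "\<And>i. i \<in> I \<Longrightarrow> (\<Sum>a\<in>{a\<in>A. i \<in> S a}. w a) = 1"
    and f: "\<And>a. a \<in> A \<Longrightarrow> f a \<in> borel_measurable (Pi\<^sub>M (S a) M)"
  shows "(\<integral>\<^sup>+x. (\<Prod>a\<in>A. epow (f a (restrict x (S a))) (w a)) \<partial>Pi\<^sub>M I M)
           \<le> (\<Prod>a\<in>A. epow (\<integral>\<^sup>+x. f a x \<partial>Pi\<^sub>M (S a) M) (w a))"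
  using I S cover f
proof (induction I arbitrary: S f rule: finite_induct)
  case empty
  have "S a = {}" if "a \<in> A" for a using empty.prems(1)[OF that] by auto
  then show ?case
    by (simp add: PiM_empty nn_integral_count_space_finite restrict_def cong: prod.cong)
next
  case (insert i I)
  define S' where "S' a = S a - {i}" for a
  define f' where "f' a = (if i \<in> S a then (\<lambda>y. \<integral>\<^sup>+u. f a (y(i := u)) \<partial>M i) else f a)" for a
  define A1 where "A1 = {a\<in>A. i \<in> S a}"
  have A1: "A1 \<subseteq> A" "finite A1" using A by (auto simp: A1_def)
  have S'0: "S' a = S a" if "a \<in> A - A1" for a using that by (auto simp: A1_def S'_def)
  have f'm: "f' a \<in> borel_measurable (Pi\<^sub>M (S' a) M)" if "a \<in> A" for a
  proof (cases "i \<in> S a")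
    case True
    show ?thesis
      unfolding f'_def S'_def if_P[OF True]
      by (rule borel_measurable_partial_nn_integral[OF True insert.prems(3)[OF that]])
  next
    case False
    then have "S a - {i} = S a" by auto
    then show ?thesis
      unfolding f'_def S'_def if_not_P[OF False] using insert.prems(3)[OF that] by (simp only:)
  qed
  have "(\<integral>\<^sup>+x. (\<Prod>a\<in>A. epow (f a (restrict x (S a))) (w a)) \<partial>Pi\<^sub>M (insert i I) M)
     = (\<integral>\<^sup>+x. \<integral>\<^sup>+u. (\<Prod>a\<in>A. epow (f a (restrict (x(i := u)) (S a))) (w a)) \<partial>M i \<partial>Pi\<^sub>M I M)"
  proof (rule product_nn_integral_insert[OF insert.hyps])
    have "(\<lambda>x. f a (restrict x (S a))) \<in> borel_measurable (Pi\<^sub>M (insert i I) M)" if "a \<in> A" for a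
      using measurable_comp[OF measurable_restrict_subset[OF insert.prems(1)[OF that]]
          insert.prems(3)[OF that]] by (simp add: comp_def)
    then show "(\<lambda>x. \<Prod>a\<in>A. epow (f a (restrict x (S a))) (w a))
        \<in> borel_measurable (Pi\<^sub>M (insert i I) M)" by measurable
  qed
  also have "\<dots> \<le> (\<integral>\<^sup>+x. (\<Prod>a\<in>A. epow (f' a (restrict x (S' a))) (w a)) \<partial>Pi\<^sub>M I M)"
  proof (rule nn_integral_mono)
    fix x assume x: "x \<in> space (Pi\<^sub>M I M)"
    define c where "c = (\<Prod>a\<in>A - A1. epow (f' a (restrict x (S' a))) (w a))"
    have split: "(\<Prod>a\<in>A. g a) = (\<Prod>a\<in>A - A1. g a) * (\<Prod>a\<in>A1. g a)" for g :: "'b \<Rightarrow> ennreal"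
      using A1 A(1) by (simp add: prod.subset_diff)
    have meas: "(\<lambda>u. f a ((restrict x (S' a))(i := u))) \<in> borel_measurable (M i)" if "a \<in> A1" for a
    proof -
      have a: "a \<in> A" "i \<in> S a" using that by (auto simp: A1_def)
      have eq: "insert i (S' a) = S a" using a by (auto simp: S'_def)
      have "restrict x (S' a) \<in> space (Pi\<^sub>M (S' a) M)"
        using x insert.prems(1)[OF a(1)] by (auto simp: space_PiM S'_def)
      then
      have "fun_upd (restrict x (S' a)) i \<in> M i \<rightarrow>\<^sub>M Pi\<^sub>M (insert i (S' a)) M"
        by (rule measurable_component_update) (auto simp: S'_def)
      from measurable_comp[OF this[unfolded eq] insert.prems(3)[OF a(1)]]
      show ?thesis by (simp add: comp_def)
    qed
    have eq1: "f a (restrict (x(i := u)) (S a)) = f a ((restrict x (S' a))(i := u))" if "a \<in> A1" for a u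
      using that restrict_fun_upd_in[of i "S a" x u] by (simp only: A1_def S'_def mem_Collect_eq)
    have eq2: "f a (restrict (x(i := u)) (S a)) = f' a (restrict x (S' a))" if "a \<in> A - A1" for a u
    proof -
      have "i \<notin> S a" using that by (auto simp: A1_def)
      then show ?thesis
        unfolding S'0[OF that] f'_def if_not_P[OF \<open>i \<notin> S a\<close>]
        by (rule arg_cong[OF restrict_fun_upd_notin])
    qed
    have eq3: "f' a y = (\<integral>\<^sup>+u. f a (y(i := u)) \<partial>M i)" if "a \<in> A1" for a y
      using that by (simp add: A1_def f'_def)
    have "(\<integral>\<^sup>+u. (\<Prod>a\<in>A. epow (f a (restrict (x(i := u)) (S a))) (w a)) \<partial>M i)
        = (\<integral>\<^sup>+u. c * (\<Prod>a\<in>A1. epow (f a ((restrict x (S' a))(i := u))) (w a)) \<partial>M i)"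
      unfolding split c_def by (simp only: eq1 eq2 cong: prod.cong)
    also have "\<dots> = c * (\<integral>\<^sup>+u. (\<Prod>a\<in>A1. epow (f a ((restrict x (S' a))(i := u))) (w a)) \<partial>M i)"
      using meas by (intro nn_integral_cmult) measurable
    also have "\<dots> \<le> c * (\<Prod>a\<in>A1. epow (\<integral>\<^sup>+u. f a ((restrict x (S' a))(i := u)) \<partial>M i) (w a))"
      using meas A1 A(2) insert.prems(2)[of i]
      by (intro mult_left_mono nn_integral_Hoelder) (auto simp: A1_def)
    also have "\<dots> = (\<Prod>a\<in>A. epow (f' a (restrict x (S' a))) (w a))"
      unfolding split c_def by (simp only: eq3 cong: prod.cong)
    finally show "(\<integral>\<^sup>+u. (\<Prod>a\<in>A. epow (f a (restrict (x(i := u)) (S a))) (w a)) \<partial>M i)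
        \<le> (\<Prod>a\<in>A. epow (f' a (restrict x (S' a))) (w a))" .
  qed
  also have "\<dots> \<le> (\<Prod>a\<in>A. epow (\<integral>\<^sup>+x. f' a x \<partial>Pi\<^sub>M (S' a) M) (w a))"
  proof (rule insert.IH[OF _ _ f'm])
    show "S' a \<subseteq> I" if "a \<in> A" for a using insert.prems(1)[OF that] by (auto simp: S'_def)
    show "(\<Sum>a\<in>{a\<in>A. m \<in> S' a}. w a) = 1" if "m \<in> I" for m
    proof -
      have "{a\<in>A. m \<in> S' a} = {a\<in>A. m \<in> S a}" using that insert.hyps by (auto simp: S'_def)
      then show ?thesis using insert.prems(2)[of m] that by simp
    qed
  qed
  also have "\<dots> = (\<Prod>a\<in>A. epow (\<integral>\<^sup>+x. f a x \<partial>Pi\<^sub>M (S a) M) (w a))"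
  proof (intro prod.cong refl arg_cong2[of _ _ _ _ epow])
    fix a assume a: "a \<in> A"
    show "(\<integral>\<^sup>+x. f' a x \<partial>Pi\<^sub>M (S' a) M) = (\<integral>\<^sup>+x. f a x \<partial>Pi\<^sub>M (S a) M)"
    proof (cases "i \<in> S a")
      case True
      have "insert i (S' a) = S a" using True by (auto simp: S'_def)
      moreover have "finite (S' a)" using insert.prems(1)[OF a] insert.hyps(1)
        by (auto simp: S'_def intro: finite_subset)
      ultimately show ?thesis
        using product_nn_integral_insert[of "S' a" i "f a"] insert.prems(3)[OF a] True
        by (simp add: f'_def S'_def)
    qed (auto simp: f'_def S'_def)
  qed
  finally show ?case .
qed

end

section \<open>From indicator functions to strong type bounds\<close>

text \<open>The estimate of an average applied to indicator functions, where \<open>measure M E\<close> is the trivial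
  bound and the minimum is the gain over it.\<close>
definition restricted_type ::
    "'a measure \<Rightarrow> 't measure \<Rightarrow> ('a \<Rightarrow> 't \<Rightarrow> 'a) \<Rightarrow> real \<Rightarrow> real \<Rightarrow> real \<Rightarrow> bool" where
  "restricted_type M \<nu> \<phi> b \<eta> K \<longleftrightarrow> (\<forall>E\<in>sets M. emeasure M E < \<infinity> \<longrightarrow>
      (pow_integral M b (shift_avg \<nu> \<phi> (indicator E)))
        \<le> ennreal (measure M E * min 1 ((K * measure M E) powr \<eta>)))"

lemma restricted_type_mono:
  assumes "restricted_type M \<nu> \<phi> b \<eta> K" "0 < \<eta>'" "\<eta>' \<le> \<eta>" "0 \<le> K" "K \<le> K'"
  shows "restricted_type M \<nu> \<phi> b \<eta>' K'"
  unfolding restricted_type_def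
proof (intro ballI impI)
  fix E assume E: "E \<in> sets M" "emeasure M E < \<infinity>"
  define e where "e = measure M E"
  have e: "0 \<le> e" by (simp add: e_def)
  have "min 1 ((K * e) powr \<eta>) \<le> min 1 ((K * e) powr \<eta>')"
  proof (cases "K * e \<le> 1")
    case True
    then have "(K * e) powr \<eta> \<le> (K * e) powr \<eta>'"
      using assms e by (intro powr_mono') auto
    then show ?thesis by simp
  next
    case False
    then show ?thesis using assms by (simp add: ge_one_powr_ge_zero)
  qed
  also have "\<dots> \<le> min 1 ((K' * e) powr \<eta>')"
    using assms e by (intro min.mono powr_mono2 mult_right_mono) auto
  finally have "e * min 1 ((K * e) powr \<eta>) \<le> e * min 1 ((K' * e) powr \<eta>')"
    using e by (rule mult_left_mono)
  then show "pow_integral M b (shift_avg \<nu> \<phi> (indicator E))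
        \<le> ennreal (measure M E * min 1 ((K' * measure M E) powr \<eta>'))"
    using assms(1) E unfolding restricted_type_def e_def
    by (meson ennreal_leI order_trans)
qed

lemma nn_integral_powr_at_0:
  assumes "0 < c" "0 < T"
  shows "(\<integral>\<^sup>+t. ennreal (t powr (c - 1)) * indicator {0<..T} t \<partial>lborel) = ennreal (T powr c / c)"
proof -
  have "((\<lambda>t. t powr (c - 1)) has_integral (T powr c / c - 0 powr c / c)) {0..T}"
    using assms
    by (intro fundamental_theorem_of_calculus_interior)
       (auto intro!: continuous_on_divide continuous_on_powr' continuous_on_id continuous_on_const derivative_eq_intros
             simp: has_real_derivative_iff_has_vector_derivative[symmetric])
  then have "(\<integral>\<^sup>+t. ennreal (t powr (c - 1)) * indicator {0..T} t \<partial>lborel) = ennreal (T powr c / c)"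
    by (intro nn_integral_has_integral_lebesgue') auto
  moreover have "(\<integral>\<^sup>+t. ennreal (t powr (c - 1)) * indicator {0<..T} t \<partial>lborel)
      = (\<integral>\<^sup>+t. ennreal (t powr (c - 1)) * indicator {0..T} t \<partial>lborel)"
    by (intro nn_integral_cong) (auto simp: indicator_def)
  ultimately show ?thesis by simp
qed

lemma nn_integral_powr_at_top:
  assumes "0 < c" "0 < T"
  shows "(\<integral>\<^sup>+t. ennreal (t powr (- c - 1)) * indicator {T..} t \<partial>lborel) = ennreal (T powr (- c) / c)"
proof -
  have "(\<integral>\<^sup>+t. ennreal (t powr (- c - 1)) * indicator {T..} t \<partial>lborel)
      = ennreal (0 - (- (T powr (- c) / c)))"
  proof (rule nn_integral_FTC_atLeast)
    show "((\<lambda>t. - (t powr (- c) / c)) has_real_derivative x powr (- c - 1)) (at x)" if "T \<le> x" for x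
      using assms that by (auto intro!: derivative_eq_intros)
    have "((\<lambda>t. - (t powr (- c) / c)) \<longlongrightarrow> - (0 / c)) at_top"
      using assms by (intro tendsto_intros tendsto_neg_powr filterlim_ident) auto
    then show "((\<lambda>t. - (t powr (- c) / c)) \<longlongrightarrow> 0) at_top" by simp
  qed auto
  then show ?thesis by simp
qed

lemma nn_integral_layer:
  fixes y :: ennreal
  shows "(\<integral>\<^sup>+\<tau>. indicator {\<tau>. 0 < \<tau> \<and> ennreal \<tau> < y} \<tau> \<partial>lborel) = y"
proof (cases y)
  case (real r)
  have "{\<tau>. 0 < \<tau> \<and> ennreal \<tau> < y} = {0<..<r}"
    using real by (auto simp: ennreal_less_iff)
  then show ?thesis using real by simp
next
  case top
  have "{\<tau>. 0 < \<tau> \<and> ennreal \<tau> < y} = {0<..}" using top by auto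
  moreover have "top \<le> emeasure lborel ({0<..} :: real set)"
    unfolding ennreal_SUP_of_nat_eq_top[symmetric]
  proof (rule SUP_least)
    fix n :: nat
    have "of_nat n = emeasure lborel {0<..real n}" by (simp add: ennreal_of_nat_eq_real_of_nat)
    also have "\<dots> \<le> emeasure lborel ({0<..} :: real set)" by (intro emeasure_mono) auto
    finally show "of_nat n \<le> emeasure lborel ({0<..} :: real set)" .
  qed
  ultimately show ?thesis using top by (simp add: top_unique)
qed

text \<open>The first factor is the total mass of the weight in the height variable, the second one bounds
  the two geometric tails; \<open>e\<close> is half of the smaller margin in the two conditions
  \<open>a < b < a * (1 + \<eta>)\<close>.\<close>
definition layer_const :: "real \<Rightarrow> real \<Rightarrow> real \<Rightarrow> real" where
  "layer_const a b \<eta> = (let e = min (b - a) (a * \<eta> - (b - a)) / 2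
     in (2 * (b - 1) / e) powr (b - 1) * (2 / e))"

text \<open>Write \<open>h\<close> as the integral of the indicator functions of its superlevel sets. With
  \<open>H = \<integral>h\<^sup>a\<close> the set at height \<open>\<tau>\<close> has measure at most \<open>H * \<tau> powr (- a)\<close>, so the
  contribution of the heights around \<open>\<tau>\<close> decays like a power of \<open>\<tau> / T\<close> on both sides of the critical
  height \<open>T = (K * H) powr (1 / a)\<close>: below \<open>T\<close> because of \<open>a < b\<close>, above \<open>T\<close> because of the gain and
  \<open>b < a * (1 + \<eta>)\<close>. This geometric decay allows the contributions to be summed, with a total
  of the size \<open>H * T powr (b - a)\<close>, which is the right hand side.\<close>
theorem strong_type_of_restricted_type:
  fixes \<phi> :: "'a \<Rightarrow> 't \<Rightarrow> 'a" and h :: "'a \<Rightarrow> ennreal"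
  assumes M: "sigma_finite_measure M" and \<nu>: "sigma_finite_measure \<nu>"
    and \<phi> [measurable]: "case_prod \<phi> \<in> M \<Otimes>\<^sub>M \<nu> \<rightarrow>\<^sub>M M"
    and ab: "1 < b" "0 < a" "a < b" "b < a * (1 + \<eta>)" and K: "0 < K"
    and restricted: "\<And>E. E \<in> sets M \<Longrightarrow> emeasure M E < \<infinity> \<Longrightarrow>
      (pow_integral M b (shift_avg \<nu> \<phi> (indicator E)))
        \<le> ennreal (measure M E * min 1 ((K * measure M E) powr \<eta>))"
    and h [measurable]: "h \<in> borel_measurable M"
  shows "pow_integral M b (shift_avg \<nu> \<phi> h)
    \<le> ennreal (layer_const a b \<eta> * K powr (b / a - 1)) * epow (pow_integral M a h) (b / a)"
proof -
  interpret M: sigma_finite_measure M by (rule M)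
  interpret \<nu>: sigma_finite_measure \<nu> by (rule \<nu>)
  interpret LM: pair_sigma_finite M "lborel :: real measure" ..
  interpret L\<nu>: pair_sigma_finite \<nu> "lborel :: real measure" ..
  define \<gamma> where "\<gamma> = b - a"
  define \<theta> where "\<theta> = a * \<eta> - \<gamma>"
  define e where "e = min \<gamma> \<theta> / 2"
  define \<epsilon> where "\<epsilon> = e / (b - 1)"
  have pos: "0 < \<gamma>" "0 < \<theta>" "0 < e" "0 < \<epsilon>" "e \<le> \<gamma> - e" "e \<le> \<theta> - e"
    using ab by (auto simp: \<gamma>_def \<theta>_def e_def \<epsilon>_def min_def algebra_simps)
  have eb: "\<epsilon> * (b - 1) = e" using ab by (simp add: \<epsilon>_def)
  have \<eta>: "0 < \<eta>" using pos ab unfolding \<theta>_def by (smt (verit) mult_nonneg_nonpos)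
  have C: "layer_const a b \<eta> = (2 / \<epsilon>) powr (b - 1) * (2 / e)"
    by (simp add: layer_const_def Let_def e_def \<epsilon>_def \<gamma>_def \<theta>_def)
  have Cpos: "0 < layer_const a b \<eta>" unfolding C using pos by simp
  define Hn where "Hn = pow_integral M a h"
  show ?thesis
  proof (cases "Hn = \<infinity>")
    case True
    have "ennreal (layer_const a b \<eta> * K powr (b / a - 1)) \<noteq> 0"
      using Cpos K by (simp add: ennreal_eq_0_iff not_le)
    then show ?thesis using True by (simp add: Hn_def[symmetric] ennreal_mult_top)
  next
    case False
    then obtain H where H: "Hn = ennreal H" "0 \<le> H" by (cases Hn) auto
    \<comment> \<open>If \<open>H = 0\<close>, then all layers are null sets and any positive value of \<open>T\<close> will do.\<close>
    define T where "T = (if H = 0 then 1 else (K * H) powr (1 / a))"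
    have T: "0 < T" using H K by (auto simp: T_def)
    have TH: "T powr a = K * H" if "H \<noteq> 0"
      using that H K ab by (simp add: T_def powr_powr)
    \<comment> \<open>The weight is integrable on all scales around \<open>T\<close>, while \<open>v powr (1 - b)\<close> exceeds the scale
      invariant \<open>\<tau> powr (b - 1)\<close> only by a small power of the distance from \<open>T\<close>, which the decay of
      the layers absorbs.\<close>
    define v where "v \<tau> = (if \<tau> \<le> 0 then 0 else if \<tau> \<le> T then \<tau> powr (\<epsilon> - 1) * T powr (- \<epsilon>)
        else \<tau> powr (- \<epsilon> - 1) * T powr \<epsilon>)" for \<tau>
    have [measurable]: "v \<in> borel_measurable borel" unfolding v_def by measurable
    have v0: "0 \<le> v \<tau>" for \<tau> by (simp add: v_def)
    have vpos: "0 < v \<tau>" if "0 < \<tau>" for \<tau> using that T by (simp add: v_def)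
    have v_int: "(\<integral>\<^sup>+\<tau>. ennreal (v \<tau>) \<partial>lborel) \<le> ennreal (2 / \<epsilon>)"
    proof -
      have "(\<integral>\<^sup>+\<tau>. ennreal (v \<tau>) \<partial>lborel) \<le>
         (\<integral>\<^sup>+\<tau>. ennreal (T powr (- \<epsilon>)) * (ennreal (\<tau> powr (\<epsilon> - 1)) * indicator {0<..T} \<tau>)
           + ennreal (T powr \<epsilon>) * (ennreal (\<tau> powr (- \<epsilon> - 1)) * indicator {T..} \<tau>) \<partial>lborel)"
      proof (intro nn_integral_mono)
        fix \<tau> :: real
        consider "\<tau> \<le> 0" | "0 < \<tau>" "\<tau> \<le> T" | "0 < \<tau>" "T < \<tau>" by linarith
        then show "ennreal (v \<tau>)
            \<le> ennreal (T powr (- \<epsilon>)) * (ennreal (\<tau> powr (\<epsilon> - 1)) * indicator {0<..T} \<tau>)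
           + ennreal (T powr \<epsilon>) * (ennreal (\<tau> powr (- \<epsilon> - 1)) * indicator {T..} \<tau>)"
        proof cases
          case 2
          then show ?thesis by (simp add: v_def ennreal_mult mult.commute)
        next
          case 3
          then show ?thesis by (simp add: v_def ennreal_mult mult.commute)
        qed (simp add: v_def)
      qed
      also have "\<dots> = ennreal (T powr (- \<epsilon>)) * ennreal (T powr \<epsilon> / \<epsilon>)
          + ennreal (T powr \<epsilon>) * ennreal (T powr (- \<epsilon>) / \<epsilon>)"
        using pos T
        by (simp add: nn_integral_add nn_integral_cmult nn_integral_powr_at_0 nn_integral_powr_at_top)
      also have "\<dots> = ennreal (1 / \<epsilon> + 1 / \<epsilon>)"
        using pos T by (simp add: ennreal_mult[symmetric] powr_add[symmetric] flip: ennreal_plus)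
      finally show ?thesis by simp
    qed
    define g where "g x \<tau> = (\<integral>\<^sup>+t. indicator {\<tau>. 0 < \<tau> \<and> ennreal \<tau> < h (\<phi> x t)} \<tau> \<partial>\<nu>)" for x \<tau>
    have [measurable]: "(\<lambda>(x, \<tau>). g x \<tau>) \<in> borel_measurable (M \<Otimes>\<^sub>M lborel)"
      unfolding g_def by measurable
    have Ah: "(shift_avg \<nu> \<phi> h x) = (\<integral>\<^sup>+\<tau>. g x \<tau> \<partial>lborel)" if x: "x \<in> space M" for x
    proof -
      have [measurable]: "\<phi> x \<in> \<nu> \<rightarrow>\<^sub>M M" using x by measurable
      have "(shift_avg \<nu> \<phi> h x)
          = (\<integral>\<^sup>+t. (\<integral>\<^sup>+\<tau>. indicator {\<tau>. 0 < \<tau> \<and> ennreal \<tau> < h (\<phi> x t)} \<tau> \<partial>lborel) \<partial>\<nu>)"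
        by (simp add: nn_integral_layer)
      also have "\<dots> = (\<integral>\<^sup>+\<tau>. g x \<tau> \<partial>lborel)"
        unfolding g_def by (rule L\<nu>.Fubini'[symmetric]) measurable
      finally show ?thesis .
    qed
    have g0: "g x \<tau> = 0" if "\<tau> \<le> 0" for x \<tau> using that by (simp add: g_def)
    define W where "W x = (\<integral>\<^sup>+\<tau>. epow (g x \<tau>) b * ennreal (v \<tau> powr (1 - b)) \<partial>lborel)" for x
    have pw: "epow (shift_avg \<nu> \<phi> h x) b \<le> ennreal ((2 / \<epsilon>) powr (b - 1)) * W x"
      if x: "x \<in> space M" for x
    proof -
      have [measurable]: "g x \<in> borel_measurable borel"
        using measurable_Pair2[of "\<lambda>(x, \<tau>). g x \<tau>" M lborel borel x] x by simp
      define f where "f s \<tau> = (if s then ennreal (v \<tau>) else epow (g x \<tau>) b * ennreal (v \<tau> powr (1 - b)))" for s \<tau>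
      define w where "w s = (if s then 1 - 1 / b else 1 / b)" for s
      have "(\<integral>\<^sup>+\<tau>. g x \<tau> \<partial>lborel) = (\<integral>\<^sup>+\<tau>. (\<Prod>s\<in>UNIV. epow (f s \<tau>) (w s)) \<partial>lborel)"
      proof (intro nn_integral_cong)
        fix \<tau> :: real
        show "g x \<tau> = (\<Prod>s\<in>UNIV. epow (f s \<tau>) (w s))"
        proof (cases "0 < \<tau>")
          case True
          have "v \<tau> powr (1 - 1 / b) * v \<tau> powr ((1 - b) * (1 / b)) = 1"
            using vpos[OF True] ab by (simp add: powr_add[symmetric] field_simps)
          then have "ennreal (v \<tau> powr (1 - 1 / b)) * ennreal (v \<tau> powr ((1 - b) * (1 / b))) = 1"
            by (simp add: ennreal_mult[symmetric])
          then show ?thesis using v0[of \<tau>] ab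
            by (simp add: UNIV_bool f_def w_def epow_mult epow_epow powr_powr mult.commute mult.left_commute)
        qed (simp add: UNIV_bool f_def g0)
      qed
      also have "\<dots> \<le> (\<Prod>s\<in>UNIV. epow (\<integral>\<^sup>+\<tau>. f s \<tau> \<partial>lborel) (w s))"
        using ab by (intro nn_integral_Hoelder) (auto simp: w_def UNIV_bool f_def)
      also have "\<dots> = epow (\<integral>\<^sup>+\<tau>. ennreal (v \<tau>) \<partial>lborel) (1 - 1 / b) * epow (W x) (1 / b)"
        by (simp add: UNIV_bool f_def w_def W_def mult.commute)
      finally have "epow (shift_avg \<nu> \<phi> h x) b
          \<le> epow (epow (\<integral>\<^sup>+\<tau>. ennreal (v \<tau>) \<partial>lborel) (1 - 1 / b) * epow (W x) (1 / b)) b"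
        unfolding Ah[OF x] using ab by (intro epow_mono) auto
      also have "\<dots> = epow (\<integral>\<^sup>+\<tau>. ennreal (v \<tau>) \<partial>lborel) (b - 1) * W x"
        using ab by (simp add: epow_mult epow_epow algebra_simps)
      also have "\<dots> \<le> epow (ennreal (2 / \<epsilon>)) (b - 1) * W x"
        using v_int ab by (intro mult_right_mono epow_mono) auto
      finally show ?thesis using pos by simp
    qed
    define Bd where "Bd \<tau> = (if \<tau> \<le> T then H * \<tau> powr (- a)
        else H * (T powr (a * \<eta>) * \<tau> powr (- (a * \<eta>) - a)))" for \<tau>
    have layer: "(\<integral>\<^sup>+x. epow (g x \<tau>) b \<partial>M) \<le> ennreal (Bd \<tau>)" if \<tau>: "0 < \<tau>" for \<tau>
    proof -
      define E where "E = {x\<in>space M. ennreal \<tau> < h x}"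
      have E [measurable]: "E \<in> sets M" unfolding E_def by measurable
      have "emeasure M E \<le> emeasure M {x\<in>space M. 1 \<le> ennreal (\<tau> powr (- a)) * epow (h x) a}"
      proof (rule emeasure_mono, safe)
        fix x assume "x \<in> E"
        then show "x \<in> space M" by (simp add: E_def)
        have "epow (ennreal \<tau>) a \<le> epow (h x) a"
          using \<open>x \<in> E\<close> ab by (intro epow_mono) (auto simp: E_def)
        then have "ennreal (\<tau> powr (- a)) * ennreal (\<tau> powr a) \<le> ennreal (\<tau> powr (- a)) * epow (h x) a"
          using \<tau> by (intro mult_left_mono) auto
        moreover have "ennreal (\<tau> powr (- a)) * ennreal (\<tau> powr a) = 1"
          using \<tau> by (simp add: ennreal_mult[symmetric] powr_add[symmetric])
        ultimately show "1 \<le> ennreal (\<tau> powr (- a)) * epow (h x) a" by simp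
      qed measurable
      also have "\<dots> \<le> ennreal (\<tau> powr (- a)) * (\<integral>\<^sup>+x. epow (h x) a * indicator (space M) x \<partial>M)"
        using nn_integral_Markov_inequality[of "\<lambda>x. epow (h x) a" "space M" M "ennreal (\<tau> powr (- a))"]
        by simp
      also have "\<dots> = ennreal (\<tau> powr (- a)) * Hn"
        unfolding Hn_def by (intro arg_cong2[of _ _ _ _ "(*)"] refl nn_integral_cong) auto
      also have "\<dots> = ennreal (H * \<tau> powr (- a))" using H by (simp add: ennreal_mult mult.commute)
      finally have Em: "emeasure M E \<le> ennreal (H * \<tau> powr (- a))" .
      then have Efin: "emeasure M E < \<infinity>" using order.strict_trans1 by fastforce
      have em: "measure M E \<le> H * \<tau> powr (- a)"
        using Em Efin H by (simp add: measure_def enn2real_leI)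
      have "(\<integral>\<^sup>+x. epow (g x \<tau>) b \<partial>M) = pow_integral M b (shift_avg \<nu> \<phi> (indicator E))"
      proof (intro nn_integral_cong arg_cong2[of _ _ _ _ epow] refl)
        fix x assume x: "x \<in> space M"
        have "\<phi> x \<in> \<nu> \<rightarrow>\<^sub>M M" using x by measurable
        then show "g x \<tau> = (\<integral>\<^sup>+t. indicator E (\<phi> x t) \<partial>\<nu>)"
          unfolding g_def using \<tau>
          by (intro nn_integral_cong) (auto simp: indicator_def E_def dest: measurable_space)
      qed
      also have "\<dots> \<le> ennreal (measure M E * min 1 ((K * measure M E) powr \<eta>))"
        by (rule restricted[OF E Efin])
      also have "\<dots> \<le> ennreal (Bd \<tau>)"
      proof (rule ennreal_leI)
        show "measure M E * min 1 ((K * measure M E) powr \<eta>) \<le> Bd \<tau>"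
        proof (cases "\<tau> \<le> T")
          case True
          have "measure M E * min 1 ((K * measure M E) powr \<eta>) \<le> measure M E * 1"
            by (intro mult_left_mono) auto
          then show ?thesis using em True by (simp add: Bd_def)
        next
          case False
          have "measure M E * min 1 ((K * measure M E) powr \<eta>)
              \<le> (H * \<tau> powr (- a)) * (K * (H * \<tau> powr (- a))) powr \<eta>"
            using em K \<eta> H
            by (intro mult_mono order_trans[OF min.cobounded2] powr_mono2 mult_left_mono) auto
          also have "\<dots> = Bd \<tau>"
          proof (cases "H = 0")
            case False
            have eq: "K * (H * \<tau> powr (- a)) = T powr a * \<tau> powr (- a)" by (simp add: TH[OF False])
            then have "(K * (H * \<tau> powr (- a))) powr \<eta> = T powr (a * \<eta>) * \<tau> powr (- (a * \<eta>))"
              by (subst eq) (use T \<tau> in \<open>simp add: powr_mult powr_powr\<close>)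
            then show ?thesis using \<open>\<not> \<tau> \<le> T\<close>
              by (simp add: Bd_def powr_diff powr_minus divide_inverse)
          qed (use \<open>\<not> \<tau> \<le> T\<close> in \<open>simp add: Bd_def\<close>)
          finally show ?thesis .
        qed
      qed
      finally show ?thesis .
    qed
    have "pow_integral M b (shift_avg \<nu> \<phi> h)
        \<le> (\<integral>\<^sup>+x. ennreal ((2 / \<epsilon>) powr (b - 1)) * W x \<partial>M)"
      by (intro nn_integral_mono pw)
    also have "\<dots> = ennreal ((2 / \<epsilon>) powr (b - 1)) * (\<integral>\<^sup>+x. W x \<partial>M)"
      unfolding W_def by (intro nn_integral_cmult) measurable
    also have "(\<integral>\<^sup>+x. W x \<partial>M)
        = (\<integral>\<^sup>+\<tau>. (\<integral>\<^sup>+x. epow (g x \<tau>) b * ennreal (v \<tau> powr (1 - b)) \<partial>M) \<partial>lborel)"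
      unfolding W_def by (rule LM.Fubini'[symmetric]) measurable
    also have "\<dots> = (\<integral>\<^sup>+\<tau>. (\<integral>\<^sup>+x. epow (g x \<tau>) b \<partial>M) * ennreal (v \<tau> powr (1 - b)) \<partial>lborel)"
      by (intro nn_integral_cong nn_integral_multc) measurable
    also have "\<dots> \<le> (\<integral>\<^sup>+\<tau>. ennreal (H * T powr e) * (ennreal (\<tau> powr ((\<gamma> - e) - 1)) * indicator {0<..T} \<tau>)
        + ennreal (H * T powr (a * \<eta> - e)) * (ennreal (\<tau> powr (- (\<theta> - e) - 1)) * indicator {T..} \<tau>) \<partial>lborel)"
    proof (intro nn_integral_mono)
      fix \<tau> :: real
      show "(\<integral>\<^sup>+x. epow (g x \<tau>) b \<partial>M) * ennreal (v \<tau> powr (1 - b))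
        \<le> ennreal (H * T powr e) * (ennreal (\<tau> powr ((\<gamma> - e) - 1)) * indicator {0<..T} \<tau>)
        + ennreal (H * T powr (a * \<eta> - e)) * (ennreal (\<tau> powr (- (\<theta> - e) - 1)) * indicator {T..} \<tau>)"
        (is "_ \<le> ?R")
      proof (cases "0 < \<tau>")
        case False
        then show ?thesis by (simp add: g0)
      next
        case True
        have "(\<integral>\<^sup>+x. epow (g x \<tau>) b \<partial>M) * ennreal (v \<tau> powr (1 - b))
            \<le> ennreal (Bd \<tau>) * ennreal (v \<tau> powr (1 - b))"
          by (intro mult_right_mono layer True) auto
        also have "\<dots> = ennreal (Bd \<tau> * v \<tau> powr (1 - b))"
          by (simp add: ennreal_mult'' )
        also have "\<dots> \<le> ?R"
        proof (cases "\<tau> \<le> T")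
          case le: True
          have "v \<tau> powr (1 - b) = \<tau> powr ((\<epsilon> - 1) * (1 - b)) * T powr (- \<epsilon> * (1 - b))"
            using True le T by (simp add: v_def powr_mult powr_powr)
          also have "(\<epsilon> - 1) * (1 - b) = b - 1 - e" by (simp add: eb[symmetric] algebra_simps)
          also have "- \<epsilon> * (1 - b) = e" by (simp add: eb[symmetric] algebra_simps)
          finally have "Bd \<tau> * v \<tau> powr (1 - b) = H * T powr e * (\<tau> powr (- a) * \<tau> powr (b - 1 - e))"
            using le by (simp add: Bd_def)
          also have "\<tau> powr (- a) * \<tau> powr (b - 1 - e) = \<tau> powr ((\<gamma> - e) - 1)"
            by (simp add: powr_add[symmetric] \<gamma>_def algebra_simps)
          finally show ?thesis using le True H by (simp add: ennreal_mult mult.assoc)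
        next
          case gt: False
          have "v \<tau> powr (1 - b) = \<tau> powr ((- \<epsilon> - 1) * (1 - b)) * T powr (\<epsilon> * (1 - b))"
            using True gt T by (simp add: v_def powr_mult powr_powr)
          also have "(- \<epsilon> - 1) * (1 - b) = b - 1 + e" by (simp add: eb[symmetric] algebra_simps)
          also have "\<epsilon> * (1 - b) = - e" by (simp add: eb[symmetric] algebra_simps)
          finally have "Bd \<tau> * v \<tau> powr (1 - b) = H * (T powr (a * \<eta>) * T powr (- e)) *
              (\<tau> powr (- (a * \<eta>) - a) * \<tau> powr (b - 1 + e))"
            using gt by (simp add: Bd_def)
          also have "\<tau> powr (- (a * \<eta>) - a) * \<tau> powr (b - 1 + e) = \<tau> powr (- (\<theta> - e) - 1)"
            by (simp add: powr_add[symmetric] \<gamma>_def \<theta>_def algebra_simps)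
          also have "T powr (a * \<eta>) * T powr (- e) = T powr (a * \<eta> - e)"
            by (simp add: powr_add[symmetric])
          finally show ?thesis using gt True H by (simp add: ennreal_mult mult.assoc)
        qed
        finally show ?thesis .
      qed
    qed
    also have "\<dots> = ennreal (H * T powr e) * ennreal (T powr (\<gamma> - e) / (\<gamma> - e))
        + ennreal (H * T powr (a * \<eta> - e)) * ennreal (T powr (- (\<theta> - e)) / (\<theta> - e))"
      using pos T by (simp add: nn_integral_add nn_integral_cmult nn_integral_powr_at_0
          nn_integral_powr_at_top del: minus_diff_eq)
    also have "\<dots> = ennreal (H * (T powr e * T powr (\<gamma> - e)) / (\<gamma> - e)
        + H * (T powr (a * \<eta> - e) * T powr (- (\<theta> - e))) / (\<theta> - e))"
      using pos T H by (simp add: ennreal_mult[symmetric] mult.assoc del: minus_diff_eq flip: ennreal_plus)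
    also have "\<dots> = ennreal (H * T powr \<gamma> * (1 / (\<gamma> - e) + 1 / (\<theta> - e)))"
    proof -
      have "T powr e * T powr (\<gamma> - e) = T powr \<gamma>" by (simp add: powr_add[symmetric])
      moreover have "T powr (a * \<eta> - e) * T powr (- (\<theta> - e)) = T powr \<gamma>"
        by (simp add: powr_add[symmetric] \<theta>_def)
      ultimately show ?thesis by (simp add: algebra_simps)
    qed
    also have "\<dots> \<le> ennreal (H * T powr \<gamma> * (2 / e))"
    proof (intro ennreal_leI mult_left_mono)
      have "1 / (\<gamma> - e) \<le> 1 / e" "1 / (\<theta> - e) \<le> 1 / e" using pos by (auto intro!: frac_le)
      then show "1 / (\<gamma> - e) + 1 / (\<theta> - e) \<le> 2 / e" by simp
    qed (use H in auto)
    also have "H * T powr \<gamma> = K powr (b / a - 1) * H powr (b / a)"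
    proof (cases "H = 0")
      case nz: False
      then have "0 < H" using H by simp
      have "T powr \<gamma> = (T powr a) powr (b / a - 1)"
        using ab by (simp add: powr_powr \<gamma>_def right_diff_distrib)
      also have "\<dots> = K powr (b / a - 1) * H powr (b / a - 1)"
        using K H by (simp add: TH[OF nz] powr_mult)
      finally show ?thesis using \<open>0 < H\<close> by (simp add: powr_diff)
    qed simp
    finally have "pow_integral M b (shift_avg \<nu> \<phi> h)
      \<le> ennreal ((2 / \<epsilon>) powr (b - 1)) * ennreal (K powr (b / a - 1) * H powr (b / a) * (2 / e))"
      by (simp add: mult_left_mono)
    also have "\<dots> = ennreal (layer_const a b \<eta> * K powr (b / a - 1)) * epow Hn (b / a)"
      using H pos by (simp add: C ennreal_mult[symmetric] mult_ac)
    finally show ?thesis by (simp add: Hn_def)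
  qed
qed

section \<open>The multilinear estimate from one-dimensional bounds\<close>

abbreviation product_avg ::
    "'t measure \<Rightarrow> ('k::finite \<Rightarrow> 'a \<Rightarrow> 't \<Rightarrow> 'a) \<Rightarrow> ('k \<Rightarrow> ('k \<Rightarrow> 'a) \<Rightarrow> ennreal) \<Rightarrow> ('k \<Rightarrow> 'a) \<Rightarrow> ennreal" where
  "product_avg \<nu> \<phi> F x \<equiv> \<integral>\<^sup>+t. (\<Prod>i\<in>UNIV. F i (x(i := \<phi> i (x i) t))) \<partial>\<nu>"

text \<open>The parameters satisfy \<open>a i / r i = b * (1 / r i - \<delta>)\<close>. After Hoelder's inequality in \<open>t\<close>, the
  \<open>i\<close>-th factor is a power of \<open>\<Phi> i = (A i (F i powr (r i / a i))) powr b\<close>, whose integral along a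
  line in the direction \<open>i\<close> is controlled by a power \<open>b / a i > 1\<close> of the mass \<open>Hf i\<close> of
  \<open>F i powr (r i)\<close> on this line. Dividing by the excess power of \<open>Hf i\<close> gives a function \<open>G i\<close> whose
  integral over the whole space is at most \<open>\<kappa> i\<close> times that of \<open>F i powr (r i)\<close>. What has been divided out is a power of
  \<open>Hf i\<close>, a function of the coordinates other than \<open>i\<close> with the same integral, and Finner's inequality
  applies to the functions \<open>G i\<close> and \<open>Hf i\<close> together: a coordinate \<open>m\<close> receives
  \<open>q * (1 / r i - \<delta>)\<close> from every \<open>G i\<close> and \<open>q * \<delta>\<close> from every \<open>Hf i\<close> with \<open>i \<noteq> m\<close>, in total one.\<close>
theorem multilinear_bound:
  fixes M :: "'a measure" and \<nu> :: "'t measure" and \<phi> :: "'k::finite \<Rightarrow> 'a \<Rightarrow> 't \<Rightarrow> 'a"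
    and F :: "'k \<Rightarrow> ('k \<Rightarrow> 'a) \<Rightarrow> ennreal" and r a \<kappa> :: "'k \<Rightarrow> real"
  assumes M: "sigma_finite_measure M" and \<nu>: "sigma_finite_measure \<nu>"
    and \<phi> [measurable]: "\<And>i. case_prod (\<phi> i) \<in> M \<Otimes>\<^sub>M \<nu> \<rightarrow>\<^sub>M M"
    and F [measurable]: "\<And>i. F i \<in> borel_measurable (cube M)"
    and r: "\<And>i. 0 < r i" and a: "\<And>i. 0 < a i" "\<And>i. a i < b" and q: "0 < q" and \<delta>: "0 < \<delta>"
    and a_eq: "\<And>i. a i = b * (1 - \<delta> * r i)"
    and sum_w: "(\<Sum>i\<in>UNIV. a i / r i) = 1"
    and sum_q: "(\<Sum>i\<in>UNIV. 1 / r i) = 1 / q + \<delta>"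
    and \<kappa>: "\<And>i. 0 < \<kappa> i"
    and one_dim: "\<And>i h. h \<in> borel_measurable M \<Longrightarrow>
      (pow_integral M b (shift_avg \<nu> (\<phi> i) h))
        \<le> ennreal (\<kappa> i) * epow (pow_integral M (a i) h) (b / a i)"
  shows "pow_integral (cube M) q (product_avg \<nu> \<phi> F)
    \<le> (\<Prod>i\<in>UNIV. ennreal (\<kappa> i powr (q * (1 / r i - \<delta>)))
        * epow (pow_integral (cube M) (r i) (F i)) (q / r i))"
proof -
  interpret M: sigma_finite_measure M by (rule M)
  interpret \<nu>: sigma_finite_measure \<nu> by (rule \<nu>)
  interpret P: product_sigma_finite "\<lambda>_::'k. M" by standard
  let ?X = "Pi\<^sub>M (UNIV :: 'k set) (\<lambda>_. M)"
  have b: "0 < b" using a[of undefined] by linarith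
  have upd [measurable]: "(\<lambda>(x, u). x(i := u)) \<in> ?X \<Otimes>\<^sub>M M \<rightarrow>\<^sub>M ?X" for i
    using measurable_add_dim[of i UNIV "\<lambda>_. M"] by simp
  define A where "A i x = (\<integral>\<^sup>+t. epow (F i (x(i := \<phi> i (x i) t))) (r i / a i) \<partial>\<nu>)" for i x
  have shift [measurable]: "(\<lambda>(x, t). F i (x(i := \<phi> i (x i) t))) \<in> borel_measurable (?X \<Otimes>\<^sub>M \<nu>)" for i
  proof -
    have "(\<lambda>z. \<phi> i (fst z i) (snd z)) \<in> ?X \<Otimes>\<^sub>M \<nu> \<rightarrow>\<^sub>M M"
    proof -
      have "(\<lambda>z. (fst z i, snd z)) \<in> ?X \<Otimes>\<^sub>M \<nu> \<rightarrow>\<^sub>M M \<Otimes>\<^sub>M \<nu>" by measurable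
      from measurable_compose[OF this \<phi>[of i]] show ?thesis by simp
    qed
    then have "(\<lambda>z. (fst z, \<phi> i (fst z i) (snd z))) \<in> ?X \<Otimes>\<^sub>M \<nu> \<rightarrow>\<^sub>M ?X \<Otimes>\<^sub>M M" by measurable
    from measurable_compose[OF measurable_compose[OF this upd[of i]] F[of i]]
    show ?thesis by (simp add: case_prod_unfold)
  qed
  have [measurable]: "A i \<in> borel_measurable ?X" for i
    unfolding A_def by measurable
  define \<Phi> where "\<Phi> i x = epow (A i x) b" for i x
  have [measurable]: "\<Phi> i \<in> borel_measurable ?X" for i unfolding \<Phi>_def by measurable
  define Hf where "Hf i y = (\<integral>\<^sup>+u. epow (F i (y(i := u))) (r i) \<partial>M)" for i y
  have Hfm: "Hf i \<in> borel_measurable (Pi\<^sub>M (UNIV - {i}) (\<lambda>_. M))" for i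
    unfolding Hf_def
    using P.borel_measurable_partial_nn_integral[of i UNIV "\<lambda>x. epow (F i x) (r i)"] by simp
  have [measurable]: "Hf i \<in> borel_measurable ?X" for i
    unfolding Hf_def using upd[of i] F[of i] by measurable
  have Hf_int: "(\<integral>\<^sup>+y. Hf i y \<partial>Pi\<^sub>M (UNIV - {i}) (\<lambda>_. M)) = pow_integral ?X (r i) (F i)" for i
    unfolding Hf_def
    using P.product_nn_integral_insert[of "UNIV - {i}" i "\<lambda>x. epow (F i x) (r i)"] by (simp add: insert_UNIV)
  have Hf_upd: "Hf i (x(i := u)) = Hf i x" for i x u by (simp add: Hf_def)
  have Hf_restrict: "Hf i (restrict x (UNIV - {i})) = Hf i x" for i x
    unfolding Hf_def by (intro nn_integral_cong arg_cong2[of _ _ _ _ epow] refl arg_cong[of _ _ "F i"]) auto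
  define c where "c i = b / a i - 1" for i
  have c: "0 < c i" for i using a[of i] by (simp add: c_def)
  have slice: "(\<integral>\<^sup>+u. \<Phi> i (x(i := u)) \<partial>M) \<le> ennreal (\<kappa> i) * epow (Hf i x) (b / a i)"
    if x: "x \<in> space ?X" for i x
  proof -
    have m: "(\<lambda>u. epow (F i (x(i := u))) (r i / a i)) \<in> borel_measurable M"
    proof -
      have "(\<lambda>u. x(i := u)) \<in> M \<rightarrow>\<^sub>M ?X"
        using measurable_Pair2[OF upd[of i] x] by simp
      then show ?thesis using F[of i] by measurable
    qed
    have "(\<integral>\<^sup>+u. \<Phi> i (x(i := u)) \<partial>M)
        = (\<integral>\<^sup>+u. epow (\<integral>\<^sup>+t. epow (F i (x(i := \<phi> i u t))) (r i / a i) \<partial>\<nu>) b \<partial>M)"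
      by (simp add: \<Phi>_def A_def)
    also have "\<dots> \<le> ennreal (\<kappa> i)
        * epow (\<integral>\<^sup>+u. epow (epow (F i (x(i := u))) (r i / a i)) (a i) \<partial>M) (b / a i)"
      by (rule one_dim[OF m])
    also have "\<dots> = ennreal (\<kappa> i) * epow (Hf i x) (b / a i)"
      using a(1)[of i] by (simp add: epow_epow Hf_def)
    finally show ?thesis .
  qed
  \<comment> \<open>On lines of infinite mass \<open>G i\<close> is infinite, so that both inequalities below hold there as well.\<close>
  define G where "G i x = (if Hf i x = \<infinity> then \<infinity> else \<Phi> i x / epow (Hf i x) (c i))" for i x
  have [measurable]: "G i \<in> borel_measurable ?X" for i unfolding G_def by measurable
  have G_slice: "(\<integral>\<^sup>+u. G i (x(i := u)) \<partial>M) \<le> ennreal (\<kappa> i) * Hf i x"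
    if x: "x \<in> space ?X" for i x
  proof (cases "Hf i x = \<infinity>")
    case True
    then show ?thesis using \<kappa>[of i] by (simp add: ennreal_mult_top)
  next
    case fin: False
    have [measurable]: "(\<lambda>u. \<Phi> i (x(i := u))) \<in> borel_measurable M"
    proof -
      have "(\<lambda>u. x(i := u)) \<in> M \<rightarrow>\<^sub>M ?X"
        using measurable_Pair2[OF upd[of i] x] by simp
      then show ?thesis by measurable
    qed
    have "(\<integral>\<^sup>+u. G i (x(i := u)) \<partial>M) = (\<integral>\<^sup>+u. \<Phi> i (x(i := u)) \<partial>M) / epow (Hf i x) (c i)"
      using fin by (simp add: G_def Hf_upd nn_integral_divide)
    also have "\<dots> \<le> (ennreal (\<kappa> i) * epow (Hf i x) (b / a i)) / epow (Hf i x) (c i)"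
      by (intro divide_right_mono_ennreal slice x)
    also have "\<dots> \<le> ennreal (\<kappa> i) * Hf i x"
    proof (cases "Hf i x = 0")
      case False
      have "epow (Hf i x) (b / a i) = Hf i x * epow (Hf i x) (c i)"
        using epow_add[of "Hf i x" 1 "c i"] by (simp add: c_def)
      then have "ennreal (\<kappa> i) * epow (Hf i x) (b / a i) = (ennreal (\<kappa> i) * Hf i x) * epow (Hf i x) (c i)"
        by (simp add: mult.assoc)
      then show ?thesis using False fin by (simp add: mult_divide_eq_ennreal)
    qed simp
    finally show ?thesis .
  qed
  have G_int: "(\<integral>\<^sup>+x. G i x \<partial>?X) \<le> ennreal (\<kappa> i) * pow_integral ?X (r i) (F i)" for i
  proof -
    have "(\<integral>\<^sup>+x. G i x \<partial>?X) = (\<integral>\<^sup>+y. \<integral>\<^sup>+u. G i (y(i := u)) \<partial>M \<partial>Pi\<^sub>M (UNIV - {i}) (\<lambda>_. M))"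
      using P.product_nn_integral_insert[of "UNIV - {i}" i "G i"] by (simp add: insert_UNIV)
    also have "\<dots> \<le> (\<integral>\<^sup>+y. ennreal (\<kappa> i) * Hf i y \<partial>Pi\<^sub>M (UNIV - {i}) (\<lambda>_. M))"
    proof (rule nn_integral_mono)
      fix y assume y: "y \<in> space (Pi\<^sub>M (UNIV - {i}) (\<lambda>_. M))"
      show "(\<integral>\<^sup>+u. G i (y(i := u)) \<partial>M) \<le> ennreal (\<kappa> i) * Hf i y"
      proof (cases "space M = {}")
        case True
        then show ?thesis by (simp add: nn_integral_empty)
      next
        case False
        then obtain u0 where u0: "u0 \<in> space M" by auto
        then have "y(i := u0) \<in> space ?X" using y by (auto simp: space_PiM PiE_def)
        from G_slice[OF this, of i] show ?thesis by (simp add: Hf_upd)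
      qed
    qed
    also have "\<dots> = ennreal (\<kappa> i) * pow_integral ?X (r i) (F i)"
      using Hfm by (simp add: nn_integral_cmult Hf_int)
    finally show ?thesis .
  qed
  \<comment> \<open>On a line of mass zero \<open>\<Phi> i\<close> need not vanish, but its integral along the line does.\<close>
  have \<Phi>_le: "AE x in ?X. \<Phi> i x \<le> G i x * epow (Hf i x) (c i)" for i
  proof -
    have "(\<integral>\<^sup>+x. (if Hf i x = 0 then \<Phi> i x else 0) \<partial>?X)
        = (\<integral>\<^sup>+y. \<integral>\<^sup>+u. (if Hf i y = 0 then \<Phi> i (y(i := u)) else 0) \<partial>M \<partial>Pi\<^sub>M (UNIV - {i}) (\<lambda>_. M))"
      using P.product_nn_integral_insert[of "UNIV - {i}" i "\<lambda>x. (if Hf i x = 0 then \<Phi> i x else 0)"]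
      by (simp add: insert_UNIV Hf_upd)
    also have "\<dots> = (\<integral>\<^sup>+y. 0 \<partial>Pi\<^sub>M (UNIV - {i}) (\<lambda>_. M))"
    proof (rule nn_integral_cong)
      fix y assume y: "y \<in> space (Pi\<^sub>M (UNIV - {i}) (\<lambda>_. M))"
      show "(\<integral>\<^sup>+u. (if Hf i y = 0 then \<Phi> i (y(i := u)) else 0) \<partial>M) = 0"
      proof (cases "space M = {} \<or> Hf i y \<noteq> 0")
        case True
        then show ?thesis by (auto simp: nn_integral_empty)
      next
        case False
        then obtain u0 where u0: "u0 \<in> space M" by auto
        then have "y(i := u0) \<in> space ?X" using y by (auto simp: space_PiM PiE_def)
        from slice[OF this, of i] False show ?thesis by (simp add: Hf_upd)
      qed
    qed
    finally have "AE x in ?X. (if Hf i x = 0 then \<Phi> i x else 0) = 0"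
      by (subst (asm) nn_integral_const) (simp add: nn_integral_0_iff_AE)
    then show ?thesis
    proof eventually_elim
      case (elim x)
      consider "Hf i x = 0" | "Hf i x = \<infinity>" | "Hf i x \<noteq> 0" "Hf i x \<noteq> \<infinity>" by blast
      then show ?case
      proof cases
        case 1
        then show ?thesis using elim by simp
      next
        case 2
        then show ?thesis by (simp add: G_def ennreal_mult_top)
      next
        case 3
        then have "epow (Hf i x) (c i) \<noteq> 0" "epow (Hf i x) (c i) \<noteq> top" by auto
        then have "\<Phi> i x / epow (Hf i x) (c i) * epow (Hf i x) (c i) = \<Phi> i x"
          by (metis ennreal_times_divide mult.commute mult_divide_eq_ennreal)
        then show ?thesis using 3 by (simp add: G_def)
      qed
    qed
  qed
  define \<rho> where "\<rho> i = 1 / r i - \<delta>" for i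
  have \<rho>: "a i / r i = b * \<rho> i" "0 < \<rho> i" for i
  proof -
    show *: "a i / r i = b * \<rho> i" using r[of i] by (simp add: a_eq \<rho>_def field_simps)
    have "0 < a i / r i" using a r by simp
    then show "0 < \<rho> i" using b by (simp add: * zero_less_mult_iff)
  qed
  have \<rho>c: "\<rho> i * c i = \<delta>" for i
  proof -
    have "a i * \<rho> i + a i * \<delta> = b * \<rho> i"
      using \<rho>(1)[of i] r[of i] by (simp add: \<rho>_def field_simps)
    then show ?thesis using a[of i] by (simp add: c_def field_simps)
  qed
  have pw: "epow (product_avg \<nu> \<phi> F x) q \<le> (\<Prod>i\<in>UNIV. epow (\<Phi> i x) (q * \<rho> i))"
    if x: "x \<in> space ?X" for x
  proof -
    have [measurable]: "(\<lambda>t. F i (x(i := \<phi> i (x i) t))) \<in> borel_measurable \<nu>" for i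
      using measurable_Pair2[OF shift[of i] x] by simp
    have "(product_avg \<nu> \<phi> F x)
      = (\<integral>\<^sup>+t. (\<Prod>i\<in>UNIV. epow (epow (F i (x(i := \<phi> i (x i) t))) (r i / a i)) (a i / r i)) \<partial>\<nu>)"
    proof -
      have "r i / a i * (a i / r i) = 1" for i using r[of i] a(1)[of i] by simp
      then show ?thesis by (simp only: epow_epow epow_1)
    qed
    also have "\<dots> \<le> (\<Prod>i\<in>UNIV. epow (A i x) (a i / r i))"
      unfolding A_def using r a sum_w by (intro nn_integral_Hoelder) auto
    finally have "epow (product_avg \<nu> \<phi> F x) q
        \<le> epow (\<Prod>i\<in>UNIV. epow (A i x) (a i / r i)) q"
      using q by (intro epow_mono) auto
    also have "\<dots> = (\<Prod>i\<in>UNIV. epow (\<Phi> i x) (q * \<rho> i))"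
      by (simp add: epow_prod epow_epow \<Phi>_def \<rho>(1) mult_ac)
    finally show ?thesis .
  qed
  \<comment> \<open>The pair \<open>(i, True)\<close> labels \<open>G i\<close>, the pair \<open>(i, False)\<close> labels \<open>Hf i\<close>.\<close>
  define Sx where "Sx z = (if snd z then UNIV else UNIV - {fst z})" for z :: "'k \<times> bool"
  define fx where "fx z = (if snd z then G (fst z) else Hf (fst z))" for z :: "'k \<times> bool"
  define w where "w z = (if snd z then q * \<rho> (fst z) else q * \<delta>)" for z :: "'k \<times> bool"
  have UN: "(UNIV :: ('k \<times> bool) set) = UNIV \<times> {True, False}" by auto
  have sum_pair: "(\<Sum>z\<in>UNIV. g z) = (\<Sum>i\<in>UNIV. g (i, True) + g (i, False))" for g :: "'k \<times> bool \<Rightarrow> real"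
    unfolding UN using sum.cartesian_product[of "\<lambda>i s. g (i, s)" "{True, False}" UNIV] by simp
  have prod_pair: "(\<Prod>z\<in>UNIV. g z) = (\<Prod>i\<in>UNIV. g (i, True) * g (i, False))" for g :: "'k \<times> bool \<Rightarrow> ennreal"
    unfolding UN using prod.cartesian_product[of "\<lambda>i s. g (i, s)" "{True, False}" UNIV] by simp
  have "pow_integral ?X q (product_avg \<nu> \<phi> F)
      \<le> (\<integral>\<^sup>+x. (\<Prod>i\<in>UNIV. epow (\<Phi> i x) (q * \<rho> i)) \<partial>?X)"
    by (intro nn_integral_mono pw)
  also have "\<dots> \<le> (\<integral>\<^sup>+x. (\<Prod>z\<in>UNIV. epow (fx z (restrict x (Sx z))) (w z)) \<partial>?X)"
  proof (rule nn_integral_mono_AE)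
    have "AE x in ?X. \<forall>i\<in>UNIV. \<Phi> i x \<le> G i x * epow (Hf i x) (c i)"
      by (rule AE_finite_allI) (auto intro: \<Phi>_le)
    then show "AE x in ?X. (\<Prod>i\<in>UNIV. epow (\<Phi> i x) (q * \<rho> i))
        \<le> (\<Prod>z\<in>UNIV. epow (fx z (restrict x (Sx z))) (w z))"
    proof eventually_elim
      case (elim x)
      have "epow (\<Phi> i x) (q * \<rho> i) \<le> epow (G i x) (q * \<rho> i) * epow (Hf i x) (q * \<delta>)" for i
      proof -
        have "epow (\<Phi> i x) (q * \<rho> i) \<le> epow (G i x * epow (Hf i x) (c i)) (q * \<rho> i)"
          using elim q \<rho>(2)[of i] by (intro epow_mono) auto
        also have "\<dots> = epow (G i x) (q * \<rho> i) * epow (Hf i x) (c i * (q * \<rho> i))"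
          by (simp only: epow_mult epow_epow)
        also have "c i * (q * \<rho> i) = q * \<delta>" using \<rho>c[of i] by (simp add: mult_ac)
        finally show ?thesis .
      qed
      then have "(\<Prod>i\<in>UNIV. epow (\<Phi> i x) (q * \<rho> i))
          \<le> (\<Prod>i\<in>UNIV. epow (G i x) (q * \<rho> i) * epow (Hf i x) (q * \<delta>))"
        by (intro prod_mono_ennreal) auto
      then show ?case
        by (simp add: prod_pair fx_def Sx_def w_def Hf_restrict restrict_def[of _ UNIV])
    qed
  qed
  also have "\<dots> \<le> (\<Prod>z\<in>UNIV. epow (\<integral>\<^sup>+x. fx z x \<partial>Pi\<^sub>M (Sx z) (\<lambda>_. M)) (w z))"
  proof (rule P.Finner_inequality)
    show "0 < w z" for z using q \<rho>(2) \<delta> by (simp add: w_def)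
    show "fx z \<in> borel_measurable (Pi\<^sub>M (Sx z) (\<lambda>_. M))" for z
      using Hfm by (simp add: fx_def Sx_def)
    show "(\<Sum>z\<in>{z \<in> UNIV. m \<in> Sx z}. w z) = 1" for m
    proof -
      have "(\<Sum>z\<in>{z \<in> UNIV. m \<in> Sx z}. w z) = (\<Sum>z\<in>UNIV. if m \<in> Sx z then w z else 0)"
        by (simp add: sum.If_cases)
      also have "\<dots> = (\<Sum>i\<in>UNIV. q * \<rho> i + (if m = i then 0 else q * \<delta>))"
        unfolding sum_pair by (intro sum.cong) (auto simp: Sx_def w_def)
      also have "\<dots> = (\<Sum>i\<in>UNIV. q / r i - (if m = i then q * \<delta> else 0))"
        by (intro sum.cong) (auto simp: \<rho>_def field_simps)
      also have "\<dots> = q * (\<Sum>i\<in>UNIV. 1 / r i) - q * \<delta>"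
        by (simp add: sum_subtractf sum_distrib_left)
      also have "\<dots> = 1" using q by (simp add: sum_q field_simps)
      finally show ?thesis .
    qed
  qed auto
  also have "\<dots> = (\<Prod>i\<in>UNIV. epow (\<integral>\<^sup>+x. G i x \<partial>?X) (q * \<rho> i)
      * epow (pow_integral ?X (r i) (F i)) (q * \<delta>))"
    by (simp add: prod_pair fx_def Sx_def w_def Hf_int)
  also have "\<dots> \<le> (\<Prod>i\<in>UNIV. ennreal (\<kappa> i powr (q * (1 / r i - \<delta>)))
        * epow (pow_integral ?X (r i) (F i)) (q / r i))"
  proof (intro prod_mono_ennreal)
    fix i
    let ?I = "pow_integral ?X (r i) (F i)"
    have "epow (\<integral>\<^sup>+x. G i x \<partial>?X) (q * \<rho> i) * epow ?I (q * \<delta>)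
        \<le> epow (ennreal (\<kappa> i) * ?I) (q * \<rho> i) * epow ?I (q * \<delta>)"
      using q \<rho>(2)[of i] by (intro mult_right_mono epow_mono G_int) auto
    also have "\<dots> = ennreal (\<kappa> i powr (q * \<rho> i)) * epow ?I (q * \<rho> i + q * \<delta>)"
      using \<kappa>[of i] by (simp add: epow_mult epow_add[symmetric] mult.assoc less_imp_le)
    also have "q * \<rho> i + q * \<delta> = q / r i" by (simp add: \<rho>_def field_simps)
    finally show "epow (\<integral>\<^sup>+x. G i x \<partial>?X) (q * \<rho> i) * epow ?I (q * \<delta>)
        \<le> ennreal (\<kappa> i powr (q * (1 / r i - \<delta>))) * epow ?I (q / r i)"
      by (simp add: \<rho>_def)
  qed
  finally show ?thesis .
qed

section \<open>One-dimensional averages along real polynomials\<close>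

text \<open>Between two points with equal values there is a critical point by Rolle's theorem, and
  passing it increases the count.\<close>
lemma inj_on_poly_between_critical_points:
  fixes P :: "real poly"
  assumes P: "pderiv P \<noteq> 0"
    and c: "\<And>t. t \<in> S \<Longrightarrow> card {z. poly (pderiv P) z = 0 \<and> z < t} = m"
  shows "inj_on (poly P) S"
proof -
  have False if "s \<in> S" "t \<in> S" "s < t" "poly P s = poly P t" for s t
  proof -
    obtain z where z: "s < z" "z < t" "poly P t - poly P s = (t - s) * poly (pderiv P) z"
      using poly_MVT[OF \<open>s < t\<close>, of P] by blast
    then have z': "poly (pderiv P) z = 0" using that by simp
    have "finite {z. poly (pderiv P) z = 0}" using P by (rule poly_roots_finite)
    then have "finite {z. poly (pderiv P) z = 0 \<and> z < t}" by (rule rev_finite_subset) auto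
    moreover have "{z. poly (pderiv P) z = 0 \<and> z < s} \<subset> {z. poly (pderiv P) z = 0 \<and> z < t}"
    proof (rule psubsetI)
      show "{z. poly (pderiv P) z = 0 \<and> z < s} \<subseteq> {z. poly (pderiv P) z = 0 \<and> z < t}"
        using \<open>s < t\<close> by auto
      have "z \<in> {z. poly (pderiv P) z = 0 \<and> z < t}" "z \<notin> {z. poly (pderiv P) z = 0 \<and> z < s}"
        using z(1,2) z' by auto
      then show "{z. poly (pderiv P) z = 0 \<and> z < s} \<noteq> {z. poly (pderiv P) z = 0 \<and> z < t}"
        by metis
    qed
    ultimately have "card {z. poly (pderiv P) z = 0 \<and> z < s} < card {z. poly (pderiv P) z = 0 \<and> z < t}"
      by (rule psubset_card_mono)
    then show False using c[OF that(1)] c[OF that(2)] by simp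
  qed
  then show ?thesis by (intro inj_onI) (metis linorder_less_linear)
qed

text \<open>Split according to the number of critical points to the left. On each of the at most
  \<open>degree P\<close> pieces \<open>P\<close> is injective, and a change of variables shows that the integral of
  \<open>\<bar>P'\<bar>\<close> over the piece is at most the measure of \<open>E\<close>.\<close>
lemma measure_steep_part_le:
  fixes P :: "real poly"
  assumes deg: "1 \<le> degree P" and E: "E \<in> sets borel" "emeasure lborel E \<le> ennreal e"
    and e: "0 \<le> e" and l: "0 < l"
  shows "emeasure lborel {t\<in>{0<..N}. poly P t \<in> E \<and> l \<le> \<bar>poly (pderiv P) t\<bar>}
      \<le> ennreal (real (degree P) * (e / l))"
proof -
  let ?P' = "poly (pderiv P)"
  have P': "pderiv P \<noteq> 0" using deg by (simp add: pderiv_eq_0_iff)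
  define Z where "Z = {z. ?P' z = 0}"
  have Z: "finite Z" "card Z \<le> degree P - 1"
    using poly_roots_finite[OF P'] card_poly_roots_bound[OF P'] by (auto simp: Z_def degree_pderiv)
  define c where "c t = card {z. ?P' z = 0 \<and> z < t}" for t
  have c_eq: "c t = (\<Sum>z\<in>Z. if z < t then 1 else 0)" for t
  proof -
    have "{z. ?P' z = 0 \<and> z < t} = Z \<inter> {z. z < t}" by (auto simp: Z_def)
    then show ?thesis using Z(1) by (simp add: c_def sum.If_cases)
  qed
  have [measurable]: "c \<in> borel \<rightarrow>\<^sub>M count_space UNIV" unfolding c_eq by measurable
  have c_less: "c t < degree P" for t
  proof -
    have "c t \<le> card Z" unfolding c_def using Z by (intro card_mono) (auto simp: Z_def)
    then show ?thesis using Z deg by linarith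
  qed
  have [measurable]: "poly p \<in> borel_measurable borel" for p :: "real poly"
    by (intro borel_measurable_continuous_onI continuous_intros)
  define S where "S m = {t\<in>{0<..N}. poly P t \<in> E \<and> l \<le> \<bar>?P' t\<bar> \<and> c t = m}" for m
  have S [measurable]: "S m \<in> sets borel" for m unfolding S_def using E by measurable
  have S_le: "emeasure lborel (S m) \<le> ennreal (e / l)" for m
  proof -
    have inj: "inj_on (poly P) (S m)"
      by (rule inj_on_poly_between_critical_points[OF P', where m = m]) (auto simp: S_def c_def)
    have der: "(poly P has_field_derivative ?P' x) (at x within S m)" for x
      by (rule DERIV_subset[OF poly_DERIV]) auto
    have SL: "S m \<in> sets lebesgue" by simp
    have im: "poly P ` S m \<in> sets lebesgue"
    proof (rule differentiable_image_in_sets_lebesgue[OF SL])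
      show "poly P differentiable_on S m"
        unfolding differentiable_on_def using der by (meson differentiable_def has_field_derivative_imp_has_derivative)
    qed simp
    have EL: "E \<in> lmeasurable"
      using E by (intro fmeasurableI) (auto simp: sets_completionI_sets less_top[symmetric] top_unique)
    have imL: "poly P ` S m \<in> lmeasurable"
      by (rule fmeasurableI2[OF EL _ im]) (auto simp: S_def)
    have "measure lebesgue (poly P ` S m) \<le> measure lebesgue E"
      by (rule measure_mono_fmeasurable[OF _ im EL]) (auto simp: S_def)
    also have "\<dots> \<le> e" using E e by (simp add: measure_def enn2real_leI)
    finally have im_le: "measure lebesgue (poly P ` S m) \<le> e" .
    have "(\<lambda>x. 1 :: real) absolutely_integrable_on (poly P ` S m)
        \<and> integral (poly P ` S m) (\<lambda>x. 1 :: real) = measure lebesgue (poly P ` S m)"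
      using imL by (simp add: lmeasure_integral absolutely_integrable_on_const)
    then have int: "(\<lambda>x. \<bar>?P' x\<bar> * 1) absolutely_integrable_on S m"
        "integral (S m) (\<lambda>x. \<bar>?P' x\<bar> * 1) = measure lebesgue (poly P ` S m)"
      using has_absolute_integral_change_of_variables_1'[OF SL der inj, of "\<lambda>_. 1"
          "measure lebesgue (poly P ` S m)"] by blast+
    have sub: "S m \<subseteq> {0<..N}" by (auto simp: S_def)
    have SM: "S m \<in> lmeasurable"
      using SL bounded_subset[of "{0..N}" "S m"] sub by (intro bounded_set_imp_lmeasurable) fastforce+
    have "l * measure lebesgue (S m) = integral (S m) (\<lambda>x. l)"
      using lmeasure_integral[OF SM] integral_mult_right[of "S m" l "\<lambda>_. 1"] by simp
    also have "\<dots> \<le> integral (S m) (\<lambda>x. \<bar>?P' x\<bar> * 1)"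
      using SM int(1) by (intro integral_le)
        (auto simp: S_def intro!: integrable_on_const set_lebesgue_integral_eq_integral(1))
    also have "\<dots> \<le> e" using int(2) im_le by simp
    finally have "measure lebesgue (S m) \<le> e / l" using l by (simp add: field_simps)
    moreover have "emeasure lborel (S m) = ennreal (measure lebesgue (S m))"
      using emeasure_eq_measure2[OF SM] S by simp
    ultimately show ?thesis by (simp add: ennreal_leI)
  qed
  have "{t\<in>{0<..N}. poly P t \<in> E \<and> l \<le> \<bar>?P' t\<bar>} \<subseteq> (\<Union>m<degree P. S m)"
    using c_less by (auto simp: S_def)
  then have "emeasure lborel {t\<in>{0<..N}. poly P t \<in> E \<and> l \<le> \<bar>?P' t\<bar>}
      \<le> emeasure lborel (\<Union>m<degree P. S m)"
    by (intro emeasure_mono) auto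
  also have "\<dots> \<le> (\<Sum>m<degree P. emeasure lborel (S m))"
    by (intro emeasure_subadditive_finite) auto
  also have "\<dots> \<le> (\<Sum>m<degree P. ennreal (e / l))" by (intro sum_mono S_le)
  also have "\<dots> = ennreal (real (degree P) * (e / l))"
    using e l by (simp add: ennreal_mult[symmetric] ennreal_of_nat_eq_real_of_nat)
  finally show ?thesis .
qed

text \<open>The set where \<open>\<bar>P'\<bar> \<le> l\<close> is the preimage of an interval of length \<open>2 * l\<close> under a
  polynomial of smaller degree, the rest has measure at most \<open>d * e / l\<close>. Both bounds are of the
  order \<open>e powr (1 / d)\<close> for \<open>l = e powr ((d - 1) / d)\<close>.\<close>
theorem measure_poly_preimage_le:
  fixes P :: "real poly"
  assumes "degree P = Suc n"
  shows "\<exists>C>0. \<forall>N E e. E \<in> sets borel \<longrightarrow> 0 < e \<longrightarrow> emeasure lborel E \<le> ennreal e \<longrightarrow>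
    emeasure lborel {t\<in>{0<..N}. poly P t \<in> E} \<le> ennreal (C * e powr (1 / real (Suc n)))"
  using assms
proof (induction n arbitrary: P)
  case 0
  have "degree (pderiv P) = 0" unfolding degree_pderiv 0 by simp
  then obtain c where c: "pderiv P = [:c:]" by (rule degree_eq_zeroE)
  have "c \<noteq> 0"
  proof
    assume "c = 0"
    then have "pderiv P = 0" using c by simp
    then show False using 0 by (simp add: pderiv_eq_0_iff)
  qed
  show ?case
  proof (intro exI[of _ "1 / \<bar>c\<bar>"] conjI allI impI)
    fix N e :: real and E :: "real set"
    assume E: "E \<in> sets borel" "emeasure lborel E \<le> ennreal e" and e: "0 < e"
    have "emeasure lborel {t\<in>{0<..N}. poly P t \<in> E \<and> \<bar>c\<bar> \<le> \<bar>poly (pderiv P) t\<bar>}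
        \<le> ennreal (real (degree P) * (e / \<bar>c\<bar>))"
      using 0 E e \<open>c \<noteq> 0\<close> by (intro measure_steep_part_le) auto
    then show "emeasure lborel {t\<in>{0<..N}. poly P t \<in> E} \<le> ennreal (1 / \<bar>c\<bar> * e powr (1 / real (Suc 0)))"
      using e 0 by (simp add: c)
  qed (use \<open>c \<noteq> 0\<close> in auto)
next
  case (Suc n)
  have "degree (pderiv P) = Suc n" using Suc.prems by (simp add: degree_pderiv)
  from Suc.IH[OF this] obtain C where C: "0 < C"
    "\<And>N E e. E \<in> sets borel \<Longrightarrow> 0 < e \<Longrightarrow> emeasure lborel E \<le> ennreal e \<Longrightarrow>
      emeasure lborel {t\<in>{0<..N}. poly (pderiv P) t \<in> E} \<le> ennreal (C * e powr (1 / real (Suc n)))"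
    by blast
  define d where "d = real (Suc (Suc n))"
  define C' where "C' = C * 2 powr (1 / real (Suc n)) + d"
  have d: "1 < d" "real (Suc n) = d - 1" by (auto simp: d_def)
  show ?case
  proof (intro exI[of _ C'] conjI allI impI)
    have "0 < C * 2 powr (1 / real (Suc n))" using C(1) by simp
    then show "0 < C'" unfolding C'_def using d(1) by linarith
    fix N e :: real and E :: "real set"
    assume E: "E \<in> sets borel" "emeasure lborel E \<le> ennreal e" and e: "0 < e"
    define l where "l = e powr ((d - 1) / d)"
    have l: "0 < l" using e by (simp add: l_def)
    have [measurable]: "poly p \<in> borel_measurable borel" for p :: "real poly"
      by (intro borel_measurable_continuous_onI continuous_intros)
    have "emeasure lborel {t\<in>{0<..N}. poly P t \<in> E}
       \<le> emeasure lborel ({t\<in>{0<..N}. poly (pderiv P) t \<in> {-l..l}}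
          \<union> {t\<in>{0<..N}. poly P t \<in> E \<and> l \<le> \<bar>poly (pderiv P) t\<bar>})"
      using E by (intro emeasure_mono) auto
    also have "\<dots> \<le> emeasure lborel {t\<in>{0<..N}. poly (pderiv P) t \<in> {-l..l}}
          + emeasure lborel {t\<in>{0<..N}. poly P t \<in> E \<and> l \<le> \<bar>poly (pderiv P) t\<bar>}"
      using E by (intro emeasure_subadditive) auto
    also have "\<dots> \<le> ennreal (C * (2 * l) powr (1 / real (Suc n))) + ennreal (real (degree P) * (e / l))"
      using l E e Suc.prems by (intro add_mono C(2) measure_steep_part_le) auto
    also have "\<dots> = ennreal (C * (2 * l) powr (1 / real (Suc n)) + d * (e / l))"
      using C e l d Suc.prems by (simp add: d_def flip: ennreal_plus)
    also have "C * (2 * l) powr (1 / real (Suc n)) + d * (e / l) = C' * e powr (1 / d)"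
    proof -
      have "(2 * l) powr (1 / real (Suc n)) = 2 powr (1 / real (Suc n)) * e powr (1 / d)"
        unfolding d(2) using l e d(1) by (simp add: powr_mult l_def powr_powr)
      moreover have "e / l = e powr (1 - (d - 1) / d)" using e by (simp add: l_def powr_diff)
      moreover have "1 - (d - 1) / d = 1 / d" using d by (simp add: field_simps)
      ultimately show ?thesis by (simp add: C'_def algebra_simps)
    qed
    finally show "emeasure lborel {t\<in>{0<..N}. poly P t \<in> E}
        \<le> ennreal (C' * e powr (1 / real (Suc (Suc n))))" by (simp add: d_def)
  qed
qed

lemma epow_le_mult:
  assumes "x \<le> ennreal c" "0 \<le> c" "1 < b"
  shows "epow x b \<le> x * ennreal (c powr (b - 1))"
proof -
  have "epow x b = x * epow x (b - 1)" using epow_add[of x 1 "b - 1"] by simp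
  also have "\<dots> \<le> x * epow (ennreal c) (b - 1)" using assms by (intro mult_left_mono epow_mono) auto
  finally show ?thesis using assms by simp
qed

text \<open>The average of an indicator function has integral \<open>\<bar>E\<bar>\<close>, and it is bounded by one and, by the
  preimage estimate, by \<open>C * \<bar>E\<bar> powr (1 / d) / N\<close>. Here the whole \<open>L\<^sup>b\<close> bound comes from
  interpolation between these two facts.\<close>
theorem restricted_type_real_poly:
  fixes P :: "real poly"
  assumes d: "1 \<le> degree P" and b: "1 < b"
  shows "\<exists>\<eta>>0. \<exists>C>0. \<forall>N\<ge>1. restricted_type lborel
    (uniform_measure lborel (real_window N)) (\<lambda>x t. x - poly P t) b \<eta> (C * N powr (- real (degree P)))"
proof -
  define d' where "d' = real (degree P)"
  have d': "1 \<le> d'" using d by (simp add: d'_def)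
  obtain C where C: "0 < C" and sub: "\<And>N E e. E \<in> sets borel \<Longrightarrow> 0 < e \<Longrightarrow> emeasure lborel E \<le> ennreal e \<Longrightarrow>
    emeasure lborel {t\<in>{0<..N}. poly P t \<in> E} \<le> ennreal (C * e powr (1 / d'))"
    using measure_poly_preimage_le[of P "degree P - 1"] d by (auto simp: d'_def)
  define \<eta> where "\<eta> = (b - 1) / d'"
  have \<eta>: "0 < \<eta>" using b d' by (simp add: \<eta>_def)
  have [measurable]: "poly P \<in> borel_measurable borel"
    by (intro borel_measurable_continuous_onI continuous_intros)
  show ?thesis
  proof (rule exI[of _ \<eta>], intro conjI \<eta>, rule exI[of _ "C powr d'"], intro conjI allI impI)
    show "0 < C powr d'" using C by simp
    fix N :: real assume N: "1 \<le> N"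
    let ?\<nu> = "uniform_measure lborel (real_window N)"
    have w: "emeasure lborel (real_window N) = ennreal N" "real_window N \<in> sets lborel"
      using N by (auto simp: real_window_def)
    have [measurable]: "real_window N \<in> sets borel" by (simp add: real_window_def)
    show "restricted_type lborel ?\<nu> (\<lambda>x t. x - poly P t) b \<eta> (C powr d' * N powr (- real (degree P)))"
      unfolding restricted_type_def
    proof (intro ballI impI)
      fix E :: "real set" assume E: "E \<in> sets lborel" "emeasure lborel E < \<infinity>"
      then have [measurable]: "E \<in> sets borel" by simp
      define e where "e = measure lborel E"
      have e0: "0 \<le> e" by (simp add: e_def)
      have eE: "emeasure lborel E = ennreal e" using E by (simp add: e_def emeasure_eq_ennreal_measure)
      define A where "A x = (\<integral>\<^sup>+t. indicator E (x - poly P t) \<partial>?\<nu>)" for x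
      have A0: "A x = (\<integral>\<^sup>+t. indicator E (x - poly P t) * indicator (real_window N) t \<partial>lborel) / ennreal N" for x
        unfolding A_def w(1)[symmetric] by (rule nn_integral_uniform_measure[OF _ w(2)]) measurable
      have A_eq: "A x = emeasure lborel {t\<in>{0<..N}. poly P t \<in> (\<lambda>y. x - y) -` E} / ennreal N" for x
      proof -
        have "(\<integral>\<^sup>+t. indicator E (x - poly P t) * indicator (real_window N) t \<partial>lborel)
            = (\<integral>\<^sup>+t. indicator {t\<in>{0<..N}. poly P t \<in> (\<lambda>y. x - y) -` E} t \<partial>lborel)"
          by (intro nn_integral_cong) (auto simp: indicator_def real_window_def)
        also have "\<dots> = emeasure lborel {t\<in>{0<..N}. poly P t \<in> (\<lambda>y. x - y) -` E}"
          by (rule nn_integral_indicator) measurable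
        finally show ?thesis by (simp add: A0)
      qed
      have [measurable]: "A \<in> borel_measurable lborel"
        using w(2) unfolding A0 by measurable
      have refl_em: "emeasure lborel ((\<lambda>y. x - y) -` E) = emeasure lborel E" for x
      proof -
        have "emeasure lborel E = emeasure (distr lborel borel (\<lambda>y. x + (-1) * y)) E"
          using lborel_real_affine[of "-1" x] by (simp add: density_1)
        also have "\<dots> = emeasure lborel ((\<lambda>y. x - y) -` E)"
          by (subst emeasure_distr) auto
        finally show ?thesis by simp
      qed
      have A_le1: "A x \<le> ennreal 1" for x
      proof -
        have "emeasure lborel {t\<in>{0<..N}. poly P t \<in> (\<lambda>y. x - y) -` E} \<le> emeasure lborel {0<..N}"
          by (intro emeasure_mono) auto
        then have "A x \<le> ennreal N / ennreal N" unfolding A_eq using N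
          by (intro divide_right_mono_ennreal) auto
        then show ?thesis using N by (simp add: divide_ennreal)
      qed
      have A_le: "A x \<le> ennreal (C * e powr (1 / d') / N)" if "0 < e" for x
      proof -
        have "emeasure lborel {t\<in>{0<..N}. poly P t \<in> (\<lambda>y. x - y) -` E} \<le> ennreal (C * e powr (1 / d'))"
        proof (rule sub[OF _ that])
          have "(\<lambda>y. x - y) \<in> borel_measurable borel" by measurable
          from measurable_sets[OF this, of E] show "(\<lambda>y. x - y) -` E \<in> sets borel" by simp
        qed (simp add: refl_em eE)
        then have "A x \<le> ennreal (C * e powr (1 / d')) / ennreal N" unfolding A_eq
          by (rule divide_right_mono_ennreal)
        then show ?thesis using N C by (simp add: divide_ennreal)
      qed
      have A_int: "(\<integral>\<^sup>+x. A x \<partial>lborel) = ennreal e"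
      proof -
        have "(\<integral>\<^sup>+x. A x \<partial>lborel)
          = (\<integral>\<^sup>+x. \<integral>\<^sup>+t. indicator E (x - poly P t) * indicator (real_window N) t \<partial>lborel \<partial>lborel) / ennreal N"
          unfolding A0 using w(2) by (intro nn_integral_divide) measurable
        also have "(\<integral>\<^sup>+x. \<integral>\<^sup>+t. indicator E (x - poly P t) * indicator (real_window N) t \<partial>lborel \<partial>lborel)
          = (\<integral>\<^sup>+t. \<integral>\<^sup>+x. indicator E (x - poly P t) * indicator (real_window N) t \<partial>lborel \<partial>lborel)"
          using w(2) by (intro lborel_pair.Fubini') measurable
        also have "\<dots> = (\<integral>\<^sup>+t. ennreal e * indicator (real_window N) t \<partial>lborel)"
        proof (intro nn_integral_cong)
          fix t :: real
          have "(\<integral>\<^sup>+x. indicator E (x - poly P t) \<partial>lborel) = emeasure lborel E"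
            using nn_integral_real_affine[of "indicator E" 1 "- poly P t"] by simp
          then show "(\<integral>\<^sup>+x. indicator E (x - poly P t) * indicator (real_window N) t \<partial>lborel)
              = ennreal e * indicator (real_window N) t"
            by (simp add: nn_integral_multc eE)
        qed
        also have "\<dots> = ennreal e * ennreal N" using w by (simp add: nn_integral_cmult)
        finally show ?thesis using N e0 by (simp add: divide_ennreal ennreal_mult[symmetric])
      qed
      show "(\<integral>\<^sup>+x. epow (\<integral>\<^sup>+t. indicator E (x - poly P t) \<partial>?\<nu>) b \<partial>lborel)
        \<le> ennreal (measure lborel E * min 1 ((C powr d' * N powr (- real (degree P)) * measure lborel E) powr \<eta>))"
        unfolding A_def[symmetric] e_def[symmetric] d'_def[symmetric]
      proof (cases "e = 0")
        case True
        then have "(\<integral>\<^sup>+x. A x \<partial>lborel) = 0" using A_int by simp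
        then have "AE x in lborel. A x = 0" using nn_integral_0_iff_AE[of A lborel] by simp
        then have "(\<integral>\<^sup>+x. epow (A x) b \<partial>lborel) = (\<integral>\<^sup>+x. 0 \<partial>(lborel :: real measure))"
          by (intro nn_integral_cong_AE) auto
        then show "(\<integral>\<^sup>+x. epow (A x) b \<partial>lborel) \<le> ennreal (e * min 1 ((C powr d' * N powr (- d') * e) powr \<eta>))"
          by simp
      next
        case False
        then have e: "0 < e" using e0 by simp
        define c where "c = min 1 (C * e powr (1 / d') / N)"
        have c: "0 \<le> c" using C N by (simp add: c_def)
        have Ac: "A x \<le> ennreal c" for x
          using A_le1[of x] A_le[OF e, of x] by (simp add: c_def min_def)
        have "(\<integral>\<^sup>+x. epow (A x) b \<partial>lborel) \<le> (\<integral>\<^sup>+x. A x * ennreal (c powr (b - 1)) \<partial>lborel)"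
          by (intro nn_integral_mono epow_le_mult Ac c b)
        also have "\<dots> = ennreal (e * c powr (b - 1))"
          using e c by (simp add: nn_integral_multc A_int ennreal_mult)
        also have "c powr (b - 1) = min 1 ((C powr d' * N powr (- d') * e) powr \<eta>)"
        proof -
          have "(C powr d' * N powr (- d') * e) powr (1 / d') = ((C / N) powr d' * e) powr (1 / d')"
            using C N by (simp add: powr_divide powr_minus_divide)
          also have "\<dots> = ((C / N) powr d') powr (1 / d') * e powr (1 / d')" by (rule powr_mult)
          also have "((C / N) powr d') powr (1 / d') = C / N" using C N d' by (simp add: powr_powr)
          finally have root: "(C powr d' * N powr (- d') * e) powr (1 / d') = C * e powr (1 / d') / N" by simp
          have "(C powr d' * N powr (- d') * e) powr \<eta> = ((C powr d' * N powr (- d') * e) powr (1 / d')) powr (b - 1)"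
            by (simp add: powr_powr \<eta>_def)
          then have "(C powr d' * N powr (- d') * e) powr \<eta> = (C * e powr (1 / d') / N) powr (b - 1)"
            unfolding root .
          moreover have "min 1 y powr (b - 1) = min 1 (y powr (b - 1))" if "0 \<le> y" for y :: real
            using b that powr_mono2[of "b - 1" y 1] powr_mono2[of "b - 1" 1 y] by (auto simp: min_def)
          ultimately show ?thesis using C N by (simp add: c_def)
        qed
        finally show "(\<integral>\<^sup>+x. epow (A x) b \<partial>lborel) \<le> ennreal (e * min 1 ((C powr d' * N powr (- d') * e) powr \<eta>))" .
      qed
    qed
  qed
qed

section \<open>Exponential sums as multisets of frequencies\<close>

text \<open>A finite multiset of integers stands for the exponential sum with these frequencies. Sums
  of two frequencies (\<open>msum\<close>) then correspond to products of exponential sums, \<open>mdiff\<close> to the squared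
  absolute value, and inclusion of multisets compares the numbers of representations, which
  would be awkward to express by the exponential sums themselves.\<close>
definition trig :: "real \<Rightarrow> int multiset \<Rightarrow> complex" where
  "trig \<theta> A = (\<Sum>m\<in>#A. cis (\<theta> * real_of_int m))"

definition msum :: "int multiset \<Rightarrow> int multiset \<Rightarrow> int multiset" where
  "msum A B = (\<Sum>a\<in>#A. image_mset ((+) a) B)"

primrec mpow :: "int multiset \<Rightarrow> nat \<Rightarrow> int multiset" where
  "mpow A 0 = {#0#}"
| "mpow A (Suc s) = msum A (mpow A s)"

definition mdiff :: "int multiset \<Rightarrow> int multiset" where
  "mdiff A = msum A (image_mset uminus A)"

lemma trig_empty [simp]: "trig \<theta> {#} = 0"
  and trig_add_mset [simp]: "trig \<theta> (add_mset a A) = cis (\<theta> * real_of_int a) + trig \<theta> A"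
  and trig_plus [simp]: "trig \<theta> (A + B) = trig \<theta> A + trig \<theta> B"
  by (simp_all add: trig_def)

lemma msum_simps [simp]: "msum {#} B = {#}" "msum (add_mset a A) B = image_mset ((+) a) B + msum A B"
  by (simp_all add: msum_def)

lemma trig_translate: "trig \<theta> (image_mset ((+) a) B) = cis (\<theta> * real_of_int a) * trig \<theta> B"
  by (induction B) (simp_all add: algebra_simps cis_mult)

lemma trig_msum: "trig \<theta> (msum A B) = trig \<theta> A * trig \<theta> B"
  by (induction A) (simp_all add: trig_translate algebra_simps)

lemma trig_mpow: "trig \<theta> (mpow A s) = trig \<theta> A ^ s"
  by (induction s) (simp_all add: trig_msum)

lemma trig_uminus: "trig \<theta> (image_mset uminus A) = cnj (trig \<theta> A)"
  by (induction A) (simp_all add: cis_cnj)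

lemma trig_mdiff: "trig \<theta> (mdiff A) = complex_of_real ((cmod (trig \<theta> A))\<^sup>2)"
  by (simp add: mdiff_def trig_msum trig_uminus complex_norm_square[symmetric])

lemma trig_mpow_mdiff: "trig \<theta> (mpow (mdiff A) s) = complex_of_real (cmod (trig \<theta> A) ^ (2 * s))"
  by (simp add: trig_mpow trig_mdiff power_mult)

lemma trig_scale: "trig \<theta> (image_mset ((*) h) A) = trig (\<theta> * real_of_int h) A"
  by (induction A) (simp_all add: mult.assoc)

lemma trig_sum: "finite H \<Longrightarrow> trig \<theta> (\<Sum>h\<in>H. A h) = (\<Sum>h\<in>H. trig \<theta> (A h))"
  by (induction H rule: finite_induct) simp_all

lemma cmod_trig_le: "cmod (trig \<theta> A) \<le> real (size A)"
proof (induction A)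
  case (add x A)
  then show ?case using norm_triangle_ineq[of "cis (\<theta> * real_of_int x)" "trig \<theta> A"] by simp
qed simp

lemma trig_mset_set: "finite X \<Longrightarrow> trig \<theta> (image_mset g (mset_set X)) = (\<Sum>x\<in>X. cis (\<theta> * real_of_int (g x)))"
  by (simp add: trig_def sum_unfold_sum_mset image_mset.compositionality o_def)

lemma sum_mset_msum: "(\<Sum>m\<in>#msum A B. g m) = (\<Sum>a\<in>#A. \<Sum>b\<in>#B. g (a + b))" for g :: "int \<Rightarrow> 'b::comm_monoid_add"
  by (induction A) (simp_all add: image_mset.compositionality o_def)

lemma msum_mono: "A \<subseteq># A' \<Longrightarrow> B \<subseteq># B' \<Longrightarrow> msum A B \<subseteq># msum A' B'"
proof -
  have *: "msum (A + C) B = msum A B + msum C B" for A B C by (simp add: msum_def)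
  have **: "msum A (B + C) = msum A B + msum A C" for A B C by (induction A) simp_all
  assume "A \<subseteq># A'" "B \<subseteq># B'"
  then obtain C D where "A' = A + C" "B' = B + D" by (auto simp: mset_subset_eq_exists_conv)
  then show ?thesis by (simp add: * ** ac_simps)
qed

lemma mpow_mono: "A \<subseteq># A' \<Longrightarrow> mpow A s \<subseteq># mpow A' s"
  by (induction s) (simp_all add: msum_mono)

lemma mdiff_mono: "A \<subseteq># A' \<Longrightarrow> mdiff A \<subseteq># mdiff A'"
  by (simp add: mdiff_def msum_mono image_mset_subseteq_mono)

lemma set_msum: "set_mset (msum A B) = {a + b | a b. a \<in># A \<and> b \<in># B}"
  by (induction A) auto

lemma abs_mdiff_le: "(\<And>x. x \<in># A \<Longrightarrow> \<bar>x\<bar> \<le> M) \<Longrightarrow> x \<in># mdiff A \<Longrightarrow> \<bar>x\<bar> \<le> 2 * M"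
proof -
  assume M: "\<And>x. x \<in># A \<Longrightarrow> \<bar>x\<bar> \<le> M" and "x \<in># mdiff A"
  then obtain a b where "x = a + - b" "a \<in># A" "b \<in># A" by (auto simp: mdiff_def set_msum)
  then show "\<bar>x\<bar> \<le> 2 * M" using M[of a] M[of b] by linarith
qed

lemma abs_mpow_le: "(\<And>x. x \<in># A \<Longrightarrow> \<bar>x\<bar> \<le> M) \<Longrightarrow> x \<in># mpow A s \<Longrightarrow> \<bar>x\<bar> \<le> int s * M"
proof (induction s arbitrary: x)
  case (Suc s)
  then obtain a b where "x = a + b" "a \<in># A" "b \<in># mpow A s" by (auto simp: set_msum)
  moreover have "\<bar>b\<bar> \<le> int s * M" using Suc.IH[of b] Suc.prems(1) \<open>b \<in># mpow A s\<close> by blast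
  moreover have "\<bar>a\<bar> \<le> M" using Suc.prems(1) \<open>a \<in># A\<close> by blast
  ultimately show ?case using abs_triangle_ineq[of a b] by (simp add: algebra_simps)
qed simp

text \<open>The points \<open>2 * pi * (j / Q)\<close> take the place of the circle: averages over them detect
  divisibility by \<open>Q\<close>, which is the same as vanishing for integers smaller than \<open>Q\<close>.\<close>
definition freq :: "nat \<Rightarrow> nat \<Rightarrow> real" where
  "freq Q j = 2 * pi * real j / real Q"

lemma sum_characters:
  assumes Q: "0 < Q"
  shows "(\<Sum>j<Q. cis (freq Q j * real_of_int m)) = (if int Q dvd m then of_nat Q else 0)"
proof -
  define z where "z = cis (2 * pi * real_of_int m / real Q)"
  have pw: "cis (freq Q j * real_of_int m) = z ^ j" for j
  proof -
    have "z ^ j = cis (real j * (2 * pi * real_of_int m / real Q))" by (simp only: z_def Complex.DeMoivre)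
    then show ?thesis by (simp add: freq_def mult_ac)
  qed
  have zQ: "z ^ Q = 1"
    using Q cis_multiple_2pi[of "real_of_int m"] by (simp add: z_def Complex.DeMoivre)
  show ?thesis
  proof (cases "int Q dvd m")
    case True
    then obtain k where k: "m = int Q * k" by auto
    have "z = cis (2 * pi * real_of_int k)" unfolding z_def using Q k by (intro arg_cong[of _ _ cis]) simp
    moreover have "cis (2 * pi * real_of_int k) = 1" by (rule cis_multiple_2pi) simp
    ultimately have "z = 1" by (simp only:)
    then show ?thesis using True by (simp add: pw)
  next
    case False
    have "z \<noteq> 1"
    proof
      assume "z = 1"
      then have "cos (2 * pi * real_of_int m / real Q) = 1" by (simp add: z_def complex_eq_iff)
      then obtain k :: int where "2 * pi * real_of_int m / real Q = of_int k * 2 * pi"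
        by (auto simp: cos_one_2pi_int)
      then have "2 * pi * real_of_int m = 2 * pi * (real_of_int k * real Q)" using Q by (simp add: field_simps)
      then have "real_of_int m = real_of_int k * real Q" by simp
      then have "m = k * int Q" by (metis of_int_eq_iff of_int_mult of_int_of_nat_eq)
      then show False using False by simp
    qed
    then have "(\<Sum>j<Q. z ^ j) = 0" using zQ by (simp add: geometric_sum)
    then show ?thesis using False by (simp add: pw)
  qed
qed

lemma sum_trig:
  assumes Q: "0 < Q"
  shows "(\<Sum>j<Q. trig (freq Q j) A) = of_nat Q * (\<Sum>m\<in>#A. if int Q dvd m then 1 else 0)"
proof (induction A)
  case (add a A)
  then show ?case by (simp add: sum.distrib sum_characters[OF Q] distrib_left)
qed simp

lemma sum_mset_eq_count: "(\<Sum>m\<in>#A. if m = c then 1 else 0 :: 'b :: semiring_1) = of_nat (count A c)"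
  by (induction A) auto

lemma sum_trig_large:
  assumes Q: "0 < Q" and large: "\<And>m. m \<in># A \<Longrightarrow> \<bar>m\<bar> < int Q"
  shows "(\<Sum>j<Q. trig (freq Q j) A) = of_nat Q * of_nat (count A 0)"
proof -
  have "int Q dvd m \<longleftrightarrow> m = 0" if "m \<in># A" for m
    using large[OF that] dvd_imp_le_int[of m "int Q"] by auto
  then have "(\<Sum>m\<in>#A. if int Q dvd m then 1 else 0 :: complex) = (\<Sum>m\<in>#A. if m = 0 then 1 else 0)"
    by (intro arg_cong[of _ _ sum_mset] image_mset_cong if_cong refl)
  then show ?thesis by (simp add: sum_trig[OF Q] sum_mset_eq_count)
qed

text \<open>A number of representations is a Fourier coefficient, hence at most the mean of the absolute
  value. Frequencies congruent to \<open>m\<close> modulo \<open>Q\<close> are counted as well, which only helps.\<close>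
lemma count_le_mean_trig:
  assumes Q: "0 < Q"
  shows "real Q * real (count A m) \<le> (\<Sum>j<Q. cmod (trig (freq Q j) A))"
proof -
  define B where "B = image_mset ((+) (- m)) A"
  have "real (count A m) = (\<Sum>x\<in>#A. if x = m then 1 else 0 :: real)" by (simp add: sum_mset_eq_count)
  also have "\<dots> \<le> (\<Sum>x\<in>#B. if int Q dvd x then 1 else 0 :: real)"
    unfolding B_def image_mset.compositionality o_def by (intro sum_mset_mono) auto
  finally have "real Q * real (count A m) \<le> real Q * (\<Sum>x\<in>#B. if int Q dvd x then 1 else 0 :: real)"
    by (intro mult_left_mono) auto
  also have "\<dots> = Re (of_nat Q * (\<Sum>x\<in>#B. if int Q dvd x then 1 else 0 :: complex))"
    by (induction B) (auto simp: algebra_simps)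
  also have "\<dots> = Re (\<Sum>j<Q. trig (freq Q j) B)" by (simp only: sum_trig[OF Q])
  also have "\<dots> \<le> cmod (\<Sum>j<Q. trig (freq Q j) B)" by (rule complex_Re_le_cmod)
  also have "\<dots> \<le> (\<Sum>j<Q. cmod (trig (freq Q j) B))" by (rule norm_sum)
  also have "\<dots> = (\<Sum>j<Q. cmod (trig (freq Q j) A))" by (simp add: B_def trig_translate norm_mult)
  finally show ?thesis .
qed

section \<open>Solutions of a bilinear equation in three pairs of variables\<close>

abbreviation max_abs :: "int \<Rightarrow> int \<Rightarrow> real" where
  "max_abs x y \<equiv> real_of_int (max \<bar>x\<bar> \<bar>y\<bar>)"

definition nz :: "nat \<Rightarrow> int set" where
  "nz N = {- int N..int N} - {0}"

lemma finite_nz [simp]: "finite (nz N)"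
  by (simp add: nz_def)

lemma card_nz [simp]: "card (nz N) = 2 * N"
  by (simp add: nz_def)

text \<open>The quotient by \<open>q\<close> separates the elements of a residue class. The hypothesis \<open>q \<le> Y\<close> absorbs
  the rounding error into the main term.\<close>
lemma card_progression_le:
  fixes q Y c :: int
  assumes q: "1 \<le> q" "q \<le> Y" and S: "S \<subseteq> {-Y..Y}" "\<And>m m'. m \<in> S \<Longrightarrow> m' \<in> S \<Longrightarrow> q dvd m - m'"
  shows "real (card S) \<le> 3 * real_of_int Y / real_of_int q"
proof -
  have inj: "inj_on (\<lambda>m. (m + Y) div q) S"
  proof (rule inj_onI)
    fix m m' assume m: "m \<in> S" "m' \<in> S" "(m + Y) div q = (m' + Y) div q"
    have "q dvd (m + Y) - (m' + Y)" using S(2)[OF m(1,2)] by simp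
    then have "(m + Y) mod q = (m' + Y) mod q" by (rule mod_eq_dvd_iff[THEN iffD2])
    then have "m + Y = m' + Y" using m(3) by (metis mult_div_mod_eq)
    then show "m = m'" by simp
  qed
  have "(\<lambda>m. (m + Y) div q) ` S \<subseteq> {0..2 * Y div q}"
  proof safe
    fix m assume "m \<in> S"
    then have "0 \<le> m + Y" "m + Y \<le> 2 * Y" using S by auto
    then show "(m + Y) div q \<in> {0..2 * Y div q}"
      using q by (auto intro!: zdiv_mono1 simp: pos_imp_zdiv_nonneg_iff)
  qed
  then have "card S \<le> card {0..2 * Y div q}"
    using card_image[OF inj] by (metis card_mono finite_atLeastAtMost_int)
  also have "card {0..2 * Y div q} = nat (2 * Y div q + 1)" by simp
  finally have "int (card S) \<le> 2 * Y div q + 1"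
    using pos_imp_zdiv_nonneg_iff[of q "2 * Y"] q by linarith
  then have "real (card S) \<le> real_of_int (2 * Y div q) + 1" by linarith
  also have "real_of_int (2 * Y div q) \<le> 2 * real_of_int Y / real_of_int q"
    using real_of_int_div4[of "2 * Y" q] by simp
  also have "2 * real_of_int Y / real_of_int q + 1 \<le> 3 * real_of_int Y / real_of_int q"
    using q by (simp add: field_simps)
  finally show ?thesis by simp
qed

text \<open>The solutions form a residue class modulo \<open>\<bar>k\<bar> / gcd h k\<close>.\<close>
lemma card_solutions_congruence_le:
  fixes h k c Y :: int
  assumes k: "k \<noteq> 0" "\<bar>k\<bar> \<le> Y"
  shows "real (card {m\<in>{-Y..Y}. k dvd h * m - c}) \<le> 3 * real_of_int Y * real_of_int (gcd h k) / real_of_int \<bar>k\<bar>"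
proof -
  define g where "g = gcd h k"
  have g: "0 < g" "g dvd k" using k by (auto simp: g_def)
  define q where "q = \<bar>k\<bar> div g"
  have gq: "g * q = \<bar>k\<bar>" using g by (simp add: q_def)
  have "\<bar>k\<bar> > 0" using k by simp
  then have q1: "1 \<le> q" using gq g by (smt (verit) mult_nonneg_nonpos)
  have qk: "q \<le> \<bar>k\<bar>" using gq g q1 by (smt (verit) mult_le_cancel_right1)
  have "real (card {m\<in>{-Y..Y}. k dvd h * m - c}) \<le> 3 * real_of_int Y / real_of_int q"
  proof (rule card_progression_le)
    fix m m' assume "m \<in> {m\<in>{-Y..Y}. k dvd h * m - c}" "m' \<in> {m\<in>{-Y..Y}. k dvd h * m - c}"
    then have "k dvd h * m - c" "k dvd h * m' - c" by auto
    then have "k dvd (h * m - c) - (h * m' - c)" by (rule dvd_diff)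
    then have "k dvd h * (m - m')" by (simp add: algebra_simps)
    moreover obtain a b where ab: "h = g * a" "k = g * b" "coprime a b"
      using gcd_coprime_exists[of h k] g by (metis g_def mult.commute less_irrefl)
    ultimately have "b dvd a * (m - m')" using g by (simp add: mult.assoc)
    then have "b dvd m - m'" using ab(3) by (simp add: coprime_commute coprime_dvd_mult_right_iff)
    moreover have "q = \<bar>b\<bar>" using ab g gq by (auto simp: abs_mult)
    ultimately show "q dvd m - m'" by simp
  qed (use q1 qk k in auto)
  also have "\<dots> = 3 * real_of_int Y * real_of_int g / real_of_int \<bar>k\<bar>"
    unfolding gq[symmetric] using g q1 by simp
  finally show ?thesis by (simp add: g_def)
qed

text \<open>Each of the two unknowns determines the other one and solves a congruence modulo the
  coefficient of the other one.\<close>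
lemma card_solutions_2_le:
  fixes h1 h2 c Y :: int
  assumes h: "h1 \<noteq> 0" "h2 \<noteq> 0" "\<bar>h1\<bar> \<le> Y" "\<bar>h2\<bar> \<le> Y"
  shows "real (card {(m1, m2). m1 \<in> {-Y..Y} \<and> m2 \<in> {-Y..Y} \<and> h1 * m1 + h2 * m2 = c})
    \<le> 3 * real_of_int Y * real_of_int (gcd h1 h2) / max_abs h1 h2"
proof -
  let ?S = "{(m1, m2). m1 \<in> {-Y..Y} \<and> m2 \<in> {-Y..Y} \<and> h1 * m1 + h2 * m2 = c}"
  have "card ?S \<le> card {m\<in>{-Y..Y}. h2 dvd h1 * m - c}"
  proof (rule card_inj_on_le[where f = fst])
    show "inj_on fst ?S" using h by (auto simp: inj_on_def)
    show "fst ` ?S \<subseteq> {m\<in>{-Y..Y}. h2 dvd h1 * m - c}"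
    proof safe
      fix m1 m2 :: int
      have "h1 * m1 - (h1 * m1 + h2 * m2) = h2 * (- m2)" by simp
      then show "h2 dvd h1 * fst (m1, m2) - (h1 * m1 + h2 * m2)" by (metis dvd_triv_left fst_conv)
    qed auto
  qed (rule finite_subset[of _ "{-Y..Y}"], auto)
  then have 1: "real (card ?S) \<le> 3 * real_of_int Y * real_of_int (gcd h1 h2) / real_of_int \<bar>h2\<bar>"
    using card_solutions_congruence_le[of h2 Y h1 c] h by linarith
  have "card ?S \<le> card {m\<in>{-Y..Y}. h1 dvd h2 * m - c}"
  proof (rule card_inj_on_le[where f = snd])
    show "inj_on snd ?S" using h by (auto simp: inj_on_def)
    show "snd ` ?S \<subseteq> {m\<in>{-Y..Y}. h1 dvd h2 * m - c}"
    proof safe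
      fix m1 m2 :: int
      have "h2 * m2 - (h1 * m1 + h2 * m2) = h1 * (- m1)" by simp
      then show "h1 dvd h2 * snd (m1, m2) - (h1 * m1 + h2 * m2)" by (metis dvd_triv_left snd_conv)
    qed auto
  qed (rule finite_subset[of _ "{-Y..Y}"], auto)
  then have 2: "real (card ?S) \<le> 3 * real_of_int Y * real_of_int (gcd h1 h2) / real_of_int \<bar>h1\<bar>"
    using card_solutions_congruence_le[of h1 Y h2 c] h by (simp add: gcd.commute)
  show ?thesis using 1 2 by (simp add: max_def)
qed

text \<open>A solution forces \<open>gcd h1 h2\<close> to divide \<open>h3 * m3\<close>; for each such \<open>m3\<close> the remaining equation in two
  unknowns has few solutions. In the product of the two bounds \<open>gcd h1 h2\<close> cancels, and only the
  greatest common divisor of all three coefficients is left.\<close>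
lemma card_solutions_3_le:
  fixes h1 h2 h3 Y :: int
  assumes h: "h1 \<noteq> 0" "h2 \<noteq> 0" "\<bar>h1\<bar> \<le> Y" "\<bar>h2\<bar> \<le> Y"
  shows "(\<Sum>m1\<in>{-Y..Y}. \<Sum>m2\<in>{-Y..Y}. \<Sum>m3\<in>{-Y..Y}. if h1 * m1 + h2 * m2 + h3 * m3 = 0 then 1 else 0 :: real)
    \<le> 9 * (real_of_int Y)\<^sup>2 * real_of_int (gcd h3 (gcd h1 h2)) / max_abs h1 h2"
proof -
  define g where "g = gcd h1 h2"
  define M where "M = max \<bar>h1\<bar> \<bar>h2\<bar>"
  have g: "0 < g" "g dvd h1" "g dvd h2" "g \<le> Y"
    using h dvd_imp_le_int[of h1 g] by (auto simp: g_def)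
  have M: "0 < M" using h by (simp add: M_def)
  let ?I = "{-Y..Y}"
  have inner: "(\<Sum>m1\<in>?I. \<Sum>m2\<in>?I. if h1 * m1 + h2 * m2 + h3 * m3 = 0 then 1 else 0 :: real)
     \<le> (if g dvd h3 * m3 - 0 then 3 * real_of_int Y * real_of_int g / real_of_int M else 0)" for m3
  proof -
    have "(\<Sum>m1\<in>?I. \<Sum>m2\<in>?I. if h1 * m1 + h2 * m2 + h3 * m3 = 0 then 1 else 0 :: real)
       = (\<Sum>z\<in>?I \<times> ?I. if (case z of (m1, m2) \<Rightarrow> h1 * m1 + h2 * m2 = - (h3 * m3)) then 1 else 0)"
      by (subst sum.cartesian_product) (auto intro!: sum.cong)
    also have "\<dots> = real (card {z\<in>?I \<times> ?I. case z of (m1, m2) \<Rightarrow> h1 * m1 + h2 * m2 = - (h3 * m3)})"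
      by (simp add: sum.If_cases Collect_conj_eq[symmetric] Int_def)
    also have "{z\<in>?I \<times> ?I. case z of (m1, m2) \<Rightarrow> h1 * m1 + h2 * m2 = - (h3 * m3)}
       = {(m1, m2). m1 \<in> ?I \<and> m2 \<in> ?I \<and> h1 * m1 + h2 * m2 = - (h3 * m3)}" by auto
    finally have eq: "(\<Sum>m1\<in>?I. \<Sum>m2\<in>?I. if h1 * m1 + h2 * m2 + h3 * m3 = 0 then 1 else 0 :: real)
       = real (card {(m1, m2). m1 \<in> ?I \<and> m2 \<in> ?I \<and> h1 * m1 + h2 * m2 = - (h3 * m3)})" .
    show ?thesis
    proof (cases "g dvd h3 * m3")
      case True
      then show ?thesis
        using card_solutions_2_le[OF h, of "- (h3 * m3)"] unfolding eq by (simp add: g_def M_def)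
    next
      case False
      have "h1 * m1 + h2 * m2 \<noteq> - (h3 * m3)" for m1 m2
      proof
        assume *: "h1 * m1 + h2 * m2 = - (h3 * m3)"
        have "g dvd h1 * m1 + h2 * m2" using g by simp
        then show False using False unfolding * by simp
      qed
      then show ?thesis using False unfolding eq by simp
    qed
  qed
  have "(\<Sum>m1\<in>?I. \<Sum>m2\<in>?I. \<Sum>m3\<in>?I. if h1 * m1 + h2 * m2 + h3 * m3 = 0 then 1 else 0 :: real)
     = (\<Sum>m1\<in>?I. \<Sum>m3\<in>?I. \<Sum>m2\<in>?I. if h1 * m1 + h2 * m2 + h3 * m3 = 0 then 1 else 0)"
    by (intro sum.cong refl sum.swap)
  also have "\<dots> = (\<Sum>m3\<in>?I. \<Sum>m1\<in>?I. \<Sum>m2\<in>?I. if h1 * m1 + h2 * m2 + h3 * m3 = 0 then 1 else 0)"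
    by (rule sum.swap)
  also have "\<dots> \<le> (\<Sum>m3\<in>?I. if g dvd h3 * m3 - 0 then 3 * real_of_int Y * real_of_int g / real_of_int M else 0)"
    by (intro sum_mono inner)
  also have "\<dots> = real (card {m\<in>?I. g dvd h3 * m - 0}) * (3 * real_of_int Y * real_of_int g / real_of_int M)"
    by (simp add: sum.If_cases Int_def)
  also have "\<dots> \<le> (3 * real_of_int Y * real_of_int (gcd h3 g) / real_of_int \<bar>g\<bar>)
      * (3 * real_of_int Y * real_of_int g / real_of_int M)"
    using card_solutions_congruence_le[of g Y h3 0] g M by (intro mult_right_mono) auto
  also have "\<dots> = 9 * (real_of_int Y)\<^sup>2 * real_of_int (gcd h3 g) / real_of_int M"
    using g M by (simp add: power2_eq_square)
  finally show ?thesis by (simp add: g_def M_def)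
qed

text \<open>At most \<open>2 * \<bar>x\<bar>\<close> values of \<open>y\<close> satisfy \<open>\<bar>y\<bar> \<le> \<bar>x\<bar>\<close>, so every \<open>x\<close> contributes at most \<open>2\<close> to the
  part of the sum where it is the larger entry.\<close>
lemma sum_inverse_max_le:
  "(\<Sum>x\<in>nz X. \<Sum>y\<in>nz X. 1 / max_abs x y) \<le> 8 * real X"
proof -
  define A where "A x = {y\<in>nz X. \<bar>y\<bar> \<le> \<bar>x\<bar>}" for x :: int
  have A: "real (card (A x)) / real_of_int \<bar>x\<bar> \<le> 2" if "x \<in> nz X" for x
  proof -
    have "A x \<subseteq> nz (nat \<bar>x\<bar>)" by (auto simp: A_def nz_def)
    then have "card (A x) \<le> 2 * nat \<bar>x\<bar>" using card_mono[of "nz (nat \<bar>x\<bar>)"] by simp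
    moreover have "x \<noteq> 0" using that by (simp add: nz_def)
    ultimately show ?thesis by (simp add: field_simps)
  qed
  have "(\<Sum>x\<in>nz X. \<Sum>y\<in>nz X. 1 / max_abs x y)
      \<le> (\<Sum>x\<in>nz X. \<Sum>y\<in>nz X. (if \<bar>y\<bar> \<le> \<bar>x\<bar> then 1 / real_of_int \<bar>x\<bar> else 0)
          + (if \<bar>x\<bar> \<le> \<bar>y\<bar> then 1 / real_of_int \<bar>y\<bar> else 0))"
    by (intro sum_mono) (auto simp: max_def)
  also have "\<dots> = (\<Sum>x\<in>nz X. \<Sum>y\<in>nz X. if \<bar>y\<bar> \<le> \<bar>x\<bar> then 1 / real_of_int \<bar>x\<bar> else 0)
      + (\<Sum>y\<in>nz X. \<Sum>x\<in>nz X. if \<bar>x\<bar> \<le> \<bar>y\<bar> then 1 / real_of_int \<bar>y\<bar> else 0)"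
    by (simp add: sum.distrib) (rule sum.swap)
  also have "\<dots> = 2 * (\<Sum>x\<in>nz X. real (card (A x)) / real_of_int \<bar>x\<bar>)"
    by (simp add: sum.If_cases A_def Int_def)
  also have "\<dots> \<le> 2 * (\<Sum>x\<in>nz X. 2)" by (intro mult_left_mono sum_mono A) auto
  finally show ?thesis by simp
qed

lemma sum_inverse_squares_le: "(\<Sum>e=1..N. 1 / (real e)\<^sup>2) \<le> 2"
proof -
  have *: "(\<Sum>e=1..Suc n. 1 / (real e)\<^sup>2) \<le> 2 - 1 / real (Suc n)" for n
  proof (induction n)
    case (Suc n)
    have "1 / (real (Suc (Suc n)))\<^sup>2 \<le> 1 / real (Suc n) - 1 / real (Suc (Suc n))"
    proof -
      have "1 / (real (Suc (Suc n)))\<^sup>2 \<le> 1 / (real (Suc n) * real (Suc (Suc n)))"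
        by (intro frac_le) (auto simp: power2_eq_square mult_right_mono)
      also have "\<dots> = 1 / real (Suc n) - 1 / real (Suc (Suc n))" by (simp add: field_simps)
      finally show ?thesis .
    qed
    then show ?case using Suc by simp
  qed simp
  show ?thesis
  proof (cases N)
    case (Suc n)
    have "0 \<le> 1 / real (Suc n)" by simp
    then show ?thesis using *[of n] unfolding Suc by linarith
  qed simp
qed

text \<open>Group the triples by a common divisor \<open>e\<close>. Replacing every entry by its quotient by \<open>e\<close> leaves a
  sum over \<open>N div e\<close> that is at most \<open>16 * (N / e)\<^sup>2\<close>, and the series of the inverse squares converges. Three
  coefficients are needed here: with two of them a logarithm of \<open>N\<close> would appear.\<close>
lemma sum_gcd_over_max_le:
  "(\<Sum>h1\<in>nz N. \<Sum>h2\<in>nz N. \<Sum>h3\<in>nz N.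
      real_of_int (gcd h3 (gcd h1 h2)) / max_abs h1 h2) \<le> 32 * (real N)\<^sup>2"
proof -
  define D where "D e = {h\<in>nz N. int e dvd h}" for e
  have [simp]: "finite (D e)" for e by (simp add: D_def)
  have D_eq: "D e = (*) (int e) ` nz (N div e)" if e: "1 \<le> e" for e
  proof safe
    fix h assume h: "h \<in> D e"
    then obtain k where k: "h = int e * k" by (auto simp: D_def)
    have "\<bar>h\<bar> \<le> int N" "h \<noteq> 0" using h by (auto simp: D_def nz_def)
    then have "int e * \<bar>k\<bar> \<le> int N" by (simp add: k abs_mult)
    then have "(int e * \<bar>k\<bar>) div int e \<le> int N div int e" using e by (intro zdiv_mono1) auto
    then have "\<bar>k\<bar> \<le> int (N div e)" using e by (simp add: zdiv_int)
    then have "k \<in> nz (N div e)" using k \<open>h \<noteq> 0\<close> by (auto simp: nz_def)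
    then show "h \<in> (*) (int e) ` nz (N div e)" using k by blast
  next
    fix k assume k: "k \<in> nz (N div e)"
    then have "\<bar>k\<bar> \<le> int (N div e)" by (auto simp: nz_def)
    then have "int e * \<bar>k\<bar> \<le> int e * int (N div e)" by (intro mult_left_mono) auto
    also have "\<dots> \<le> int N" by (metis of_nat_le_iff of_nat_mult times_div_less_eq_dividend)
    finally have "\<bar>int e * k\<bar> \<le> int N" by (simp add: abs_mult)
    then show "int e * k \<in> D e" using k e by (auto simp: D_def nz_def)
  qed
  have inj: "inj_on ((*) (int e)) S" if "1 \<le> e" for e S using that by (auto simp: inj_on_def)
  have De: "(\<Sum>h1\<in>D e. \<Sum>h2\<in>D e. \<Sum>h3\<in>D e. real e / max_abs h1 h2) \<le> 16 * (real N)\<^sup>2 * (1 / (real e)\<^sup>2)"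
    if e: "1 \<le> e" for e
  proof -
    have mx: "max \<bar>int e * x\<bar> \<bar>int e * y\<bar> = int e * max \<bar>x\<bar> \<bar>y\<bar>" for x y
      using e by (simp add: abs_mult max_def mult_le_cancel_left)
    have "(\<Sum>h1\<in>D e. \<Sum>h2\<in>D e. \<Sum>h3\<in>D e. real e / max_abs h1 h2)
       = (\<Sum>x\<in>nz (N div e). \<Sum>y\<in>nz (N div e). 2 * real (N div e) * (1 / max_abs x y))"
      unfolding D_eq[OF e] sum.reindex[OF inj[OF e]] o_def
      using e by (intro sum.cong refl)
        (simp add: card_image[OF inj[OF e]] mx)
    also have "\<dots> = 2 * real (N div e) * (\<Sum>x\<in>nz (N div e). \<Sum>y\<in>nz (N div e). 1 / max_abs x y)"
      by (simp only: sum_distrib_left)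
    also have "\<dots> \<le> 2 * real (N div e) * (8 * real (N div e))"
      by (intro mult_left_mono sum_inverse_max_le) auto
    also have "\<dots> = 16 * (real (N div e))\<^sup>2" by (simp add: power2_eq_square)
    also have "\<dots> \<le> 16 * (real N / real e)\<^sup>2"
    proof (intro mult_left_mono power_mono)
      have "real (N div e) * real e \<le> real N"
        using div_times_less_eq_dividend[of N e] by (metis of_nat_le_iff of_nat_mult)
      then show "real (N div e) \<le> real N / real e" using e by (simp add: field_simps)
    qed auto
    finally show ?thesis by (simp add: power_divide)
  qed
  have "(\<Sum>h1\<in>nz N. \<Sum>h2\<in>nz N. \<Sum>h3\<in>nz N. real_of_int (gcd h3 (gcd h1 h2)) / max_abs h1 h2)
    \<le> (\<Sum>h1\<in>nz N. \<Sum>h2\<in>nz N. \<Sum>h3\<in>nz N. \<Sum>e=1..N.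
        if int e dvd h1 \<and> int e dvd h2 \<and> int e dvd h3 then real e / max_abs h1 h2 else 0)"
  proof (intro sum_mono)
    fix h1 h2 h3 assume h: "h1 \<in> nz N" "h2 \<in> nz N" "h3 \<in> nz N"
    define e where "e = nat (gcd h3 (gcd h1 h2))"
    have h0: "h1 \<noteq> 0" "\<bar>h1\<bar> \<le> int N" using h by (auto simp: nz_def)
    have gpos: "0 < gcd h3 (gcd h1 h2)" using h0 by simp
    have ge: "gcd h3 (gcd h1 h2) = int e" using gpos by (simp add: e_def)
    have dv: "int e dvd h1" "int e dvd h2" "int e dvd h3"
      unfolding ge[symmetric] by (auto intro: dvd_trans)
    have "int e \<le> \<bar>h1\<bar>" using dvd_imp_le_int[OF h0(1) dv(1)] by simp
    then have e: "e \<in> {1..N}" using h0 gpos ge by auto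
    have "real_of_int (gcd h3 (gcd h1 h2)) / max_abs h1 h2
      = (if int e dvd h1 \<and> int e dvd h2 \<and> int e dvd h3 then real e / max_abs h1 h2 else 0)"
      using dv by (simp add: ge)
    also have "\<dots> \<le> (\<Sum>e=1..N. if int e dvd h1 \<and> int e dvd h2 \<and> int e dvd h3
        then real e / max_abs h1 h2 else 0)"
      by (rule member_le_sum[OF e]) auto
    finally show "real_of_int (gcd h3 (gcd h1 h2)) / max_abs h1 h2 \<le> \<dots>" .
  qed
  also have "\<dots> = (\<Sum>h1\<in>nz N. \<Sum>h2\<in>nz N. \<Sum>e=1..N. \<Sum>h3\<in>nz N. 
      if int e dvd h1 \<and> int e dvd h2 \<and> int e dvd h3 then real e / max_abs h1 h2 else 0)"
    by (intro sum.cong refl sum.swap)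
  also have "\<dots> = (\<Sum>h1\<in>nz N. \<Sum>e=1..N. \<Sum>h2\<in>nz N. \<Sum>h3\<in>nz N. 
      if int e dvd h1 \<and> int e dvd h2 \<and> int e dvd h3 then real e / max_abs h1 h2 else 0)"
    by (intro sum.cong refl sum.swap)
  also have "\<dots> = (\<Sum>e=1..N. \<Sum>h1\<in>nz N. \<Sum>h2\<in>nz N. \<Sum>h3\<in>nz N. 
      if int e dvd h1 \<and> int e dvd h2 \<and> int e dvd h3 then real e / max_abs h1 h2 else 0)"
    by (intro sum.cong refl sum.swap)
  also have "\<dots> = (\<Sum>e=1..N. \<Sum>h1\<in>D e. \<Sum>h2\<in>D e. \<Sum>h3\<in>D e. real e / max_abs h1 h2)"
  proof (rule sum.cong[OF refl])
    fix e
    show "(\<Sum>h1\<in>nz N. \<Sum>h2\<in>nz N. \<Sum>h3\<in>nz N. if int e dvd h1 \<and> int e dvd h2 \<and> int e dvd h3 then real e / max_abs h1 h2 else 0)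
      = (\<Sum>h1\<in>D e. \<Sum>h2\<in>D e. \<Sum>h3\<in>D e. real e / max_abs h1 h2)"
      unfolding D_def sum.inter_filter[OF finite_nz]
      by (intro sum.cong refl) (auto intro!: sum.cong)
  qed
  also have "\<dots> \<le> (\<Sum>e=1..N. 16 * (real N)\<^sup>2 * (1 / (real e)\<^sup>2))" by (intro sum_mono De) auto
  also have "\<dots> = 16 * (real N)\<^sup>2 * (\<Sum>e=1..N. 1 / (real e)\<^sup>2)" by (simp add: sum_distrib_left)
  also have "\<dots> \<le> 16 * (real N)\<^sup>2 * 2" by (intro mult_left_mono sum_inverse_squares_le) auto
  finally show ?thesis by simp
qed

text \<open>The total number of choices is of the order \<open>N\<^sup>3 * Y\<^sup>3\<close> and the left hand sides of the equation are of the
  size \<open>N * Y\<close>, so this is the expected order of magnitude, without any logarithm.\<close>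
theorem card_bilinear_solutions_le:
  assumes N: "int N \<le> Y"
  shows "(\<Sum>h1\<in>nz N. \<Sum>m1\<in>{-Y..Y}. \<Sum>h2\<in>nz N. \<Sum>m2\<in>{-Y..Y}. \<Sum>h3\<in>nz N. \<Sum>m3\<in>{-Y..Y}.
      if h1 * m1 + h2 * m2 + h3 * m3 = 0 then 1 else 0 :: real) \<le> 288 * (real_of_int Y)\<^sup>2 * (real N)\<^sup>2"
proof -
  let ?I = "{-Y..Y}"
  let ?f = "\<lambda>h1 m1 h2 m2 h3 m3. if h1 * m1 + h2 * m2 + h3 * m3 = 0 then 1 else 0 :: real"
  have "(\<Sum>h1\<in>nz N. \<Sum>m1\<in>?I. \<Sum>h2\<in>nz N. \<Sum>m2\<in>?I. \<Sum>h3\<in>nz N. \<Sum>m3\<in>?I. ?f h1 m1 h2 m2 h3 m3)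
     = (\<Sum>h1\<in>nz N. \<Sum>m1\<in>?I. \<Sum>h2\<in>nz N. \<Sum>h3\<in>nz N. \<Sum>m2\<in>?I. \<Sum>m3\<in>?I. ?f h1 m1 h2 m2 h3 m3)"
    by (intro sum.cong refl sum.swap)
  also have "\<dots> = (\<Sum>h1\<in>nz N. \<Sum>h2\<in>nz N. \<Sum>m1\<in>?I. \<Sum>h3\<in>nz N. \<Sum>m2\<in>?I. \<Sum>m3\<in>?I. ?f h1 m1 h2 m2 h3 m3)"
    by (intro sum.cong refl sum.swap)
  also have "\<dots> = (\<Sum>h1\<in>nz N. \<Sum>h2\<in>nz N. \<Sum>h3\<in>nz N. \<Sum>m1\<in>?I. \<Sum>m2\<in>?I. \<Sum>m3\<in>?I. ?f h1 m1 h2 m2 h3 m3)"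
    by (intro sum.cong refl sum.swap)
  also have "\<dots> \<le> (\<Sum>h1\<in>nz N. \<Sum>h2\<in>nz N. \<Sum>h3\<in>nz N.
      9 * (real_of_int Y)\<^sup>2 * (real_of_int (gcd h3 (gcd h1 h2)) / max_abs h1 h2))"
  proof (intro sum_mono)
    fix h1 h2 h3 assume "h1 \<in> nz N" "h2 \<in> nz N" "h3 \<in> nz N"
    then have "h1 \<noteq> 0" "h2 \<noteq> 0" "\<bar>h1\<bar> \<le> Y" "\<bar>h2\<bar> \<le> Y" using N by (auto simp: nz_def)
    from card_solutions_3_le[OF this, of h3]
    show "(\<Sum>m1\<in>?I. \<Sum>m2\<in>?I. \<Sum>m3\<in>?I. ?f h1 m1 h2 m2 h3 m3)
      \<le> 9 * (real_of_int Y)\<^sup>2 * (real_of_int (gcd h3 (gcd h1 h2)) / max_abs h1 h2)" by simp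
  qed
  also have "\<dots> = 9 * (real_of_int Y)\<^sup>2 * (\<Sum>h1\<in>nz N. \<Sum>h2\<in>nz N. \<Sum>h3\<in>nz N.
      real_of_int (gcd h3 (gcd h1 h2)) / max_abs h1 h2)"
    by (simp only: sum_distrib_left)
  also have "\<dots> \<le> 9 * (real_of_int Y)\<^sup>2 * (32 * (real N)\<^sup>2)"
    by (intro mult_left_mono sum_gcd_over_max_le) auto
  finally show ?thesis by simp
qed

section \<open>The mean value of Weyl sums\<close>

text \<open>Polynomials are given by their coefficients, because the bounds below have to be uniform over
  all polynomials whose \<open>i\<close>-th coefficient is of the size \<open>N ^ (n - i)\<close>.\<close>
definition poly_val :: "(nat \<Rightarrow> int) \<Rightarrow> nat \<Rightarrow> int \<Rightarrow> int" where
  "poly_val a n x = (\<Sum>i\<le>n. a i * x ^ i)"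

text \<open>The coefficients of \<open>(f (y + h) - f y) / h\<close> as a polynomial in \<open>y\<close>, where \<open>f = poly_val a (Suc n)\<close>.\<close>
definition diff_quot :: "(nat \<Rightarrow> int) \<Rightarrow> nat \<Rightarrow> int \<Rightarrow> nat \<Rightarrow> int" where
  "diff_quot a n h m = (\<Sum>i=Suc m..Suc n. a i * int (i choose m) * h ^ (i - 1 - m))"

text \<open>The values of \<open>f x1 - f x1' + \<dots> + f xs - f xs'\<close> with multiplicity, all variables in \<open>X\<close>.\<close>
definition reps :: "(int \<Rightarrow> int) \<Rightarrow> int set \<Rightarrow> nat \<Rightarrow> int multiset" where
  "reps f X s = mpow (mdiff (image_mset f (mset_set X))) s"

lemma poly_val_diff: "poly_val a (Suc n) (y + h) - poly_val a (Suc n) y = h * poly_val (diff_quot a n h) n y"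
proof -
  have power_diff: "(y + h) ^ i - y ^ i = (\<Sum>m<i. int (i choose m) * y ^ m * h ^ (i - m))" for i
    using binomial_ring[of y h i] by (simp add: lessThan_Suc_atMost[symmetric])
  have "poly_val a (Suc n) (y + h) - poly_val a (Suc n) y = (\<Sum>i\<le>Suc n. a i * ((y + h) ^ i - y ^ i))"
    unfolding poly_val_def by (simp only: right_diff_distrib sum_subtractf)
  also have "\<dots> = (\<Sum>i\<le>Suc n. \<Sum>m<i. h * (a i * int (i choose m) * h ^ (i - 1 - m) * y ^ m))"
  proof (intro sum.cong refl)
    fix i
    have "h ^ (i - m) = h * h ^ (i - 1 - m)" if "m < i" for m
      using that by (simp add: power_Suc[symmetric] Suc_diff_Suc del: power_Suc)
    then show "a i * ((y + h) ^ i - y ^ i) = (\<Sum>m<i. h * (a i * int (i choose m) * h ^ (i - 1 - m) * y ^ m))"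
      unfolding power_diff sum_distrib_left by (intro sum.cong) auto
  qed
  also have "\<dots> = (\<Sum>m<Suc n. \<Sum>i=Suc m..Suc n. h * (a i * int (i choose m) * h ^ (i - 1 - m) * y ^ m))"
    by (rule sum.nested_swap')
  also have "\<dots> = h * poly_val (diff_quot a n h) n y"
    by (simp add: poly_val_def diff_quot_def sum_distrib_left sum_distrib_right lessThan_Suc_atMost del: sum.cl_ivl_Suc)
  finally show ?thesis .
qed

lemma diff_quot_lead: "diff_quot a n h n = a (Suc n) * int (Suc n)"
  by (simp add: diff_quot_def)

lemma abs_diff_quot_le:
  assumes a: "\<And>i. i \<le> Suc n \<Longrightarrow> \<bar>a i\<bar> \<le> int D * int N ^ (Suc n - i)" and h: "\<bar>h\<bar> \<le> int N" and m: "m \<le> n"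
  shows "\<bar>diff_quot a n h m\<bar> \<le> int (Suc n * 2 ^ Suc n * D) * int N ^ (n - m)"
proof -
  have "\<bar>diff_quot a n h m\<bar> \<le> (\<Sum>i=Suc m..Suc n. \<bar>a i * int (i choose m) * h ^ (i - 1 - m)\<bar>)"
    unfolding diff_quot_def by (rule sum_abs)
  also have "\<dots> \<le> (\<Sum>i=Suc m..Suc n. int (2 ^ Suc n * D) * int N ^ (n - m))"
  proof (rule sum_mono)
    fix i assume i: "i \<in> {Suc m..Suc n}"
    have "i choose m \<le> 2 ^ i" by (rule binomial_le_pow2)
    also have "(2::nat) ^ i \<le> 2 ^ Suc n" using i by (intro power_increasing) auto
    finally have "int (i choose m) \<le> int (2 ^ Suc n)" by (rule of_nat_mono)
    moreover have "\<bar>h\<bar> ^ (i - 1 - m) \<le> int N ^ (i - 1 - m)" using h by (intro power_mono) auto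
    ultimately have "\<bar>a i\<bar> * int (i choose m) * \<bar>h\<bar> ^ (i - 1 - m)
        \<le> (int D * int N ^ (Suc n - i)) * int (2 ^ Suc n) * int N ^ (i - 1 - m)"
      using a[of i] i by (intro mult_mono) auto
    also have "\<dots> = int (2 ^ Suc n * D) * (int N ^ (Suc n - i) * int N ^ (i - 1 - m))" by simp
    also have "int N ^ (Suc n - i) * int N ^ (i - 1 - m) = int N ^ (n - m)"
      using i by (simp add: power_add[symmetric])
    finally show "\<bar>a i * int (i choose m) * h ^ (i - 1 - m)\<bar> \<le> int (2 ^ Suc n * D) * int N ^ (n - m)"
      by (simp add: abs_mult power_abs)
  qed
  also have "\<dots> = int (Suc n - m) * (int (2 ^ Suc n * D) * int N ^ (n - m))" by simp
  also have "\<dots> \<le> int (Suc n) * (int (2 ^ Suc n * D) * int N ^ (n - m))"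
    by (intro mult_right_mono) auto
  also have "\<dots> = int (Suc n * 2 ^ Suc n * D) * int N ^ (n - m)"
    by (simp only: of_nat_mult mult.assoc)
  finally show ?thesis .
qed

lemma abs_poly_val_le:
  assumes b: "\<And>m. m \<le> n \<Longrightarrow> \<bar>b m\<bar> \<le> int D * int N ^ (n - m)" and y: "\<bar>y\<bar> \<le> int N"
  shows "\<bar>poly_val b n y\<bar> \<le> int (Suc n * D) * int N ^ n"
proof -
  have "\<bar>poly_val b n y\<bar> \<le> (\<Sum>m\<le>n. \<bar>b m * y ^ m\<bar>)" unfolding poly_val_def by (rule sum_abs)
  also have "\<dots> \<le> (\<Sum>m\<le>n. int D * int N ^ n)"
  proof (rule sum_mono)
    fix m assume "m \<in> {..n}"
    then have m: "m \<le> n" by simp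
    have "\<bar>b m\<bar> * \<bar>y\<bar> ^ m \<le> (int D * int N ^ (n - m)) * int N ^ m"
      using b[OF m] y by (intro mult_mono power_mono) auto
    then show "\<bar>b m * y ^ m\<bar> \<le> int D * int N ^ n"
      using m by (simp add: abs_mult power_abs mult.assoc power_add[symmetric])
  qed
  finally show ?thesis by (simp add: algebra_simps)
qed

lemma trig_reps: "finite X \<Longrightarrow> trig \<theta> (reps f X s) = complex_of_real (cmod (\<Sum>x\<in>X. cis (\<theta> * real_of_int (f x))) ^ (2 * s))"
  by (simp add: reps_def trig_mpow_mdiff trig_mset_set)

lemma sum_mset_eq_sum_count:
  fixes g :: "int \<Rightarrow> real"
  assumes "finite I" "set_mset A \<subseteq> I"
  shows "(\<Sum>m\<in>#A. g m) = (\<Sum>m\<in>I. real (count A m) * g m)"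
  using assms(2)
proof (induction A)
  case (add a A)
  have "(\<Sum>m\<in>I. real (count (add_mset a A) m) * g m)
      = (\<Sum>m\<in>I. real (count A m) * g m + (if m = a then g m else 0))"
    by (intro sum.cong) (auto simp: algebra_simps)
  then show ?case using add assms(1) by (simp add: sum.distrib)
qed simp

lemma sum_mset_Sum: "finite H \<Longrightarrow> (\<Sum>a\<in>#(\<Sum>h\<in>H. A h). g a) = (\<Sum>h\<in>H. \<Sum>a\<in>#A h. g a)" for g :: "int \<Rightarrow> real"
  by (induction H rule: finite_induct) auto

lemma sum_mset_nonneg_real: "(\<And>x. 0 \<le> g x) \<Longrightarrow> 0 \<le> (\<Sum>x\<in>#A. g x)" for g :: "int \<Rightarrow> real"
  by (induction A) (auto intro: add_nonneg_nonneg)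

text \<open>Expand the square and group the pairs by their difference \<open>h\<close>; the diagonal contributes \<open>N\<close>.\<close>
lemma weyl_differencing:
  fixes f :: "int \<Rightarrow> int"
  defines "X \<equiv> \<lambda>N h. {y\<in>{1..int N}. y + h \<in> {1..int N}}"
  shows "(cmod (\<Sum>x\<in>{1..int N}. cis (\<theta> * real_of_int (f x))))\<^sup>2
    \<le> real N + (\<Sum>h\<in>nz N. cmod (\<Sum>y\<in>X N h. cis (\<theta> * real_of_int (f (y + h) - f y))))"
proof -
  let ?I = "{1..int N}"
  let ?e = "\<lambda>x y. cis (\<theta> * real_of_int (f x - f y))"
  define S where "S = (\<Sum>x\<in>?I. cis (\<theta> * real_of_int (f x)))"
  have fin: "finite (X N h)" for h by (rule finite_subset[of _ ?I]) (auto simp: X_def)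
  have "complex_of_real ((cmod S)\<^sup>2) = S * cnj S" by (rule complex_norm_square)
  also have "\<dots> = (\<Sum>x\<in>?I. \<Sum>y\<in>?I. ?e x y)"
    by (simp add: S_def sum_product cis_cnj cis_mult right_diff_distrib)
  also have "\<dots> = (\<Sum>(x, y)\<in>?I \<times> ?I. ?e x y)" by (rule sum.cartesian_product)
  also have "\<dots> = (\<Sum>(h, y)\<in>(SIGMA h:{-int N..int N}. X N h). ?e (y + h) y)"
    by (rule sum.reindex_bij_witness[of _ "\<lambda>(h, y). (y + h, y)" "\<lambda>(x, y). (x - y, y)"])
       (auto simp: X_def)
  also have "\<dots> = (\<Sum>h\<in>{-int N..int N}. \<Sum>y\<in>X N h. ?e (y + h) y)"
    by (rule sum.Sigma[symmetric]) (auto simp: fin)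
  also have "{-int N..int N} = insert 0 (nz N)" by (auto simp: nz_def)
  also have "(\<Sum>h\<in>insert 0 (nz N). \<Sum>y\<in>X N h. ?e (y + h) y) = of_nat N + (\<Sum>h\<in>nz N. \<Sum>y\<in>X N h. ?e (y + h) y)"
  proof -
    have "X N 0 = ?I" by (auto simp: X_def)
    then show ?thesis by (subst sum.insert) (auto simp: nz_def)
  qed
  finally have "(cmod S)\<^sup>2 = cmod (of_nat N + (\<Sum>h\<in>nz N. \<Sum>y\<in>X N h. ?e (y + h) y))"
    by (metis norm_of_real abs_power2 abs_of_nonneg norm_ge_zero power_abs)
  also have "\<dots> \<le> real N + cmod (\<Sum>h\<in>nz N. \<Sum>y\<in>X N h. ?e (y + h) y)"
    by (rule order_trans[OF norm_triangle_ineq]) simp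
  also have "\<dots> \<le> real N + (\<Sum>h\<in>nz N. cmod (\<Sum>y\<in>X N h. ?e (y + h) y))"
    by (intro add_left_mono norm_sum)
  finally show ?thesis by (simp add: S_def)
qed

lemma power_sum_le:
  fixes x :: "'b \<Rightarrow> real"
  assumes H: "finite H" and x: "\<And>h. h \<in> H \<Longrightarrow> 0 \<le> x h" and k: "even k" "1 \<le> k"
  shows "(\<Sum>h\<in>H. x h) ^ k \<le> real (card H) ^ (k - 1) * (\<Sum>h\<in>H. x h ^ k)"
proof (cases "H = {}")
  case True
  then show ?thesis using k by (simp add: power_0_left)
next
  case False
  then have c: "0 < real (card H)" using H by (simp add: card_gt_0_iff)
  have cvx: "convex_on UNIV (\<lambda>x::real. x ^ k)" by (rule convex_power_even[OF k(1)])
  have "((\<Sum>h\<in>H. (1 / real (card H)) *\<^sub>R x h)) ^ k \<le> (\<Sum>h\<in>H. (1 / real (card H)) * x h ^ k)"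
    using H False x c by (intro convex_on_sum[OF _ _ cvx]) auto
  then have "(\<Sum>h\<in>H. x h) ^ k / real (card H) ^ k \<le> (\<Sum>h\<in>H. x h ^ k) / real (card H)"
    by (simp add: sum_divide_distrib[symmetric] power_divide)
  then have "(\<Sum>h\<in>H. x h) ^ k \<le> (\<Sum>h\<in>H. x h ^ k) / real (card H) * real (card H) ^ k"
    using c by (simp add: field_simps)
  also have "\<dots> = real (card H) ^ (k - 1) * (\<Sum>h\<in>H. x h ^ k)"
    using c k by (cases k) auto
  finally show ?thesis .
qed

lemma power_add_le:
  fixes x y :: real
  assumes "0 \<le> x" "0 \<le> y"
  shows "(x + y) ^ k \<le> 2 ^ k * (x ^ k + y ^ k)"
proof -
  have "(x + y) ^ k \<le> (2 * max x y) ^ k" using assms by (intro power_mono) auto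
  also have "\<dots> = 2 ^ k * max x y ^ k" by (simp add: power_mult_distrib)
  also have "\<dots> \<le> 2 ^ k * (x ^ k + y ^ k)" using assms by (auto simp: max_def)
  finally show ?thesis .
qed

text \<open>Differencing turns \<open>\<bar>S\<bar>\<^sup>2\<close> into a sum over \<open>h\<close> of sums with frequencies \<open>h * \<phi> h y\<close>. After raising it to the
  power \<open>2 * s\<close>, convexity leaves the sum of the \<open>2 * s\<close>-th powers, which is the exponential sum
  of the multiset of all \<open>h * m\<close> with \<open>m\<close> from \<open>reps (\<phi> h)\<close>. It is nonnegative, hence equal to \<open>v\<close>, and the cube is
  taken because three summands \<open>h * m\<close> are needed in the count of solutions.\<close>
lemma mean_value_from_sum_of_powers:
  fixes \<theta> :: real and N s :: nat and a :: "nat \<Rightarrow> int" and n :: nat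
  assumes s: "1 \<le> s" and N: "1 \<le> N"
  defines "X \<equiv> \<lambda>h. {y\<in>{1..int N}. y + h \<in> {1..int N}}"
  defines "V \<equiv> (\<Sum>h\<in>nz N. image_mset ((*) h) (reps (poly_val (diff_quot a n h) n) (X h) s))"
  shows "\<exists>v::real. 0 \<le> v \<and> trig \<theta> V = complex_of_real v \<and>
    cmod (\<Sum>x\<in>{1..int N}. cis (\<theta> * real_of_int (poly_val a (Suc n) x))) ^ (12 * s)
      \<le> 2 ^ (6 * s) * (real N ^ (6 * s) + (2 * real N) ^ (6 * s - 3) * v ^ 3)"
proof -
  define f where "f = poly_val a (Suc n)"
  define S where "S = (\<Sum>x\<in>{1..int N}. cis (\<theta> * real_of_int (f x)))"
  define U where "U h = cmod (\<Sum>y\<in>X h. cis (\<theta> * real_of_int (f (y + h) - f y)))" for h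
  define v where "v = (\<Sum>h\<in>nz N. U h ^ (2 * s))"
  have fin: "finite (X h)" for h by (rule finite_subset[of _ "{1..int N}"]) (auto simp: X_def)
  have "trig \<theta> V = (\<Sum>h\<in>nz N. complex_of_real (U h ^ (2 * s)))"
    unfolding V_def trig_sum[OF finite_nz] trig_scale trig_reps[OF fin] U_def f_def poly_val_diff
    by (simp add: mult.assoc)
  then have trV: "trig \<theta> V = complex_of_real v" by (simp add: v_def)
  have U0: "0 \<le> U h" for h by (simp add: U_def)
  have v0: "0 \<le> v" unfolding v_def using U0 by (intro sum_nonneg) auto
  have S2: "(cmod S)\<^sup>2 \<le> real N + (\<Sum>h\<in>nz N. U h)"
    unfolding S_def U_def X_def by (rule weyl_differencing)
  have "cmod S ^ (12 * s) = ((cmod S)\<^sup>2) ^ (6 * s)" by (simp add: power_mult[symmetric])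
  also have "\<dots> \<le> (real N + (\<Sum>h\<in>nz N. U h)) ^ (6 * s)" by (intro power_mono S2) auto
  also have "\<dots> \<le> 2 ^ (6 * s) * (real N ^ (6 * s) + (\<Sum>h\<in>nz N. U h) ^ (6 * s))"
    using U0 by (intro power_add_le sum_nonneg) auto
  also have "(\<Sum>h\<in>nz N. U h) ^ (6 * s) = ((\<Sum>h\<in>nz N. U h) ^ (2 * s)) ^ 3" by (simp add: power_mult[symmetric])
  also have "\<dots> \<le> (real (card (nz N)) ^ (2 * s - 1) * v) ^ 3"
    unfolding v_def using s U0 by (intro power_mono power_sum_le zero_le_power sum_nonneg) auto
  also have "\<dots> = (2 * real N) ^ (6 * s - 3) * v ^ 3"
    by (simp add: power_mult_distrib power_mult[symmetric] diff_mult_distrib)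
  finally have "cmod S ^ (12 * s) \<le> 2 ^ (6 * s) * (real N ^ (6 * s) + (2 * real N) ^ (6 * s - 3) * v ^ 3)"
    by simp
  then show ?thesis using v0 trV unfolding S_def f_def by blast
qed

text \<open>As long as no \<open>m\<close> is represented more than \<open>B\<close> times, one may pretend that every \<open>m\<close> up to \<open>Y\<close> occurs
  exactly \<open>B\<close> times, and count solutions of the bilinear equation.\<close>
lemma sum_triple_multiset_le:
  fixes R :: "int \<Rightarrow> int multiset" and B :: real and Y :: int
  assumes B: "0 \<le> B" and N: "int N \<le> Y"
    and R: "\<And>h m. h \<in> nz N \<Longrightarrow> real (count (R h) m) \<le> B"
    and Y: "\<And>h m. h \<in> nz N \<Longrightarrow> m \<in># R h \<Longrightarrow> \<bar>m\<bar> \<le> Y"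
  defines "V \<equiv> (\<Sum>h\<in>nz N. image_mset ((*) h) (R h))"
  shows "real (count (mpow V 3) 0) \<le> B ^ 3 * (288 * (real_of_int Y)\<^sup>2 * (real N)\<^sup>2)"
proof -
  let ?I = "{-Y..Y}"
  have step: "(\<Sum>a\<in>#V. g a) \<le> B * (\<Sum>h\<in>nz N. \<Sum>m\<in>?I. g (h * m))" if g: "\<And>a. 0 \<le> g a" for g :: "int \<Rightarrow> real"
  proof -
    have "(\<Sum>a\<in>#V. g a) = (\<Sum>h\<in>nz N. \<Sum>m\<in>#R h. g (h * m))"
      by (simp add: V_def sum_mset_Sum image_mset.compositionality o_def)
    also have "\<dots> = (\<Sum>h\<in>nz N. \<Sum>m\<in>?I. real (count (R h) m) * g (h * m))"
      using Y by (intro sum.cong refl sum_mset_eq_sum_count) (force simp: abs_le_iff)+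
    also have "\<dots> \<le> (\<Sum>h\<in>nz N. \<Sum>m\<in>?I. B * g (h * m))"
      using R g by (intro sum_mono mult_right_mono) auto
    finally show ?thesis by (simp add: sum_distrib_left)
  qed
  let ?ind = "\<lambda>z::int. if z = 0 then 1 else 0 :: real"
  have "real (count (mpow V 3) 0) = (\<Sum>z\<in>#mpow V 3. ?ind z)" by (simp add: sum_mset_eq_count)
  also have "\<dots> = (\<Sum>a\<in>#V. \<Sum>b\<in>#V. \<Sum>c\<in>#V. ?ind (a + (b + c)))"
    by (simp add: numeral_3_eq_3 sum_mset_msum)
  also have "\<dots> \<le> B * (\<Sum>h1\<in>nz N. \<Sum>m1\<in>?I. \<Sum>b\<in>#V. \<Sum>c\<in>#V. ?ind (h1 * m1 + (b + c)))"
    by (rule step) (auto intro!: sum_mset_nonneg_real)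
  also have "\<dots> \<le> B * (\<Sum>h1\<in>nz N. \<Sum>m1\<in>?I. B * (\<Sum>h2\<in>nz N. \<Sum>m2\<in>?I. \<Sum>c\<in>#V. ?ind (h1 * m1 + (h2 * m2 + c))))"
    using B by (intro mult_left_mono sum_mono step) (auto intro!: sum_mset_nonneg_real)
  also have "\<dots> \<le> B * (\<Sum>h1\<in>nz N. \<Sum>m1\<in>?I. B * (\<Sum>h2\<in>nz N. \<Sum>m2\<in>?I. B * (\<Sum>h3\<in>nz N. \<Sum>m3\<in>?I.
      ?ind (h1 * m1 + (h2 * m2 + h3 * m3)))))"
    using B by (intro mult_left_mono sum_mono step) auto
  also have "\<dots> = B ^ 3 * (\<Sum>h1\<in>nz N. \<Sum>m1\<in>?I. \<Sum>h2\<in>nz N. \<Sum>m2\<in>?I. \<Sum>h3\<in>nz N. \<Sum>m3\<in>?I.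
      ?ind (h1 * m1 + h2 * m2 + h3 * m3))"
    by (simp only: sum_distrib_left[symmetric] power3_eq_cube mult.assoc add.assoc)
  also have "\<dots> \<le> B ^ 3 * (288 * (real_of_int Y)\<^sup>2 * (real N)\<^sup>2)"
    using B by (intro mult_left_mono card_bilinear_solutions_le N) auto
  finally show ?thesis .
qed

lemma reps_mono: "X \<subseteq> X' \<Longrightarrow> finite X' \<Longrightarrow> count (reps f X s) m \<le> count (reps f X' s) m"
  unfolding reps_def
  by (intro mset_subset_eq_count mpow_mono mdiff_mono image_mset_subseteq_mono)
     (simp add: finite_subset subset_imp_msubset_mset_set)

lemma abs_reps_le:
  assumes "finite X" "\<And>x. x \<in> X \<Longrightarrow> \<bar>f x\<bar> \<le> M" "m \<in># reps f X s"
  shows "\<bar>m\<bar> \<le> int s * (2 * M)"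
  using assms(3) unfolding reps_def
  by (rule abs_mpow_le[rotated]) (rule abs_mdiff_le, use assms(1,2) in auto)

text \<open>The number of solutions is bounded for all right hand sides \<open>m\<close> and uniformly over a class of
  polynomials that is stable under taking difference quotients; both are needed for the
  induction on the degree \<open>n\<close>.\<close>
definition mean_value_bound :: "nat \<Rightarrow> nat \<Rightarrow> bool" where
  "mean_value_bound n s \<longleftrightarrow> (\<forall>D. \<exists>C\<ge>0. \<forall>N a m. 1 \<le> N \<longrightarrow> a n \<noteq> 0 \<longrightarrow>
     (\<forall>i\<le>n. \<bar>a i\<bar> \<le> int D * int N ^ (n - i)) \<longrightarrow>
     real (count (reps (poly_val a n) {1..int N} s) m) \<le> C * real N ^ (2 * s - n))"

lemma mean_value_bound_1: "mean_value_bound 1 1"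
  unfolding mean_value_bound_def
proof (intro allI exI[of _ 1] conjI impI)
  fix N m and a :: "nat \<Rightarrow> int"
  assume a: "a 1 \<noteq> 0"
  let ?I = "{1..int N}"
  have "real (count (reps (poly_val a 1) ?I 1) m)
     = (\<Sum>z\<in>#reps (poly_val a 1) ?I 1. if z = m then 1 else 0 :: real)" by (simp add: sum_mset_eq_count)
  also have "\<dots> = (\<Sum>x\<in>?I. \<Sum>y\<in>?I. if poly_val a 1 x - poly_val a 1 y = m then 1 else 0)"
    by (simp add: reps_def mdiff_def sum_mset_msum image_mset.compositionality o_def sum_unfold_sum_mset)
  also have "\<dots> \<le> (\<Sum>x\<in>?I. 1)"
  proof (rule sum_mono)
    fix x
    have "(\<Sum>y\<in>?I. if poly_val a 1 x - poly_val a 1 y = m then 1 else 0 :: real)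
        = real (card {y\<in>?I. poly_val a 1 x - poly_val a 1 y = m})"
      by (simp add: sum.If_cases Int_def)
    also have "card {y\<in>?I. poly_val a 1 x - poly_val a 1 y = m} \<le> 1"
    proof (subst card_le_Suc0_iff_eq[unfolded One_nat_def[symmetric]])
      show "finite {y\<in>?I. poly_val a 1 x - poly_val a 1 y = m}" by (rule finite_subset[of _ ?I]) auto
      show "\<forall>y\<in>{y\<in>?I. poly_val a 1 x - poly_val a 1 y = m}.
          \<forall>z\<in>{y\<in>?I. poly_val a 1 x - poly_val a 1 y = m}. y = z"
        using a by (auto simp: poly_val_def)
    qed
    finally show "(\<Sum>y\<in>?I. if poly_val a 1 x - poly_val a 1 y = m then 1 else 0 :: real) \<le> 1" by simp
  qed
  finally show "real (count (reps (poly_val a 1) ?I 1) m) \<le> 1 * real N ^ (2 * 1 - 1)" by simp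
qed simp

text \<open>The difference quotients belong to the class of degree \<open>n\<close>, so every value of their sums is represented at
  most \<open>B = C0 * N ^ (2 * s - n)\<close> times. Together with the bilinear count this bounds the mean value of
  \<open>v\<^sup>3\<close>, and then that of \<open>\<bar>S\<bar> ^ (12 * s)\<close>; the powers of \<open>N\<close> add up to \<open>12 * s - (n + 1)\<close> exactly.\<close>
lemma mean_value_bound_Suc:
  assumes mv: "mean_value_bound n s" and n: "1 \<le> n" and s: "1 \<le> s" "n \<le> 2 * s"
  shows "mean_value_bound (Suc n) (6 * s)"
  unfolding mean_value_bound_def
proof
  fix D :: nat
  define D1 where "D1 = Suc n * 2 ^ Suc n * D"
  define k where "k = 2 * s * (Suc n * D1)"
  obtain C0 where C0: "0 \<le> C0" "\<And>N b m. 1 \<le> N \<Longrightarrow> b n \<noteq> 0 \<Longrightarrow>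
     (\<And>i. i \<le> n \<Longrightarrow> \<bar>b i\<bar> \<le> int D1 * int N ^ (n - i)) \<Longrightarrow>
     real (count (reps (poly_val b n) {1..int N} s) m) \<le> C0 * real N ^ (2 * s - n)"
    using mv unfolding mean_value_bound_def by meson
  define C where "C = 2 ^ (6 * s) * (1 + 2 ^ (6 * s - 3) * (C0 ^ 3 * (288 * (real k)\<^sup>2)))"
  show "\<exists>C\<ge>0. \<forall>N a m. 1 \<le> N \<longrightarrow> a (Suc n) \<noteq> 0 \<longrightarrow>
     (\<forall>i\<le>Suc n. \<bar>a i\<bar> \<le> int D * int N ^ (Suc n - i)) \<longrightarrow>
     real (count (reps (poly_val a (Suc n)) {1..int N} (6 * s)) m) \<le> C * real N ^ (2 * (6 * s) - Suc n)"
  proof (intro exI[of _ C] conjI allI impI)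
    show "0 \<le> C" using C0(1) by (simp add: C_def)
    fix N m and a :: "nat \<Rightarrow> int"
    assume N: "1 \<le> N" and lead: "a (Suc n) \<noteq> 0"
      and a: "\<forall>i\<le>Suc n. \<bar>a i\<bar> \<le> int D * int N ^ (Suc n - i)"
    define X where "X h = {y\<in>{1..int N}. y + h \<in> {1..int N}}" for h
    define R where "R h = reps (poly_val (diff_quot a n h) n) (X h) s" for h
    define V where "V = (\<Sum>h\<in>nz N. image_mset ((*) h) (R h))"
    \<comment> \<open>\<open>B\<close> bounds the multiplicities in \<open>R h\<close>, and \<open>Y\<close> its elements.\<close>
    define B where "B = C0 * real N ^ (2 * s - n)"
    define Y where "Y = int (k * N ^ n)"
    have fin: "finite (X h)" for h by (rule finite_subset[of _ "{1..int N}"]) (auto simp: X_def)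
    have B: "0 \<le> B" using C0 by (simp add: B_def)
    have D: "1 \<le> D" using a[rule_format, of "Suc n"] lead by (cases D) auto
    have NY: "int N \<le> Y"
    proof -
      have "0 < D1" unfolding D1_def using D by (intro mult_pos_pos) auto
      then have "1 * N ^ 1 \<le> k * N ^ n"
        using s n N by (intro mult_mono power_increasing) (auto simp: k_def)
      then show ?thesis unfolding Y_def by (intro of_nat_mono) simp
    qed
    have dq: "\<bar>diff_quot a n h i\<bar> \<le> int D1 * int N ^ (n - i)" if "h \<in> nz N" "i \<le> n" for h i
      unfolding D1_def using a that by (intro abs_diff_quot_le) (auto simp: nz_def)
    have R_count: "real (count (R h) z) \<le> B" if h: "h \<in> nz N" for h z
    proof -
      have "count (R h) z \<le> count (reps (poly_val (diff_quot a n h) n) {1..int N} s) z"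
        unfolding R_def by (rule reps_mono) (auto simp: X_def)
      also have "real (count (reps (poly_val (diff_quot a n h) n) {1..int N} s) z) \<le> B"
        unfolding B_def using N dq[OF h] lead by (intro C0(2)) (auto simp: diff_quot_lead)
      finally show ?thesis by simp
    qed
    have R_Y: "\<bar>z\<bar> \<le> Y" if h: "h \<in> nz N" and z: "z \<in># R h" for h z
    proof -
      have "\<bar>z\<bar> \<le> int s * (2 * (int (Suc n * D1) * int N ^ n))"
      proof (rule abs_reps_le[OF fin _ z[unfolded R_def]])
        fix y assume "y \<in> X h"
        then have "\<bar>y\<bar> \<le> int N" by (auto simp: X_def)
        then show "\<bar>poly_val (diff_quot a n h) n y\<bar> \<le> int (Suc n * D1) * int N ^ n"
          using dq[OF h] by (intro abs_poly_val_le) auto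
      qed
      also have "\<dots> = Y" by (simp add: Y_def k_def)
      finally show ?thesis .
    qed
    have count_V: "real (count (mpow V 3) 0) \<le> B ^ 3 * (288 * (real_of_int Y)\<^sup>2 * (real N)\<^sup>2)"
      unfolding V_def by (rule sum_triple_multiset_le[OF B NY R_count R_Y])
    \<comment> \<open>The modulus is so large that a congruence to zero is an equality.\<close>
    define Q where "Q = Suc (nat (Max (insert 0 (abs ` set_mset (mpow V 3)))))"
    have Q: "0 < Q" "\<bar>z\<bar> < int Q" if "z \<in># mpow V 3" for z
    proof -
      have "\<bar>z\<bar> \<le> Max (insert 0 (abs ` set_mset (mpow V 3)))" using that by (intro Max_ge) auto
      then show "\<bar>z\<bar> < int Q" by (simp add: Q_def)
    qed (simp add: Q_def)
    have Q0: "0 < Q" by (simp add: Q_def)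
    let ?S = "\<lambda>j. \<Sum>x\<in>{1..int N}. cis (freq Q j * real_of_int (poly_val a (Suc n) x))"
    have "\<forall>j. \<exists>v::real. 0 \<le> v \<and> trig (freq Q j) V = complex_of_real v \<and>
      cmod (?S j) ^ (12 * s) \<le> 2 ^ (6 * s) * (real N ^ (6 * s) + (2 * real N) ^ (6 * s - 3) * v ^ 3)"
      unfolding V_def R_def X_def using mean_value_from_sum_of_powers[OF s(1) N] by blast
    then obtain v :: "nat \<Rightarrow> real" where v: "\<And>j. 0 \<le> v j" "\<And>j. trig (freq Q j) V = complex_of_real (v j)"
      "\<And>j. cmod (?S j) ^ (12 * s) \<le> 2 ^ (6 * s) * (real N ^ (6 * s) + (2 * real N) ^ (6 * s - 3) * v j ^ 3)"
      by metis
    have "complex_of_real (\<Sum>j<Q. v j ^ 3) = (\<Sum>j<Q. trig (freq Q j) (mpow V 3))"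
      by (simp add: trig_mpow v(2))
    also have "\<dots> = of_nat Q * of_nat (count (mpow V 3) 0)"
      using Q by (intro sum_trig_large Q0) auto
    finally have sum_v: "(\<Sum>j<Q. v j ^ 3) = real Q * real (count (mpow V 3) 0)"
      by (metis of_nat_mult of_real_eq_iff of_real_of_nat_eq)
    have "real Q * real (count (reps (poly_val a (Suc n)) {1..int N} (6 * s)) m)
        \<le> (\<Sum>j<Q. cmod (trig (freq Q j) (reps (poly_val a (Suc n)) {1..int N} (6 * s))))"
      by (rule count_le_mean_trig[OF Q0])
    also have "\<dots> = (\<Sum>j<Q. cmod (?S j) ^ (12 * s))"
      by (simp add: trig_reps norm_power)
    also have "\<dots> \<le> (\<Sum>j<Q. 2 ^ (6 * s) * (real N ^ (6 * s) + (2 * real N) ^ (6 * s - 3) * v j ^ 3))"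
      by (intro sum_mono v(3))
    also have "\<dots> = real Q * (2 ^ (6 * s) * (real N ^ (6 * s) + (2 * real N) ^ (6 * s - 3) * real (count (mpow V 3) 0)))"
      by (simp only: sum_distrib_left[symmetric] sum.distrib sum_v) (simp add: algebra_simps)
    finally have "real (count (reps (poly_val a (Suc n)) {1..int N} (6 * s)) m)
        \<le> 2 ^ (6 * s) * (real N ^ (6 * s) + (2 * real N) ^ (6 * s - 3) * real (count (mpow V 3) 0))"
      using Q0 by simp
    also have "\<dots> \<le> 2 ^ (6 * s) * (real N ^ (12 * s - Suc n)
        + (2 * real N) ^ (6 * s - 3) * (B ^ 3 * (288 * (real_of_int Y)\<^sup>2 * (real N)\<^sup>2)))"
      using N s n by (intro mult_left_mono add_mono power_increasing count_V) auto
    also have "(2 * real N) ^ (6 * s - 3) * (B ^ 3 * (288 * (real_of_int Y)\<^sup>2 * (real N)\<^sup>2))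
        = 2 ^ (6 * s - 3) * (C0 ^ 3 * (288 * (real k)\<^sup>2)) * (real N ^ (6 * s - 3)
            * (real N ^ (2 * s - n)) ^ 3 * (real N ^ n)\<^sup>2 * (real N)\<^sup>2)"
      by (simp add: B_def Y_def power_mult_distrib mult_ac)
    also have "real N ^ (6 * s - 3) * (real N ^ (2 * s - n)) ^ 3 * (real N ^ n)\<^sup>2 * (real N)\<^sup>2
        = real N ^ (12 * s - Suc n)"
    proof -
      have "6 * s - 3 + (2 * s - n) * 3 + n * 2 + 2 = 12 * s - Suc n" using s by simp
      then show ?thesis by (simp only: power_mult[symmetric] power_add[symmetric])
    qed
    also have "2 ^ (6 * s) * (real N ^ (12 * s - Suc n) + 2 ^ (6 * s - 3) * (C0 ^ 3 * (288 * (real k)\<^sup>2)) * real N ^ (12 * s - Suc n))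
        = C * real N ^ (2 * (6 * s) - Suc n)"
      by (simp add: C_def algebra_simps)
    finally show "real (count (reps (poly_val a (Suc n)) {1..int N} (6 * s)) m)
        \<le> C * real N ^ (2 * (6 * s) - Suc n)" .
  qed
qed

theorem mean_value_bound_exists: "\<exists>s\<ge>1. Suc n \<le> 2 * s \<and> mean_value_bound (Suc n) s"
proof (induction n)
  case 0
  show ?case using mean_value_bound_1 by (intro exI[of _ 1]) auto
next
  case (Suc n)
  then obtain s where "1 \<le> s" "Suc n \<le> 2 * s" "mean_value_bound (Suc n) s" by blast
  then show ?case using mean_value_bound_Suc[of "Suc n" s] by (intro exI[of _ "6 * s"]) auto
qed

section \<open>One-dimensional averages along integer polynomials\<close>

lemma count_mdiff_0:
  assumes "finite X" "set_mset A \<subseteq> X"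
  shows "real (count (mdiff A) 0) = (\<Sum>x\<in>X. (real (count A x))\<^sup>2)"
proof -
  have "real (count (mdiff A) 0) = (\<Sum>z\<in>#mdiff A. if z = 0 then 1 else 0 :: real)"
    by (simp add: sum_mset_eq_count)
  also have "\<dots> = (\<Sum>a\<in>#A. \<Sum>b\<in>#A. if b = a then 1 else 0)"
  proof -
    have "a + - b = 0 \<longleftrightarrow> b = a" for a b :: int by auto
    then show ?thesis
      unfolding mdiff_def sum_mset_msum image_mset.compositionality o_def by (simp only:)
  qed
  also have "\<dots> = (\<Sum>a\<in>#A. real (count A a))" by (simp add: sum_mset_eq_count)
  also have "\<dots> = (\<Sum>x\<in>X. real (count A x) * real (count A x))"
    by (rule sum_mset_eq_sum_count[OF assms])
  finally show ?thesis by (simp add: power2_eq_square)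
qed

lemma size_msum: "size (msum A B) = size A * size B"
  by (induction A) simp_all

lemma poly_eq_poly_val: "poly P x = poly_val (coeff P) (degree P) x"
  by (simp add: poly_val_def poly_altdef)

lemma count_shifts:
  assumes "finite E" "finite T"
  shows "count (msum (mset_set E) (image_mset f (mset_set T))) x = card {t\<in>T. x - f t \<in> E}"
proof -
  have "real (count (msum (mset_set E) (image_mset f (mset_set T))) x)
      = (\<Sum>z\<in>#msum (mset_set E) (image_mset f (mset_set T)). if z = x then 1 else 0 :: real)"
    by (simp add: sum_mset_eq_count)
  also have "\<dots> = (\<Sum>y\<in>E. \<Sum>t\<in>T. if y + f t = x then 1 else 0)"
    by (simp add: sum_mset_msum image_mset.compositionality o_def sum_unfold_sum_mset)
  also have "\<dots> = (\<Sum>t\<in>T. \<Sum>y\<in>E. if y = x - f t then 1 else 0)"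
    by (subst sum.swap) (intro sum.cong refl, auto)
  also have "\<dots> = (\<Sum>t\<in>T. if x - f t \<in> E then 1 else 0)" using assms by simp
  also have "\<dots> = real (card {t\<in>T. x - f t \<in> E})" using assms by (simp add: sum.If_cases Int_def)
  finally show ?thesis by simp
qed

lemma exists_large_modulus: "\<exists>Q::nat. 0 < Q \<and> (\<forall>z\<in>#A. \<bar>z\<bar> < int Q)"
proof (intro exI conjI ballI)
  let ?Q = "Suc (nat (Max (insert 0 (abs ` set_mset A))))"
  fix z assume "z \<in># A"
  then have "\<bar>z\<bar> \<le> Max (insert 0 (abs ` set_mset A))" by (intro Max_ge) auto
  then show "\<bar>z\<bar> < int ?Q" by simp
qed simp

abbreviation hits :: "int poly \<Rightarrow> nat \<Rightarrow> int set \<Rightarrow> int \<Rightarrow> nat" where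
  "hits P N E x \<equiv> card {t\<in>{1..int N}. x - poly P t \<in> E}"

text \<open>By Parseval's identity, the left hand side is the mean of \<open>\<bar>S\<bar>\<^sup>2 * \<bar>H\<bar>\<^sup>2\<close>, where \<open>H\<close> is the exponential sum
  of \<open>E\<close> and \<open>S\<close> the Weyl sum. Frequencies with \<open>\<bar>S\<bar> \<le> l * N\<close> contribute at most \<open>l\<^sup>2 * N\<^sup>2 * \<bar>E\<bar>\<close>. On the others
  \<open>\<bar>S\<bar>\<^sup>2\<close> is dominated by a multiple of \<open>\<bar>S\<bar> ^ (2 * s)\<close>, whose mean is small, and \<open>\<bar>H\<bar> \<le> \<bar>E\<bar>\<close> suffices.\<close>
lemma square_average_le:
  fixes P :: "int poly"
  assumes d: "degree P = d" "1 \<le> d"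
  shows "\<exists>s\<ge>1. \<exists>C>0. \<forall>N\<ge>1. \<forall>E X. finite E \<longrightarrow> E \<noteq> {} \<longrightarrow> finite X \<longrightarrow>
    (\<Sum>x\<in>X. (real (hits P N E x))\<^sup>2)
      \<le> 2 * (real N)\<^sup>2 * real (card E) * (C * real N powr (- real d) * real (card E)) powr (1 / real s)"
proof -
  obtain s where s: "1 \<le> s" "d \<le> 2 * s" "mean_value_bound d s"
    using mean_value_bound_exists[of "d - 1"] d by auto
  define D where "D = (\<Sum>i\<le>d. nat \<bar>coeff P i\<bar>)"
  have D: "\<bar>coeff P i\<bar> \<le> int D" if "i \<le> d" for i
  proof -
    have "nat \<bar>coeff P i\<bar> \<le> D" unfolding D_def using that by (intro member_le_sum) auto
    then show ?thesis by linarith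
  qed
  obtain C0 where C0: "0 \<le> C0" "\<And>N a m. 1 \<le> N \<Longrightarrow> a d \<noteq> 0 \<Longrightarrow>
     (\<forall>i\<le>d. \<bar>a i\<bar> \<le> int D * int N ^ (d - i)) \<Longrightarrow>
     real (count (reps (poly_val a d) {1..int N} s) m) \<le> C0 * real N ^ (2 * s - d)"
    using s(3) unfolding mean_value_bound_def by meson
  define C where "C = C0 + 1"
  have C: "0 < C" using C0 by (simp add: C_def)
  show ?thesis
  proof (rule exI[of _ s], intro conjI s(1), rule exI[of _ C], intro conjI C allI impI)
    fix N :: nat and E X :: "int set"
    assume N: "1 \<le> N" and E: "finite E" "E \<noteq> {}" and X: "finite X"
    define e where "e = real (card E)"
    have e: "0 < e" using E by (simp add: e_def card_gt_0_iff)
    have N0: "0 < real N" using N by simp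
    define F where "F = image_mset (poly P) (mset_set {1..int N})"
    define EE where "EE = mset_set E"
    define A where "A = msum EE F"
    define R where "R = reps (poly P) {1..int N} s"
    have R: "real (count R 0) \<le> C * real N ^ (2 * s - d)"
    proof -
      have "real (count R 0) \<le> C0 * real N ^ (2 * s - d)"
        unfolding R_def poly_eq_poly_val[of P] d(1)
      proof (intro C0(2) N allI impI)
        show "coeff P d \<noteq> 0" using d by auto
        fix i assume "i \<le> d"
        then have "\<bar>coeff P i\<bar> \<le> int D * 1" using D by simp
        also have "\<dots> \<le> int D * int N ^ (d - i)" using N by (intro mult_left_mono) auto
        finally show "\<bar>coeff P i\<bar> \<le> int D * int N ^ (d - i)" .
      qed
      also have "\<dots> \<le> C * real N ^ (2 * s - d)" by (intro mult_right_mono) (auto simp: C_def)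
      finally show ?thesis .
    qed
    obtain Q where Q: "0 < Q" "\<And>z. z \<in># mdiff EE + R \<Longrightarrow> \<bar>z\<bar> < int Q"
      using exists_large_modulus[of "mdiff EE + R"] by blast
    define S where "S j = cmod (trig (freq Q j) F)" for j
    define H where "H j = cmod (trig (freq Q j) EE)" for j
    have H: "0 \<le> H j" "H j \<le> e" for j
      using cmod_trig_le[of "freq Q j" EE] by (auto simp: H_def EE_def e_def)
    have sumH: "(\<Sum>j<Q. (H j)\<^sup>2) = real Q * e"
    proof -
      have "complex_of_real (\<Sum>j<Q. (H j)\<^sup>2) = (\<Sum>j<Q. trig (freq Q j) (mdiff EE))"
        by (simp add: trig_mdiff H_def)
      also have "\<dots> = of_nat Q * of_nat (count (mdiff EE) 0)"
        using Q by (intro sum_trig_large) auto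
      finally have "(\<Sum>j<Q. (H j)\<^sup>2) = real Q * real (count (mdiff EE) 0)"
        by (metis of_nat_mult of_real_eq_iff of_real_of_nat_eq)
      also have "real (count (mdiff EE) 0) = e"
        using count_mdiff_0[of E EE] E by (simp add: EE_def e_def)
      finally show ?thesis .
    qed
    have sumS: "(\<Sum>j<Q. S j ^ (2 * s)) \<le> real Q * (C * real N ^ (2 * s - d))"
    proof -
      have "complex_of_real (\<Sum>j<Q. S j ^ (2 * s)) = (\<Sum>j<Q. trig (freq Q j) R)"
        by (simp add: trig_reps R_def S_def F_def trig_mset_set)
      also have "\<dots> = of_nat Q * of_nat (count R 0)"
        using Q by (intro sum_trig_large) auto
      finally have "(\<Sum>j<Q. S j ^ (2 * s)) = real Q * real (count R 0)"
        by (metis of_nat_mult of_real_eq_iff of_real_of_nat_eq)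
      then show ?thesis using R by (simp add: mult_left_mono)
    qed
    \<comment> \<open>This height makes the bounds for the two sets of frequencies equal.\<close>
    define z where "z = C * real N powr (- real d) * e"
    have z: "0 < z" using C N0 e by (simp add: z_def)
    define l where "l = z powr (1 / (2 * real s))"
    have l: "0 < l" using z by (simp add: l_def)
    have l2s: "l ^ (2 * s) = z"
      using s z by (simp add: l_def powr_realpow[symmetric] powr_powr)
    have l2: "l\<^sup>2 = z powr (1 / real s)"
      using s z by (simp add: l_def powr_realpow[symmetric] powr_powr)
    have split: "x\<^sup>2 \<le> l\<^sup>2 + x ^ (2 * s) / l ^ (2 * s - 2)" if "0 \<le> x" for x
    proof (cases "x \<le> l")
      case True
      have "x\<^sup>2 \<le> l\<^sup>2" using True that by (intro power_mono)
      moreover have "0 \<le> x ^ (2 * s) / l ^ (2 * s - 2)" using that l by simp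
      ultimately show ?thesis by linarith
    next
      case False
      have "2 * s = 2 + (2 * s - 2)" using s by simp
      then have "x ^ (2 * s) = x\<^sup>2 * x ^ (2 * s - 2)" by (metis power_add)
      moreover have "l ^ (2 * s - 2) \<le> x ^ (2 * s - 2)" using False l by (intro power_mono) auto
      ultimately have "x\<^sup>2 * l ^ (2 * s - 2) \<le> x ^ (2 * s)" by (simp add: mult_left_mono)
      then have "x\<^sup>2 \<le> x ^ (2 * s) / l ^ (2 * s - 2)" using l by (simp add: field_simps)
      then show ?thesis by (smt (verit) zero_le_power2)
    qed
    have pw: "(H j)\<^sup>2 * (S j)\<^sup>2 \<le> (real N)\<^sup>2 * (l\<^sup>2 * (H j)\<^sup>2 + e\<^sup>2 * (S j ^ (2 * s) / real N ^ (2 * s)) / l ^ (2 * s - 2))" for j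
    proof -
      have S0: "0 \<le> S j" by (simp add: S_def)
      have "(S j / real N)\<^sup>2 \<le> l\<^sup>2 + (S j / real N) ^ (2 * s) / l ^ (2 * s - 2)"
        using S0 by (intro split) auto
      then have "(H j)\<^sup>2 * (S j / real N)\<^sup>2 \<le> (H j)\<^sup>2 * (l\<^sup>2 + (S j / real N) ^ (2 * s) / l ^ (2 * s - 2))"
        by (rule mult_left_mono) auto
      also have "\<dots> = l\<^sup>2 * (H j)\<^sup>2 + (H j)\<^sup>2 * ((S j / real N) ^ (2 * s) / l ^ (2 * s - 2))"
        by (simp add: algebra_simps)
      also have "\<dots> \<le> l\<^sup>2 * (H j)\<^sup>2 + e\<^sup>2 * ((S j / real N) ^ (2 * s) / l ^ (2 * s - 2))"
        using H S0 l by (intro add_left_mono mult_right_mono power_mono) auto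
      finally have "(real N)\<^sup>2 * ((H j)\<^sup>2 * (S j / real N)\<^sup>2)
        \<le> (real N)\<^sup>2 * (l\<^sup>2 * (H j)\<^sup>2 + e\<^sup>2 * ((S j / real N) ^ (2 * s) / l ^ (2 * s - 2)))"
        by (rule mult_left_mono) auto
      then show ?thesis using N0 by (simp add: power_divide)
    qed
    have set_A: "set_mset A \<subseteq> X \<union> set_mset A" "finite (X \<union> set_mset A)" using X by auto
    have "(\<Sum>x\<in>X. (real (hits P N E x))\<^sup>2) = (\<Sum>x\<in>X. (real (count A x))\<^sup>2)"
      using E by (simp add: A_def EE_def F_def count_shifts)
    also have "\<dots> \<le> (\<Sum>x\<in>X \<union> set_mset A. (real (count A x))\<^sup>2)"
      using set_A by (intro sum_mono2) auto
    also have "\<dots> = real (count (mdiff A) 0)" using count_mdiff_0[OF set_A(2), of A] by simp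
    also have "\<dots> \<le> (real N)\<^sup>2 * (l\<^sup>2 * e + e\<^sup>2 * (C * real N ^ (2 * s - d) / real N ^ (2 * s)) / l ^ (2 * s - 2))"
    proof -
      have "real Q * real (count (mdiff A) 0) \<le> (\<Sum>j<Q. cmod (trig (freq Q j) (mdiff A)))"
        by (rule count_le_mean_trig[OF Q(1)])
      also have "\<dots> = (\<Sum>j<Q. (H j)\<^sup>2 * (S j)\<^sup>2)"
        by (simp add: trig_mdiff A_def trig_msum norm_mult norm_power power_mult_distrib H_def S_def)
      also have "\<dots> \<le> (\<Sum>j<Q. (real N)\<^sup>2 * (l\<^sup>2 * (H j)\<^sup>2 + e\<^sup>2 * (S j ^ (2 * s) / real N ^ (2 * s)) / l ^ (2 * s - 2)))"
        by (intro sum_mono pw)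
      also have "\<dots> = (real N)\<^sup>2 * (l\<^sup>2 * (\<Sum>j<Q. (H j)\<^sup>2) + e\<^sup>2 * ((\<Sum>j<Q. S j ^ (2 * s)) / real N ^ (2 * s)) / l ^ (2 * s - 2))"
        by (simp only: sum_distrib_left[symmetric] sum.distrib sum_divide_distrib[symmetric])
      also have "\<dots> \<le> (real N)\<^sup>2 * (l\<^sup>2 * (real Q * e) + e\<^sup>2 * ((real Q * (C * real N ^ (2 * s - d))) / real N ^ (2 * s)) / l ^ (2 * s - 2))"
        unfolding sumH using l sumS by (intro mult_left_mono add_left_mono divide_right_mono) auto
      also have "\<dots> = real Q * ((real N)\<^sup>2 * (l\<^sup>2 * e + e\<^sup>2 * (C * real N ^ (2 * s - d) / real N ^ (2 * s)) / l ^ (2 * s - 2)))"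
        by (simp add: algebra_simps)
      finally show ?thesis using Q(1) by simp
    qed
    also have "C * real N ^ (2 * s - d) / real N ^ (2 * s) = z / e"
    proof -
      have "real N ^ (2 * s) = real N ^ (2 * s - d) * real N ^ d" using s by (simp add: power_add[symmetric])
      then have "real N ^ (2 * s - d) / real N ^ (2 * s) = real N powr (- real d)"
        using N0 by (simp add: powr_minus powr_realpow divide_inverse)
      then have "C * (real N ^ (2 * s - d) / real N ^ (2 * s)) = C * real N powr (- real d)" by (rule arg_cong)
      then show ?thesis using e by (simp add: z_def)
    qed
    also have "e\<^sup>2 * (z / e) / l ^ (2 * s - 2) = e * l\<^sup>2"
    proof -
      have "2 * s = 2 + (2 * s - 2)" using s by simp
      then have "z = l\<^sup>2 * l ^ (2 * s - 2)" by (metis l2s power_add)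
      then show ?thesis using e l by (simp add: power2_eq_square)
    qed
    finally show "(\<Sum>x\<in>X. (real (hits P N E x))\<^sup>2)
      \<le> 2 * (real N)\<^sup>2 * real (card E) * (C * real N powr (- real d) * real (card E)) powr (1 / real s)"
      by (simp add: l2 z_def e_def algebra_simps)
  qed
qed

lemma int_window_eq: "int_window N = {1..\<lfloor>N\<rfloor>}"
  by (auto simp: int_window_def le_floor_iff)

lemma nn_integral_uniform_int_window:
  assumes N: "1 \<le> N" and n: "n = nat \<lfloor>N\<rfloor>"
  shows "(\<integral>\<^sup>+t. f t \<partial>uniform_measure (count_space UNIV) (int_window N)) = (\<Sum>t\<in>{1..int n}. f t) / of_nat n"
proof -
  have w: "int_window N = {1..int n}" using N n by (simp add: int_window_eq)
  have "(\<integral>\<^sup>+t. f t \<partial>uniform_measure (count_space UNIV) (int_window N))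
      = (\<integral>\<^sup>+t. f t * indicator {1..int n} t \<partial>count_space UNIV) / emeasure (count_space UNIV) {1..int n}"
    unfolding w by (rule nn_integral_uniform_measure) auto
  also have "(\<integral>\<^sup>+t. f t * indicator {1..int n} t \<partial>count_space UNIV) = (\<Sum>t\<in>{1..int n}. f t * indicator {1..int n} t)"
    by (rule nn_integral_count_space') auto
  also have "\<dots> = (\<Sum>t\<in>{1..int n}. f t)" by (intro sum.cong) auto
  also have "emeasure (count_space UNIV) {1..int n} = of_nat n"
    using emeasure_count_space_finite[of "{1..int n}" UNIV] by simp
  finally show ?thesis .
qed

text \<open>The two terms dominate on \<open>y \<le> m ^ 3\<close> and on \<open>y \<ge> m ^ 3\<close>, respectively. Since the average of an
  indicator function is estimated in \<open>L\<^sup>1\<close> and \<open>L\<^sup>2\<close>, this replaces interpolation.\<close>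
lemma powr_four_thirds_le:
  fixes y m :: real
  assumes y: "0 \<le> y" and m: "0 < m"
  shows "y powr (4 / 3) \<le> m * y + y\<^sup>2 / m\<^sup>2"
proof (cases "y = 0")
  case False
  define x where "x = y powr (1 / 3)"
  have x: "0 < x" using y False by (simp add: x_def)
  have "x powr 3 = y" using y False by (simp only: x_def powr_powr) simp
  then have y3: "y = x ^ 3" using x by simp
  have "y powr (4 / 3) = (y powr (1 / 3)) powr 4" by (simp only: powr_powr) simp
  then have y4: "y powr (4 / 3) = x ^ 4" using x by (simp add: x_def)
  have "x ^ 4 \<le> m * x ^ 3 + (x ^ 3)\<^sup>2 / m\<^sup>2"
  proof (cases "x \<le> m")
    case True
    then have "x * x ^ 3 \<le> m * x ^ 3" using x by (intro mult_right_mono) auto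
    moreover have "x ^ 4 = x * x ^ 3" by (simp add: power_numeral_reduce)
    moreover have "0 \<le> (x ^ 3)\<^sup>2 / m\<^sup>2" by simp
    ultimately show ?thesis by linarith
  next
    case False
    then have "x ^ 4 * m\<^sup>2 \<le> x ^ 4 * x\<^sup>2" using m by (intro mult_left_mono power_mono) auto
    also have "\<dots> = (x ^ 3)\<^sup>2" by (simp add: power_mult[symmetric] power_add[symmetric])
    finally have "x ^ 4 \<le> (x ^ 3)\<^sup>2 / m\<^sup>2" using m by (simp add: pos_le_divide_eq)
    moreover have "0 \<le> m * x ^ 3" using m x by simp
    ultimately show ?thesis by linarith
  qed
  then show ?thesis by (simp add: y3[symmetric] y4)
qed simp

text \<open>Interpolation between the trivial \<open>L\<^sup>1\<close> bound and the \<open>L\<^sup>2\<close> bound of \<open>square_average_le\<close>. The factor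
  \<open>27 ^ s\<close> hides the constant \<open>3\<close> of this interpolation inside the power \<open>\<eta> = 1 / (3 * s)\<close>, and \<open>2 powr d\<close> pays for the
  passage from the integer part of \<open>N\<close> to \<open>N\<close>.\<close>
theorem restricted_type_int_poly:
  fixes P :: "int poly"
  assumes d: "1 \<le> degree P"
  shows "\<exists>\<eta>>0. \<exists>C>0. \<forall>N\<ge>1. restricted_type (count_space UNIV)
    (uniform_measure (count_space UNIV) (int_window N)) (\<lambda>x t. x - poly P t) (4 / 3) \<eta> (C * N powr (- real (degree P)))"
proof -
  obtain s where s: "1 \<le> s" and "\<exists>C>0. \<forall>N\<ge>1. \<forall>E X. finite E \<longrightarrow> E \<noteq> {} \<longrightarrow> finite X \<longrightarrow>
    (\<Sum>x\<in>X. (real (hits P N E x))\<^sup>2)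
      \<le> 2 * (real N)\<^sup>2 * real (card E) * (C * real N powr (- real (degree P)) * real (card E)) powr (1 / real s)"
    using square_average_le[OF refl d] by blast
  then obtain C where C: "0 < C" and sq: "\<forall>N\<ge>1. \<forall>E X. finite E \<longrightarrow> E \<noteq> {} \<longrightarrow> finite X \<longrightarrow>
    (\<Sum>x\<in>X. (real (hits P N E x))\<^sup>2)
      \<le> 2 * (real N)\<^sup>2 * real (card E) * (C * real N powr (- real (degree P)) * real (card E)) powr (1 / real s)"
    by blast
  define \<eta> where "\<eta> = 1 / (3 * real s)"
  define d' where "d' = real (degree P)"
  define K where "K = 27 ^ s * C * 2 powr d'"
  have \<eta>: "0 < \<eta>" using s by (simp add: \<eta>_def)
  show ?thesis
  proof (rule exI[of _ \<eta>], intro conjI \<eta>, rule exI[of _ K], intro conjI allI impI)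
    show "0 < K" using C by (simp add: K_def)
    fix N :: real assume N: "1 \<le> N"
    define n where "n = nat \<lfloor>N\<rfloor>"
    have fl: "1 \<le> \<lfloor>N\<rfloor>" using N by simp
    then have n1: "1 \<le> n" unfolding n_def by linarith
    have "real n = real_of_int \<lfloor>N\<rfloor>" unfolding n_def using fl by simp
    then have n2: "N \<le> 2 * real n" using n1 by linarith
    note n = n1 n2
    show "restricted_type (count_space UNIV) (uniform_measure (count_space UNIV) (int_window N))
      (\<lambda>x t. x - poly P t) (4 / 3) \<eta> (K * N powr (- real (degree P)))"
      unfolding restricted_type_def
    proof (intro ballI impI)
      fix E :: "int set" assume "emeasure (count_space UNIV) E < \<infinity>"
      then have E: "finite E" by (simp add: emeasure_count_space split: if_splits)
      have mE: "measure (count_space UNIV) E = real (card E)" using E by (simp add: measure_count_space)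
      define c where "c x = card {t\<in>{1..int n}. x - poly P t \<in> E}" for x
      define X where "X = (\<lambda>(y, t). y + poly P t) ` (E \<times> {1..int n})"
      have X: "finite X" using E by (simp add: X_def)
      have c0: "c x = 0" if "x \<notin> X" for x
      proof -
        have "{t\<in>{1..int n}. x - poly P t \<in> E} = {}" using that by (force simp: X_def)
        then show ?thesis unfolding c_def by (simp only: card.empty)
      qed
      have A: "(\<integral>\<^sup>+t. indicator E (x - poly P t) \<partial>uniform_measure (count_space UNIV) (int_window N)) = ennreal (real (c x) / real n)" for x
      proof -
        have "(\<Sum>t\<in>{1..int n}. indicator E (x - poly P t) :: ennreal) = of_nat (c x)"
          by (simp add: indicator_def sum.If_cases Int_def c_def)
        then show ?thesis
          unfolding nn_integral_uniform_int_window[OF N n_def] using n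
          by (simp add: ennreal_of_nat_eq_real_of_nat divide_ennreal)
      qed
      have "(\<integral>\<^sup>+x. epow (\<integral>\<^sup>+t. indicator E (x - poly P t) \<partial>uniform_measure (count_space UNIV) (int_window N)) (4 / 3) \<partial>count_space UNIV)
        = (\<integral>\<^sup>+x. ennreal ((real (c x) / real n) powr (4 / 3)) \<partial>count_space UNIV)"
        by (simp add: A)
      also have "\<dots> = (\<Sum>x\<in>X. ennreal ((real (c x) / real n) powr (4 / 3)))"
        using X c0 by (intro nn_integral_count_space'[where A = X]) auto
      also have "\<dots> = ennreal (\<Sum>x\<in>X. (real (c x) / real n) powr (4 / 3))" by (rule sum_ennreal) auto
      also have "\<dots> \<le> ennreal (measure (count_space UNIV) E
          * min 1 ((K * N powr (- real (degree P)) * measure (count_space UNIV) E) powr \<eta>))"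
      proof (cases "E = {}")
        case True
        then show ?thesis by (simp add: X_def)
      next
        case ne: False
        define e where "e = real (card E)"
        have e: "0 < e" using ne E by (simp add: e_def card_gt_0_iff)
        have c_eq: "c x = count (msum (mset_set E) (image_mset (poly P) (mset_set {1..int n}))) x" for x
          using E by (simp add: count_shifts c_def)
        have "(\<Sum>x\<in>X. real (c x)) = (\<Sum>z\<in>#msum (mset_set E) (image_mset (poly P) (mset_set {1..int n})). 1 :: real)"
          unfolding c_eq using X E by (subst sum_mset_eq_sum_count[where I = X]) (force simp: set_msum X_def)+
        also have "\<dots> = real n * e" using E by (simp add: size_msum e_def)
        finally have sum1: "(\<Sum>x\<in>X. real (c x) / real n) = e"
          using n by (simp add: sum_divide_distrib[symmetric])
        have cn: "0 \<le> real (c x) / real n" "real (c x) / real n \<le> 1" for x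
        proof -
          have "c x \<le> card {1..int n}" unfolding c_def by (intro card_mono) auto
          then show "real (c x) / real n \<le> 1" using n by simp
        qed simp
        have le1: "(\<Sum>x\<in>X. (real (c x) / real n) powr (4 / 3)) \<le> e"
        proof -
          have "(\<Sum>x\<in>X. (real (c x) / real n) powr (4 / 3)) \<le> (\<Sum>x\<in>X. (real (c x) / real n) powr 1)"
            using cn by (intro sum_mono powr_mono') auto
          also have "\<dots> = e" using sum1 cn by simp
          finally show ?thesis .
        qed
        define z where "z = (C * real n powr (- d') * e) powr (1 / real s)"
        have z: "0 < z" using C n e by (simp add: z_def)
        define \<mu> where "\<mu> = z powr (1 / 3)"
        have \<mu>0: "0 < \<mu>" using z by (simp add: \<mu>_def)
        have "\<mu> powr 3 = z" using z by (simp only: \<mu>_def powr_powr) simp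
        then have \<mu>: "0 < \<mu>" "\<mu> ^ 3 = z" using \<mu>0 by simp_all
        have pw: "y powr (4 / 3) \<le> \<mu> * y + y\<^sup>2 / \<mu>\<^sup>2" if "0 \<le> y" for y
          using that \<mu>(1) by (rule powr_four_thirds_le)
        have "(\<Sum>x\<in>X. (real (c x) / real n) powr (4 / 3))
            \<le> (\<Sum>x\<in>X. \<mu> * (real (c x) / real n) + (real (c x) / real n)\<^sup>2 / \<mu>\<^sup>2)"
          using cn by (intro sum_mono pw)
        also have "\<dots> = \<mu> * e + (\<Sum>x\<in>X. (real (c x))\<^sup>2) / (real n)\<^sup>2 / \<mu>\<^sup>2"
          using sum1 by (simp only: sum.distrib sum_distrib_left[symmetric] power_divide sum_divide_distrib[symmetric])
        also have "\<dots> \<le> \<mu> * e + (2 * (real n)\<^sup>2 * e * z) / (real n)\<^sup>2 / \<mu>\<^sup>2"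
          using sq[rule_format, OF n(1) E ne X] unfolding c_def e_def z_def d'_def
          by (intro add_left_mono divide_right_mono) auto
        also have "\<dots> = 3 * \<mu> * e"
          using n \<mu>(1) unfolding \<mu>(2)[symmetric] by (simp add: power2_eq_square power3_eq_cube)
        also have "3 * \<mu> = (27 ^ s * (C * real n powr (- d') * e)) powr \<eta>"
        proof -
          have "(27 ^ s :: real) powr \<eta> = 3"
          proof -
            have "(27 ^ s :: real) = 3 powr (3 * real s)"
              by (simp add: powr_powr[symmetric] powr_realpow[symmetric])
            then show ?thesis using s by (simp add: powr_powr \<eta>_def)
          qed
          moreover have "\<mu> = (C * real n powr (- d') * e) powr \<eta>"
            by (simp add: \<mu>_def z_def powr_powr \<eta>_def mult.commute[of 3])
          ultimately show ?thesis using C e by (simp add: powr_mult)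
        qed
        also have "\<dots> \<le> (K * N powr (- d') * e) powr \<eta>"
        proof (intro powr_mono2)
          have "real n powr (- d') = 2 powr d' * (2 * real n) powr (- d')"
            using n by (simp add: powr_mult powr_minus field_simps)
          also have "\<dots> \<le> 2 powr d' * N powr (- d')"
            using n N by (intro mult_left_mono powr_mono2') (auto simp: d'_def)
          finally have "27 ^ s * (C * real n powr (- d') * e) \<le> 27 ^ s * (C * (2 powr d' * N powr (- d')) * e)"
            using C e by (intro mult_left_mono mult_right_mono) auto
          then show "27 ^ s * (C * real n powr (- d') * e) \<le> K * N powr (- d') * e"
            by (simp add: K_def mult_ac)
        qed (use C e \<eta> in auto)
        finally have le2: "(\<Sum>x\<in>X. (real (c x) / real n) powr (4 / 3)) \<le> (K * N powr (- d') * e) powr \<eta> * e"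
          using e by (simp add: mult_right_mono)
        have "(\<Sum>x\<in>X. (real (c x) / real n) powr (4 / 3)) \<le> e * min 1 ((K * N powr (- d') * e) powr \<eta>)"
          using le1 le2 by (simp add: min_def mult.commute)
        then show ?thesis unfolding mE e_def[symmetric] d'_def[symmetric] by (rule ennreal_leI)
      qed
      finally show "(\<integral>\<^sup>+x. epow (\<integral>\<^sup>+t. indicator E (x - poly P t) \<partial>uniform_measure (count_space UNIV) (int_window N)) (4 / 3) \<partial>count_space UNIV)
        \<le> ennreal (measure (count_space UNIV) E
          * min 1 ((K * N powr (- real (degree P)) * measure (count_space UNIV) E) powr \<eta>))" .
    qed
  qed
qed

section \<open>The choice of exponents\<close>

lemma layer_const_pos:
  assumes "1 < b" "0 < a" "a < b" "b < a * (1 + \<eta>)"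
  shows "0 < layer_const a b \<eta>"
proof -
  define e where "e = min (b - a) (a * \<eta> - (b - a)) / 2"
  have "0 < e" using assms by (simp add: e_def algebra_simps)
  then show ?thesis using assms(1) unfolding layer_const_def e_def[symmetric] by (simp add: Let_def)
qed

lemma exists_uniform_restricted_type:
  fixes d :: "'k::finite \<Rightarrow> real" and \<nu> :: "real \<Rightarrow> 't measure" and \<phi> :: "'k \<Rightarrow> 'a \<Rightarrow> 't \<Rightarrow> 'a"
  assumes "\<And>i. \<exists>\<eta>>0. \<exists>C>0. \<forall>N\<ge>1. restricted_type M (\<nu> N) (\<phi> i) b \<eta> (C * N powr (- d i))"
  shows "\<exists>\<eta>>0. \<exists>C>0. \<forall>i. \<forall>N\<ge>1. restricted_type M (\<nu> N) (\<phi> i) b \<eta> (C * N powr (- d i))"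
proof -
  have "\<forall>i. \<exists>\<eta> C. 0 < \<eta> \<and> 0 < C \<and> (\<forall>N\<ge>1. restricted_type M (\<nu> N) (\<phi> i) b \<eta> (C * N powr (- d i)))"
    using assms by blast
  then obtain \<eta> where "\<forall>i. \<exists>C. 0 < \<eta> i \<and> 0 < C \<and> (\<forall>N\<ge>1. restricted_type M (\<nu> N) (\<phi> i) b (\<eta> i) (C * N powr (- d i)))"
    by (rule choice[THEN exE])
  then obtain C where C: "\<forall>i. 0 < \<eta> i \<and> 0 < C i \<and> (\<forall>N\<ge>1. restricted_type M (\<nu> N) (\<phi> i) b (\<eta> i) (C i * N powr (- d i)))"
    by (rule choice[THEN exE])
  define \<eta>0 where "\<eta>0 = Min (range \<eta>)"
  define C0 where "C0 = Max (range C)"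
  have \<eta>0: "0 < \<eta>0" "\<eta>0 \<le> \<eta> i" for i using C by (auto simp: \<eta>0_def)
  have C0: "C i \<le> C0" for i by (auto simp: C0_def)
  have C0p: "0 < C0" using C C0 by (meson less_le_trans)
  show ?thesis
  proof (rule exI[of _ \<eta>0], intro conjI \<eta>0(1), rule exI[of _ C0], intro conjI C0p allI impI)
    fix i and N :: real assume N: "1 \<le> N"
    show "restricted_type M (\<nu> N) (\<phi> i) b \<eta>0 (C0 * N powr (- d i))"
    proof (rule restricted_type_mono)
      show "restricted_type M (\<nu> N) (\<phi> i) b (\<eta> i) (C i * N powr (- d i))" using C N by blast
      show "0 \<le> C i * N powr (- d i)" using C by (simp add: less_imp_le)
      show "C i * N powr (- d i) \<le> C0 * N powr (- d i)" using C0 by (intro mult_right_mono) auto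
    qed (use \<eta>0 in auto)
  qed
qed

definition admissible :: "'k::finite \<Rightarrow> real \<Rightarrow> real \<Rightarrow> ('k \<Rightarrow> real) \<Rightarrow> bool" where
  "admissible j p q r \<longleftrightarrow> 1 < p \<and> p < q \<and> q < 2 \<and> (\<forall>i. 1 < r i) \<and>
     (\<Sum>i\<in>UNIV. 1 / r i) = 1 / p \<and> r j = 2"

definition product_bound ::
    "'a measure \<Rightarrow> 't measure \<Rightarrow> ('k::finite \<Rightarrow> 'a \<Rightarrow> 't \<Rightarrow> 'a) \<Rightarrow> real \<Rightarrow> ('k \<Rightarrow> real) \<Rightarrow> real \<Rightarrow> bool" where
  "product_bound M \<nu> \<phi> q r B \<longleftrightarrow> (\<forall>F. (\<forall>i. F i \<in> borel_measurable (cube M)) \<longrightarrow>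
      pow_integral (cube M) q (product_avg \<nu> \<phi> F)
        \<le> ennreal (B powr q) * (\<Prod>i\<in>UNIV. epow (pow_integral (cube M) (r i) (F i)) (q / r i)))"

text \<open>With \<open>k\<close> functions, take \<open>r i = (k - 1) / (1 / 4 + k * \<delta>)\<close> for \<open>i \<noteq> j\<close>. The constant \<open>4 / 3\<close> is the
  exponent \<open>b\<close>, and \<open>1 / p = 3 / 4 + k * \<delta>\<close> is what makes the Hoelder weights \<open>a i / r i\<close> sum up to one. As \<open>r i \<le> 4 * k\<close>, the
  chosen \<open>\<delta>\<close> is so small that \<open>a i = b * (1 - \<delta> * r i)\<close> lies in the range \<open>b < a i * (1 + \<eta>)\<close> where the
  strong type bound holds.\<close>
theorem improving_bound:
  fixes M :: "'a measure" and \<nu> :: "real \<Rightarrow> 't measure" and \<phi> :: "'k::finite \<Rightarrow> 'a \<Rightarrow> 't \<Rightarrow> 'a"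
    and d :: "'k \<Rightarrow> real" and j :: 'k
  assumes card: "2 \<le> CARD('k)"
    and M: "sigma_finite_measure M" and \<nu>: "\<And>N. 1 \<le> N \<Longrightarrow> sigma_finite_measure (\<nu> N)"
    and \<phi>: "\<And>i N. 1 \<le> N \<Longrightarrow> case_prod (\<phi> i) \<in> M \<Otimes>\<^sub>M \<nu> N \<rightarrow>\<^sub>M M"
    and restricted: "\<And>i. \<exists>\<eta>>0. \<exists>C>0. \<forall>N\<ge>1. restricted_type M (\<nu> N) (\<phi> i) (4 / 3) \<eta> (C * N powr (- d i))"
  shows "\<exists>p q r. admissible j p q r \<and> (\<exists>C\<ge>0. \<forall>N\<ge>1.
    product_bound M (\<nu> N) \<phi> q r (C * N powr (- (\<Sum>i\<in>UNIV. d i) * (1 / p - 1 / q))))"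
proof -
  obtain \<eta> C0 where \<eta>: "0 < \<eta>" and C0: "0 < C0"
    and restr: "\<forall>i. \<forall>N\<ge>1. restricted_type M (\<nu> N) (\<phi> i) (4 / 3) \<eta> (C0 * N powr (- d i))"
    using exists_uniform_restricted_type[where d = d and \<phi> = \<phi>, OF restricted] by (elim exE conjE) (rule that)
  define k where "k = real CARD('k)"
  have k: "2 \<le> k" using card by (simp add: k_def)
  \<comment> \<open>The condition \<open>b < a i * (1 + \<eta>)\<close> reads \<open>\<delta> * r i < h\<close>.\<close>
  define h where "h = \<eta> / (1 + \<eta>)"
  have h: "0 < h" "h < 1" using \<eta> by (auto simp: h_def)
  define \<delta> where "\<delta> = h / 8 / k"
  have \<delta>: "0 < \<delta>" using h k by (simp add: \<delta>_def)
  have k\<delta>: "k * \<delta> = h / 8" using k by (simp add: \<delta>_def)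
  have k\<delta>8: "k * \<delta> < 1 / 8" using k\<delta> h by linarith
  have k\<delta>0: "0 < k * \<delta>" using k \<delta> by simp
  have \<delta>k: "2 * \<delta> \<le> k * \<delta>" using k \<delta> by simp
  define R where "R = (k - 1) / (1 / 4 + k * \<delta>)"
  define r where "r i = (if i = j then 2 else R)" for i
  define p where "p = 1 / (3 / 4 + k * \<delta>)"
  define q where "q = 1 / (3 / 4 + k * \<delta> - \<delta>)"
  define a where "a i = 4 / 3 * (1 - \<delta> * r i)" for i
  have R: "1 < R" "R \<le> 4 * k"
  proof -
    have "1 / 4 + k * \<delta> < k - 1" using k\<delta>8 k by linarith
    then show "1 < R" using k\<delta>0 by (simp add: R_def)
    have "0 \<le> 4 * k * (k * \<delta>)" using k k\<delta>0 by (intro mult_nonneg_nonneg[of "4 * k" "k * \<delta>"]) linarith+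
    moreover have "4 * k * (1 / 4 + k * \<delta>) = k + 4 * k * (k * \<delta>)" by (simp add: distrib_left)
    ultimately have "k - 1 \<le> 4 * k * (1 / 4 + k * \<delta>)" by linarith
    then show "R \<le> 4 * k" using k\<delta>0 by (simp add: R_def divide_le_eq)
  qed
  have r: "1 < r i" "r i \<le> 4 * k" for i using R k by (auto simp: r_def)
  have sum_r: "(\<Sum>i\<in>UNIV. 1 / r i) = 3 / 4 + k * \<delta>"
  proof -
    have "(\<Sum>i\<in>UNIV. 1 / r i) = 1 / r j + (\<Sum>i\<in>UNIV - {j}. 1 / r i)" by (simp add: sum.remove)
    also have "(\<Sum>i\<in>UNIV - {j}. 1 / r i) = (\<Sum>i\<in>UNIV - {j}. 1 / R)" by (intro sum.cong) (auto simp: r_def)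
    also have "\<dots> = real (card (UNIV - {j})) / R" by simp
    also have "card (UNIV - {j}) = CARD('k) - 1" by (simp add: card_Diff_singleton)
    also have "real (CARD('k) - 1) = k - 1" using card by (simp add: k_def of_nat_diff)
    also have "(k - 1) / R = 1 / 4 + k * \<delta>" using k k\<delta>0 by (simp add: R_def)
    finally show ?thesis by (simp add: r_def)
  qed
  have dr: "\<delta> * r i \<le> h / 2" for i
  proof -
    have "\<delta> * r i \<le> \<delta> * (4 * k)" using r(2)[of i] \<delta> by (intro mult_left_mono) auto
    also have "\<dots> = 4 * (k * \<delta>)" by simp
    finally show ?thesis using k\<delta> by linarith
  qed
  have dr1: "\<delta> * r i < 1" for i using dr[of i] h by linarith
  have dr0: "0 < \<delta> * r i" for i using \<delta> r(1)[of i] by simp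
  have a: "0 < a i" "a i < 4 / 3" "4 / 3 < a i * (1 + \<eta>)" for i
  proof -
    show "0 < a i" "a i < 4 / 3" using dr1[of i] dr0[of i] by (auto simp: a_def)
    have "\<delta> * r i < \<eta> / (1 + \<eta>)" using dr[of i] h unfolding h_def[symmetric] by linarith
    then have "\<delta> * r i * (1 + \<eta>) < \<eta>" using \<eta> by (simp add: pos_less_divide_eq)
    then have "1 < (1 - \<delta> * r i) * (1 + \<eta>)" by (simp add: algebra_simps)
    moreover have "a i * (1 + \<eta>) = 4 / 3 * ((1 - \<delta> * r i) * (1 + \<eta>))" by (simp only: a_def mult.assoc)
    ultimately show "4 / 3 < a i * (1 + \<eta>)" by linarith
  qed
  have qpos1: "0 < 3 / 4 + k * \<delta> - \<delta>" using \<delta>k \<delta> k\<delta>0 by linarith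
  then have qpos: "0 < 3 / 4 + k * \<delta> - \<delta>" "0 < q" by (simp_all add: q_def)
  have pq: "1 / p - 1 / q = \<delta>" by (simp add: p_def q_def)
  have sum_w: "(\<Sum>i\<in>UNIV. a i / r i) = 1"
  proof -
    have "a i / r i = 4 / 3 * (1 / r i) - 4 / 3 * \<delta>" for i
      using r(1)[of i] by (simp add: a_def field_simps)
    then have "(\<Sum>i\<in>UNIV. a i / r i) = 4 / 3 * (\<Sum>i\<in>UNIV. 1 / r i) - k * (4 / 3 * \<delta>)"
      by (simp only: sum_subtractf sum_distrib_left[symmetric]) (simp add: k_def)
    then show ?thesis by (simp add: sum_r field_simps)
  qed
  define L where "L i = layer_const (a i) (4 / 3) \<eta> * C0 powr (4 / 3 / a i - 1)" for i
  have L: "0 < L i" for i using a[of i] C0 layer_const_pos[of "4/3" "a i" \<eta>] by (simp add: L_def)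
  define \<rho> where "\<rho> i = 1 / r i - \<delta>" for i
  have \<rho>: "(4 / 3 / a i - 1) * \<rho> i = \<delta>" for i
  proof -
    have "4 / 3 / a i - 1 = \<delta> * r i / (1 - \<delta> * r i)" using dr1[of i] by (simp add: a_def field_simps)
    moreover have "\<rho> i = (1 - \<delta> * r i) / r i" using r(1)[of i] by (simp add: \<rho>_def field_simps)
    ultimately show ?thesis using dr1[of i] r(1)[of i] by simp
  qed
  define C where "C = (\<Prod>i\<in>UNIV. L i powr \<rho> i)"
  have main: "pow_integral (cube M) q (product_avg (\<nu> N) \<phi> F)
        \<le> ennreal ((C * N powr (- (\<Sum>i\<in>UNIV. d i) * (1 / p - 1 / q))) powr q)
            * (\<Prod>i\<in>UNIV. epow (pow_integral (cube M) (r i) (F i)) (q / r i))"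
    if N: "1 \<le> N" and F: "\<And>i. F i \<in> borel_measurable (cube M)" for N F
  proof -
    define \<kappa> where "\<kappa> i = L i * (N powr (- d i)) powr (4 / 3 / a i - 1)" for i
    have \<kappa>: "0 < \<kappa> i" for i using L N by (simp add: \<kappa>_def)
    have one_dim: "pow_integral M (4 / 3) (shift_avg (\<nu> N) (\<phi> i) h)
        \<le> ennreal (\<kappa> i) * epow (pow_integral M (a i) h) (4 / 3 / a i)" if "h \<in> borel_measurable M" for i h
    proof -
      have "pow_integral M (4 / 3) (shift_avg (\<nu> N) (\<phi> i) h)
        \<le> ennreal (layer_const (a i) (4 / 3) \<eta> * (C0 * N powr (- d i)) powr (4 / 3 / a i - 1))
            * epow (pow_integral M (a i) h) (4 / 3 / a i)"
      proof (rule strong_type_of_restricted_type[OF M \<nu>[OF N] \<phi>[OF N] _ a(1) a(2) a(3)])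
        fix E assume "E \<in> sets M" "emeasure M E < \<infinity>"
        then show "pow_integral M (4 / 3) (shift_avg (\<nu> N) (\<phi> i) (indicator E))
          \<le> ennreal (measure M E * min 1 ((C0 * N powr (- d i) * measure M E) powr \<eta>))"
          using restr[rule_format, OF N, of i] unfolding restricted_type_def by blast
      qed (use C0 N that in auto)
      also have "layer_const (a i) (4 / 3) \<eta> * (C0 * N powr (- d i)) powr (4 / 3 / a i - 1) = \<kappa> i"
        using C0 by (simp add: \<kappa>_def L_def powr_mult)
      finally show ?thesis .
    qed
    have "pow_integral (cube M) q (product_avg (\<nu> N) \<phi> F)
      \<le> (\<Prod>i\<in>UNIV. ennreal (\<kappa> i powr (q * (1 / r i - \<delta>)))
        * epow (pow_integral (cube M) (r i) (F i)) (q / r i))"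
    proof (rule multilinear_bound[OF M \<nu>[OF N] \<phi>[OF N] F _ a(1) a(2) _ \<delta> a_def sum_w _ \<kappa> one_dim])
      show "0 < r i" for i using r(1)[of i] by simp
      show "(\<Sum>i\<in>UNIV. 1 / r i) = 1 / q + \<delta>" by (simp add: sum_r q_def)
    qed (use qpos in auto)
    also have "\<dots> = (\<Prod>i\<in>UNIV. ennreal (\<kappa> i powr (q * (1 / r i - \<delta>))))
        * (\<Prod>i\<in>UNIV. epow (pow_integral (cube M) (r i) (F i)) (q / r i))"
      by (rule prod.distrib)
    also have "(\<Prod>i\<in>UNIV. ennreal (\<kappa> i powr (q * (1 / r i - \<delta>)))) = ennreal (\<Prod>i\<in>UNIV. \<kappa> i powr (q * (1 / r i - \<delta>)))"
      by (rule prod_ennreal) simp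
    also have "(\<Prod>i\<in>UNIV. \<kappa> i powr (q * (1 / r i - \<delta>))) = (\<Prod>i\<in>UNIV. L i powr \<rho> i * N powr (- d i * \<delta>)) powr q"
    proof -
      have "\<kappa> i powr (q * (1 / r i - \<delta>)) = (L i powr \<rho> i * N powr (- d i * \<delta>)) powr q" for i
      proof -
        have "\<kappa> i powr (q * (1 / r i - \<delta>)) = (\<kappa> i powr \<rho> i) powr q"
          by (simp add: powr_powr \<rho>_def mult.commute)
        also have "\<kappa> i powr \<rho> i = L i powr \<rho> i * N powr (- d i * ((4 / 3 / a i - 1) * \<rho> i))"
          unfolding \<kappa>_def using L[of i] N by (simp add: powr_mult powr_powr mult.assoc)
        finally show ?thesis by (simp only: \<rho>)
      qed
      then show ?thesis by (simp add: prod_powr_distrib)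
    qed
    also have "(\<Prod>i\<in>UNIV. L i powr \<rho> i * N powr (- d i * \<delta>)) = C * N powr (- (\<Sum>i\<in>UNIV. d i) * (1 / p - 1 / q))"
    proof -
      have "(\<Prod>i\<in>UNIV. N powr (- d i * \<delta>)) = N powr (\<Sum>i\<in>UNIV. - d i * \<delta>)"
        using N by (simp add: powr_sum)
      also have "(\<Sum>i\<in>UNIV. - d i * \<delta>) = - (\<Sum>i\<in>UNIV. d i) * (1 / p - 1 / q)"
        unfolding pq by (simp add: sum_negf sum_distrib_right)
      finally show ?thesis by (simp add: prod.distrib C_def)
    qed
    finally show ?thesis .
  qed
  have p1: "1 < p" using k\<delta>8 k\<delta>0 by (simp add: p_def)
  have pq': "p < q" unfolding p_def q_def using \<delta> qpos(1) by (intro divide_strict_left_mono mult_pos_pos) auto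
  have "1 / 2 < 3 / 4 + k * \<delta> - \<delta>" using \<delta>k \<delta> by linarith
  moreover have "1 / x < 2" if "1 / 2 < x" for x :: real using that by (simp add: field_simps)
  ultimately have q2: "q < 2" unfolding q_def by blast
  have "(\<Sum>i\<in>UNIV. 1 / r i) = 1 / p" "r j = 2" by (simp_all only: sum_r) (simp_all add: p_def r_def)
  then have "admissible j p q r"
    unfolding admissible_def using p1 pq' q2 r(1) by blast
  moreover have "0 \<le> C" by (auto simp: C_def intro!: prod_nonneg)
  moreover have "product_bound M (\<nu> N) \<phi> q r (C * N powr (- (\<Sum>i\<in>UNIV. d i) * (1 / p - 1 / q)))"
    if "1 \<le> N" for N
    unfolding product_bound_def using main[OF that] by blast
  ultimately show ?thesis by blast
qed

section \<open>From coordinates to the averages\<close>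

lemma Lp_space_nn_integral:
  assumes f: "f \<in> Lp_space V p" and p: "0 < p"
  shows "f \<in> borel_measurable V"
    and "epow (\<integral>\<^sup>+x. epow (ennreal (norm (f x))) p \<partial>V) (q / p) = ennreal (Lp_norm V p f powr q)"
proof -
  show "f \<in> borel_measurable V" using f by (simp add: Lp_space_def)
  have "integrable V (\<lambda>x. norm (f x) powr p)" using f by (simp add: Lp_space_def)
  then have "(\<integral>\<^sup>+x. ennreal (norm (f x) powr p) \<partial>V) = ennreal (LINT x|V. norm (f x) powr p)"
    by (intro nn_integral_eq_integral) auto
  then have "epow (\<integral>\<^sup>+x. epow (ennreal (norm (f x))) p \<partial>V) (q / p)
      = ennreal ((LINT x|V. norm (f x) powr p) powr (q / p))" by simp
  also have "(LINT x|V. norm (f x) powr p) powr (q / p) = Lp_norm V p f powr q"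
    by (simp add: Lp_norm_def powr_powr)
  finally show "epow (\<integral>\<^sup>+x. epow (ennreal (norm (f x))) p \<partial>V) (q / p) = ennreal (Lp_norm V p f powr q)" .
qed

lemma Lp_norm_nonneg: "0 \<le> Lp_norm V p f"
  by (simp add: Lp_norm_def)

definition avg_Lp_bound ::
    "('a::comm_ring_1 ^ 'k::finite) measure \<Rightarrow> 'a measure \<Rightarrow> 'a set \<Rightarrow> ('k \<Rightarrow> 'a poly) \<Rightarrow>
      ('k \<Rightarrow> 'a ^ 'k \<Rightarrow> complex) \<Rightarrow> real \<Rightarrow> ('k \<Rightarrow> real) \<Rightarrow> real \<Rightarrow> bool" where
  "avg_Lp_bound V lam I P f q r B \<longleftrightarrow> (AE x in V. set_integrable lam I (avg_integrand P f x)) \<and>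
     poly_avg lam I P f \<in> Lp_space V q \<and>
     Lp_norm V q (poly_avg lam I P f) \<le> B * (\<Prod>i\<in>UNIV. Lp_norm V (r i) (f i))"

text \<open>Finiteness of the bound for the average of the absolute values makes this average finite
  almost everywhere. This yields integrability in \<open>t\<close>, and then the triangle inequality applies.\<close>
lemma poly_avg_Lp_bound:
  fixes V :: "('a::comm_ring_1 ^ 'k::finite) measure" and lam :: "'a measure"
  assumes lam: "sigma_finite_measure lam" and I: "I \<in> sets lam" "emeasure lam I \<noteq> 0" "emeasure lam I < \<infinity>"
    and q: "0 < q" and r: "\<And>i. 0 < r i" and f: "\<And>i. f i \<in> Lp_space V (r i)" and B: "0 \<le> B"
    and meas: "(\<lambda>(x, t). avg_integrand P f x t) \<in> borel_measurable (V \<Otimes>\<^sub>M lam)"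
    and bound: "pow_integral V q (\<lambda>x. \<integral>\<^sup>+t. ennreal (norm (avg_integrand P f x t)) \<partial>uniform_measure lam I)
      \<le> ennreal (B powr q) * (\<Prod>i\<in>UNIV. epow (pow_integral V (r i) (\<lambda>x. ennreal (norm (f i x)))) (q / r i))"
  shows "avg_Lp_bound V lam I P f q r B"
proof -
  interpret lam: sigma_finite_measure lam by (rule lam)
  define c where "c = measure lam I"
  have cI: "emeasure lam I = ennreal c" using I by (simp add: c_def emeasure_eq_ennreal_measure)
  have c: "0 < c" using I(2) cI by (auto simp: c_def less_le)
  define R where "R = B * (\<Prod>i\<in>UNIV. Lp_norm V (r i) (f i))"
  have R: "0 \<le> R" using B by (auto simp: R_def Lp_norm_nonneg intro!: mult_nonneg_nonneg prod_nonneg)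
  let ?F = "avg_integrand P f"
  define n where "n x = (\<integral>\<^sup>+t. ennreal (norm (?F x t)) * indicator I t \<partial>lam) / ennreal c" for x
  have Fx: "?F x \<in> borel_measurable lam" if "x \<in> space V" for x
    using measurable_Pair2[OF meas that] by simp
  have n_eq: "(\<integral>\<^sup>+t. ennreal (norm (?F x t)) \<partial>uniform_measure lam I) = n x" if "x \<in> space V" for x
    unfolding n_def cI[symmetric] using Fx[OF that] by (intro nn_integral_uniform_measure I(1)) auto
  have [measurable]: "(\<lambda>z. avg_integrand P f (fst z) (snd z)) \<in> borel_measurable (V \<Otimes>\<^sub>M lam)"
    using meas by (simp add: case_prod_unfold)
  have [measurable]: "I \<in> sets lam" by (rule I(1))
  have nm [measurable]: "n \<in> borel_measurable V"
    unfolding n_def by measurable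
  have "(\<integral>\<^sup>+x. epow (n x) q \<partial>V)
      = pow_integral V q (\<lambda>x. \<integral>\<^sup>+t. ennreal (norm (avg_integrand P f x t)) \<partial>uniform_measure lam I)"
    by (intro nn_integral_cong) (simp add: n_eq)
  also note bound
  also have "ennreal (B powr q) * (\<Prod>i\<in>UNIV. epow (pow_integral V (r i) (\<lambda>x. ennreal (norm (f i x)))) (q / r i))
      = ennreal (B powr q) * (\<Prod>i\<in>UNIV. ennreal (Lp_norm V (r i) (f i) powr q))"
    by (simp only: Lp_space_nn_integral(2)[OF f r])
  also have "\<dots> = ennreal (B powr q) * ennreal (\<Prod>i\<in>UNIV. Lp_norm V (r i) (f i) powr q)"
    by (simp add: prod_ennreal)
  also have "\<dots> = ennreal (B powr q * (\<Prod>i\<in>UNIV. Lp_norm V (r i) (f i) powr q))"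
    by (rule ennreal_mult[symmetric]) (auto intro!: prod_nonneg)
  also have "B powr q * (\<Prod>i\<in>UNIV. Lp_norm V (r i) (f i) powr q) = R powr q"
    by (simp add: R_def powr_mult prod_powr_distrib Lp_norm_nonneg)
  finally have nR: "(\<integral>\<^sup>+x. epow (n x) q \<partial>V) \<le> ennreal (R powr q)" .
  then have "(\<integral>\<^sup>+x. epow (n x) q \<partial>V) \<noteq> \<infinity>" by (auto simp: top_unique)
  then have "AE x in V. epow (n x) q \<noteq> \<infinity>" by (intro nn_integral_PInf_AE) measurable
  then have fin: "AE x in V. n x < \<infinity>" by eventually_elim (simp add: less_top)
  have int: "set_integrable lam I (?F x)" if "x \<in> space V" "n x < \<infinity>" for x
    unfolding set_integrable_def
  proof (rule integrableI_bounded)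
    show "(\<lambda>t. indicator I t *\<^sub>R ?F x t) \<in> borel_measurable lam" using Fx[OF that(1)] by measurable
    have "(\<integral>\<^sup>+t. ennreal (norm (?F x t)) * indicator I t \<partial>lam) \<noteq> top"
    proof
      assume "(\<integral>\<^sup>+t. ennreal (norm (?F x t)) * indicator I t \<partial>lam) = top"
      then have "n x = top" by (simp add: n_def ennreal_top_divide)
      then show False using that by simp
    qed
    moreover have "(\<integral>\<^sup>+t. ennreal (norm (indicator I t *\<^sub>R ?F x t)) \<partial>lam) = (\<integral>\<^sup>+t. ennreal (norm (?F x t)) * indicator I t \<partial>lam)"
      by (intro nn_integral_cong) (auto simp: indicator_def)
    ultimately show "(\<integral>\<^sup>+t. ennreal (norm (indicator I t *\<^sub>R ?F x t)) \<partial>lam) < \<infinity>" by (simp add: less_top)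
  qed
  have avg_le: "ennreal (norm (poly_avg lam I P f x)) \<le> n x" if "x \<in> space V" "n x < \<infinity>" for x
  proof -
    have "integrable lam (\<lambda>t. indicator I t *\<^sub>R ?F x t)" using int[OF that] by (simp add: set_integrable_def)
    then have "ennreal (norm (LINT t:I|lam. ?F x t)) \<le> (\<integral>\<^sup>+t. ennreal (norm (indicator I t *\<^sub>R ?F x t)) \<partial>lam)"
      unfolding set_lebesgue_integral_def by (rule integral_norm_bound_ennreal)
    also have "\<dots> = (\<integral>\<^sup>+t. ennreal (norm (?F x t)) * indicator I t \<partial>lam)"
      by (intro nn_integral_cong) (auto simp: indicator_def)
    finally have *: "ennreal (norm (LINT t:I|lam. ?F x t)) / ennreal c \<le> n x"
      unfolding n_def by (rule divide_right_mono_ennreal)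
    have "norm (poly_avg lam I P f x) = norm (LINT t:I|lam. ?F x t) / c"
      using c by (simp add: poly_avg_def c_def divide_inverse mult.commute)
    then have "ennreal (norm (poly_avg lam I P f x)) = ennreal (norm (LINT t:I|lam. ?F x t)) / ennreal c"
      using c by (simp add: divide_ennreal)
    then show ?thesis using * by simp
  qed
  have avg_meas [measurable]: "poly_avg lam I P f \<in> borel_measurable V"
    unfolding poly_avg_def set_lebesgue_integral_def by measurable
  have nn: "(\<integral>\<^sup>+x. ennreal (norm (poly_avg lam I P f x) powr q) \<partial>V) \<le> ennreal (R powr q)"
  proof -
    have "(\<integral>\<^sup>+x. ennreal (norm (poly_avg lam I P f x) powr q) \<partial>V) \<le> (\<integral>\<^sup>+x. epow (n x) q \<partial>V)"
    proof (rule nn_integral_mono_AE)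
      show "AE x in V. ennreal (norm (poly_avg lam I P f x) powr q) \<le> epow (n x) q"
        using fin AE_space
      proof eventually_elim
        case (elim x)
        have "epow (ennreal (norm (poly_avg lam I P f x))) q \<le> epow (n x) q"
          using avg_le[OF elim(2,1)] q by (intro epow_mono) auto
        then show ?case by simp
      qed
    qed
    then show ?thesis using nR by (rule order_trans)
  qed
  have intq: "integrable V (\<lambda>x. norm (poly_avg lam I P f x) powr q)"
  proof (rule integrableI_bounded)
    show "(\<integral>\<^sup>+x. ennreal (norm (norm (poly_avg lam I P f x) powr q)) \<partial>V) < \<infinity>"
      using order.strict_trans1[OF nn ennreal_less_top] by simp
  qed measurable
  then have "ennreal (LINT x|V. norm (poly_avg lam I P f x) powr q) \<le> ennreal (R powr q)"
    using nn by (subst nn_integral_eq_integral[symmetric]) auto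
  then have "(LINT x|V. norm (poly_avg lam I P f x) powr q) \<le> R powr q" by (simp add: ennreal_le_iff)
  then have "Lp_norm V q (poly_avg lam I P f) \<le> (R powr q) powr (1 / q)"
    unfolding Lp_norm_def using q by (intro powr_mono2) auto
  also have "\<dots> = R" using R q by (cases "R = 0") (auto simp: powr_powr)
  finally have le: "Lp_norm V q (poly_avg lam I P f) \<le> R" .
  show ?thesis
    unfolding avg_Lp_bound_def
  proof (intro conjI)
    show "AE x in V. set_integrable lam I (avg_integrand P f x)"
      using fin AE_space by eventually_elim (rule int)
    show "poly_avg lam I P f \<in> Lp_space V q" using avg_meas intq by (simp add: Lp_space_def)
    show "Lp_norm V q (poly_avg lam I P f) \<le> B * (\<Prod>i\<in>UNIV. Lp_norm V (r i) (f i))"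
      using le by (simp add: R_def)
  qed
qed

lemma vec_lambda_minus_axis:
  fixes x :: "'k::finite \<Rightarrow> 'a::comm_ring_1"
  shows "(\<chi> i. x i) - axis m c = (\<chi> i. (x(m := x m - c)) i)"
  by (auto simp: vec_eq_iff axis_def)

lemma nn_integral_avg_integrand_le:
  fixes V :: "('a::comm_ring_1 ^ 'k::finite) measure" and M :: "'a measure" and \<nu> :: "'a measure"
  assumes V: "V = distr (cube M) V vec_lambda"
    and vl [measurable]: "vec_lambda \<in> cube M \<rightarrow>\<^sub>M V"
    and f [measurable]: "\<And>i. f i \<in> borel_measurable V"
    and bound: "product_bound M \<nu> (\<lambda>i x t. x - poly (P i) t) q r B"
    and meas: "(\<lambda>x. \<integral>\<^sup>+t. ennreal (norm (avg_integrand P f x t)) \<partial>\<nu>) \<in> borel_measurable V"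
  shows "pow_integral V q (\<lambda>x. \<integral>\<^sup>+t. ennreal (norm (avg_integrand P f x t)) \<partial>\<nu>)
      \<le> ennreal (B powr q) * (\<Prod>i\<in>UNIV. epow (pow_integral V (r i) (\<lambda>x. ennreal (norm (f i x)))) (q / r i))"
proof -
  define F where "F i x = ennreal (norm (f i (vec_lambda x)))" for i x
  have F: "\<forall>i. F i \<in> borel_measurable (cube M)" unfolding F_def by measurable
  have tr: "(\<integral>\<^sup>+x. g x \<partial>V) = (\<integral>\<^sup>+x. g (vec_lambda x) \<partial>cube M)" if "g \<in> borel_measurable V" for g
    by (subst V, subst nn_integral_distr) (use that in auto)
  have "pow_integral V q (\<lambda>x. \<integral>\<^sup>+t. ennreal (norm (avg_integrand P f x t)) \<partial>\<nu>)
      = (\<integral>\<^sup>+x. epow (\<integral>\<^sup>+t. ennreal (norm (avg_integrand P f (vec_lambda x) t)) \<partial>\<nu>) q \<partial>cube M)"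
    using meas by (intro tr) measurable
  also have "\<dots> = pow_integral (cube M) q (product_avg \<nu> (\<lambda>i x t. x - poly (P i) t) F)"
    by (simp only: avg_integrand_def F_def prod_norm[symmetric] prod_ennreal norm_ge_zero vec_lambda_minus_axis)
  also have "\<dots> \<le> ennreal (B powr q) * (\<Prod>i\<in>UNIV. epow (pow_integral (cube M) (r i) (F i)) (q / r i))"
    using bound F unfolding product_bound_def by blast
  also have "\<dots> = ennreal (B powr q) * (\<Prod>i\<in>UNIV. epow (pow_integral V (r i) (\<lambda>x. ennreal (norm (f i x)))) (q / r i))"
  proof -
    have "pow_integral (cube M) (r i) (F i) = pow_integral V (r i) (\<lambda>x. ennreal (norm (f i x)))" for i
      unfolding F_def by (rule tr[symmetric]) measurable
    then show ?thesis by simp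
  qed
  finally show ?thesis .
qed

lemma count_space_vec_eq_distr:
  "count_space (UNIV :: (int ^ 'k::finite) set) = distr (Pi\<^sub>M UNIV (\<lambda>_. count_space UNIV)) (count_space UNIV) vec_lambda"
  "vec_lambda \<in> Pi\<^sub>M UNIV (\<lambda>_::'k. count_space (UNIV :: int set)) \<rightarrow>\<^sub>M count_space UNIV"
proof -
  interpret product_sigma_finite "\<lambda>_::'k. count_space (UNIV :: int set)"
    by (intro product_sigma_finite.intro sigma_finite_measure_count_space)
  have pre: "vec_lambda -` {v} = (\<Pi>\<^sub>E i\<in>(UNIV::'k set). {v $ i})" for v :: "int ^ 'k"
    by (auto simp: PiE_iff fun_eq_iff vec_eq_iff)
  have pre_sets: "vec_lambda -` {v} \<inter> space (Pi\<^sub>M UNIV (\<lambda>_::'k. count_space (UNIV :: int set)))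
      \<in> sets (Pi\<^sub>M UNIV (\<lambda>_::'k. count_space (UNIV :: int set)))" for v :: "int ^ 'k"
    unfolding pre by (simp add: space_PiM)
  show vl: "vec_lambda \<in> Pi\<^sub>M UNIV (\<lambda>_::'k. count_space (UNIV :: int set)) \<rightarrow>\<^sub>M count_space UNIV"
    by (subst measurable_count_space_eq_countable) (auto simp: pre_sets)
  show "count_space (UNIV :: (int ^ 'k) set) = distr (Pi\<^sub>M UNIV (\<lambda>_. count_space UNIV)) (count_space UNIV) vec_lambda"
  proof (rule measure_eqI_countable[where A = UNIV])
    fix v :: "int ^ 'k"
    have "emeasure (distr (Pi\<^sub>M UNIV (\<lambda>_. count_space UNIV)) (count_space UNIV) vec_lambda) {v}
        = emeasure (Pi\<^sub>M UNIV (\<lambda>_::'k. count_space UNIV)) (\<Pi>\<^sub>E i\<in>UNIV. {v $ i})"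
      by (subst emeasure_distr[OF vl]) (auto simp: pre space_PiM)
    also have "\<dots> = 1" by (subst emeasure_PiM) auto
    finally show "emeasure (count_space UNIV) {v}
        = emeasure (distr (Pi\<^sub>M UNIV (\<lambda>_. count_space UNIV)) (count_space UNIV) vec_lambda) {v}" by simp
  qed auto
qed

lemma lborel_vec_eq_distr:
  "lborel = distr (Pi\<^sub>M UNIV (\<lambda>_::'k::finite. lborel)) (lborel :: (real ^ 'k) measure) vec_lambda"
  "vec_lambda \<in> Pi\<^sub>M UNIV (\<lambda>_::'k. (lborel :: real measure)) \<rightarrow>\<^sub>M (lborel :: (real ^ 'k) measure)"
proof -
  interpret product_sigma_finite "\<lambda>_::'k. (lborel :: real measure)"
    by (intro product_sigma_finite.intro sigma_finite_lborel)
  have "vec_lambda \<in> borel_measurable (Pi\<^sub>M UNIV (\<lambda>_::'k. (lborel :: real measure)))"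
    by (subst borel_measurable_euclidean_space) (auto simp: Basis_vec_def inner_axis)
  then show vl: "vec_lambda \<in> Pi\<^sub>M UNIV (\<lambda>_::'k. (lborel :: real measure)) \<rightarrow>\<^sub>M (lborel :: (real ^ 'k) measure)"
    by simp
  show "lborel = distr (Pi\<^sub>M UNIV (\<lambda>_::'k. lborel)) (lborel :: (real ^ 'k) measure) vec_lambda"
  proof (rule lborel_eqI)
    fix l u :: "real ^ 'k" assume le: "\<And>b. b \<in> Basis \<Longrightarrow> l \<bullet> b \<le> u \<bullet> b"
    have lu: "l $ i \<le> u $ i" for i using le[of "axis i 1"] by (simp add: inner_axis)
    have "emeasure (distr (Pi\<^sub>M UNIV (\<lambda>_::'k. lborel)) (lborel :: (real ^ 'k) measure) vec_lambda) (box l u)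
        = emeasure (Pi\<^sub>M UNIV (\<lambda>_::'k. lborel)) (\<Pi>\<^sub>E i\<in>UNIV. {l $ i<..<u $ i})"
      by (subst emeasure_distr[OF vl]) (auto simp: space_PiM mem_box_cart PiE_iff intro!: arg_cong2[of _ _ _ _ emeasure])
    also have "\<dots> = (\<Prod>i\<in>UNIV. ennreal (u $ i - l $ i))"
      using lu by (subst emeasure_PiM) auto
    also have "\<dots> = ennreal (\<Prod>i\<in>UNIV. u $ i - l $ i)" using lu by (intro prod_ennreal) simp
    also have "(\<Prod>i\<in>UNIV. u $ i - l $ i) = (\<Prod>b\<in>Basis. (u - l) \<bullet> b)"
    proof -
      have Basis: "(Basis :: (real ^ 'k) set) = (\<lambda>i. axis i 1) ` UNIV" by (auto simp: Basis_vec_def)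
      have inj: "inj (\<lambda>i::'k. axis i (1::real))" by (auto simp: inj_on_def axis_eq_axis)
      show ?thesis unfolding Basis prod.reindex[OF inj] by (simp add: inner_axis)
    qed
    finally show "emeasure (distr (Pi\<^sub>M UNIV (\<lambda>_::'k. lborel)) (lborel :: (real ^ 'k) measure) vec_lambda) (box l u)
        = (\<Prod>b\<in>Basis. (u - l) \<bullet> b)" .
  qed simp
qed

section \<open>Integers and reals\<close>

lemma sigma_finite_uniform_measure:
  assumes "A \<in> sets M" "emeasure M A \<noteq> 0" "emeasure M A < \<infinity>"
  shows "sigma_finite_measure (uniform_measure M A)"
proof -
  have "emeasure (uniform_measure M A) (space (uniform_measure M A)) = emeasure M (A \<inter> space M) / emeasure M A"
    using assms by (simp add: emeasure_uniform_measure)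
  also have "A \<inter> space M = A" using sets.sets_into_space[OF assms(1)] by auto
  also have "emeasure M A / emeasure M A = 1" using assms by (simp add: less_top)
  finally have "finite_measure (uniform_measure M A)" by (intro finite_measureI) simp
  then show ?thesis by (simp add: finite_measure_def)
qed

theorem improving_estimate_int:
  fixes P :: "'k::finite \<Rightarrow> int poly" and j :: 'k
  assumes card: "CARD('k) \<ge> 2" and deg: "\<And>i. 1 \<le> degree (P i)"
  shows "\<exists>p q r. admissible j p q r \<and> (\<exists>C. \<forall>N\<ge>1. \<forall>f :: 'k \<Rightarrow> int ^ 'k \<Rightarrow> complex.
    (\<forall>i. f i \<in> Lp_space (count_space UNIV) (r i)) \<longrightarrow> avg_Lp_bound (count_space UNIV) (count_space UNIV) (int_window N) P f q r
      (C * N powr (- real (\<Sum>i\<in>UNIV. degree (P i)) * (1 / p - 1 / q))))"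
proof -
  let ?c = "count_space (UNIV :: int set)"
  let ?\<nu> = "\<lambda>N. uniform_measure ?c (int_window N)"
  have w: "int_window N \<in> sets ?c" "emeasure ?c (int_window N) \<noteq> 0" "emeasure ?c (int_window N) < \<infinity>" if N: "1 \<le> N" for N
  proof -
    have "finite (int_window N)" by (simp add: int_window_eq)
    moreover have "1 \<in> int_window N" using N by (simp add: int_window_def)
    ultimately show "int_window N \<in> sets ?c" "emeasure ?c (int_window N) \<noteq> 0" "emeasure ?c (int_window N) < \<infinity>"
      by (auto simp: emeasure_count_space of_nat_less_top)
  qed
  have "\<exists>p q r. admissible j p q r \<and> (\<exists>C\<ge>0. \<forall>N\<ge>1. product_bound ?c (?\<nu> N)
    (\<lambda>i x t. x - poly (P i) t) q r (C * N powr (- (\<Sum>i\<in>UNIV. real (degree (P i))) * (1 / p - 1 / q))))"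
  proof (rule improving_bound)
    show "sigma_finite_measure ?c" by (rule sigma_finite_measure_count_space)
    show "sigma_finite_measure (?\<nu> N)" if "1 \<le> N" for N using w[OF that] by (rule sigma_finite_uniform_measure)
    show "(\<lambda>(x, t). x - poly (P i) t) \<in> ?c \<Otimes>\<^sub>M ?\<nu> N \<rightarrow>\<^sub>M ?c" for i N
      by (rule measurable_pair_measure_countable1) auto
    show "\<exists>\<eta>>0. \<exists>C>0. \<forall>N\<ge>1. restricted_type ?c (?\<nu> N) (\<lambda>x t. x - poly (P i) t) (4 / 3) \<eta> (C * N powr (- real (degree (P i))))" for i
      by (rule restricted_type_int_poly[OF deg])
  qed (rule card)
  then obtain p q r C where adm: "admissible j p q r" and C: "0 \<le> C"
    and main: "\<forall>N\<ge>1. product_bound ?c (?\<nu> N) (\<lambda>i x t. x - poly (P i) t) q r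
      (C * N powr (- (\<Sum>i\<in>UNIV. real (degree (P i))) * (1 / p - 1 / q)))"
    by (elim exE conjE) (rule that)
  have q: "0 < q" and r: "0 < r i" for i
    using adm less_trans[of 0 1 "r i"] by (auto simp: admissible_def)
  let ?B = "\<lambda>N. C * N powr (- real (\<Sum>i\<in>UNIV. degree (P i)) * (1 / p - 1 / q))"
  have bound: "product_bound ?c (?\<nu> N) (\<lambda>i x t. x - poly (P i) t) q r (?B N)" if "1 \<le> N" for N
    using main that by simp
  have key: "avg_Lp_bound (count_space UNIV) (count_space UNIV) (int_window N) P f q r (?B N)"
    if N: "1 \<le> N" and f: "\<forall>i. f i \<in> Lp_space (count_space UNIV) (r i)" for N and f :: "'k \<Rightarrow> int ^ 'k \<Rightarrow> complex"
  proof (rule poly_avg_Lp_bound)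
    show "(\<lambda>(x, t). avg_integrand P f x t) \<in> borel_measurable (count_space UNIV \<Otimes>\<^sub>M ?c)"
      by (rule measurable_pair_measure_countable1) auto
    show "pow_integral (count_space UNIV) q (\<lambda>x. \<integral>\<^sup>+t. ennreal (norm (avg_integrand P f x t)) \<partial>?\<nu> N)
      \<le> ennreal (?B N powr q)
        * (\<Prod>i\<in>UNIV. epow (pow_integral (count_space UNIV) (r i) (\<lambda>x. ennreal (norm (f i x)))) (q / r i))"
      by (rule nn_integral_avg_integrand_le[OF count_space_vec_eq_distr _ bound[OF N]]) auto
    show "0 < q" by (rule q)
    show "0 < r i" for i by (rule r)
    show "0 \<le> ?B N" using C by simp
    show "f i \<in> Lp_space (count_space UNIV) (r i)" for i using f by blast
  qed (use w[OF N] sigma_finite_measure_count_space in auto)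
  show ?thesis using adm key by blast
qed

lemma AE_eq_lebesgue_measurable:
  fixes u v :: "'a::euclidean_space \<Rightarrow> complex"
  assumes u: "u \<in> borel_measurable lborel" and ae: "AE x in lborel. v x = u x"
  shows "v \<in> borel_measurable lebesgue"
proof (rule measurableI)
  fix A :: "complex set" assume A: "A \<in> sets borel"
  have uL: "u -` A \<inter> space lebesgue \<in> sets lebesgue"
    using measurable_sets[OF measurable_completion[OF u] A] .
  have "AE x in lebesgue. x \<in> u -` A \<inter> space lebesgue \<longleftrightarrow> x \<in> v -` A \<inter> space lebesgue"
    unfolding AE_completion_iff using ae by eventually_elim auto
  then show "v -` A \<inter> space lebesgue \<in> sets lebesgue"
    using uL by (rule completion.in_sets_AE) auto
qed simp

lemma Lp_space_lebesgue_cong: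
  fixes u v :: "'a::euclidean_space \<Rightarrow> complex"
  assumes u: "u \<in> borel_measurable lborel" and v: "v \<in> borel_measurable lebesgue"
    and ae: "AE x in lborel. v x = u x"
  shows "v \<in> Lp_space lebesgue p \<longleftrightarrow> u \<in> Lp_space lborel p" "Lp_norm lebesgue p v = Lp_norm lborel p u"
proof -
  have [measurable]: "u \<in> borel_measurable lborel" by (rule u)
  have [measurable]: "v \<in> borel_measurable lebesgue" by (rule v)
  have [measurable]: "u \<in> borel_measurable lebesgue" by (rule measurable_completion[OF u])
  have um: "(\<lambda>x. norm (u x) powr p) \<in> borel_measurable lborel" by measurable
  have ae': "AE x in lebesgue. norm (v x) powr p = norm (u x) powr p"
    unfolding AE_completion_iff using ae by eventually_elim simp
  have "integrable lebesgue (\<lambda>x. norm (v x) powr p) \<longleftrightarrow> integrable lebesgue (\<lambda>x. norm (u x) powr p)"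
    by (rule integrable_cong_AE[OF _ _ ae']) measurable
  also have "\<dots> \<longleftrightarrow> integrable lborel (\<lambda>x. norm (u x) powr p)" by (rule integrable_completion[OF um])
  finally show "v \<in> Lp_space lebesgue p \<longleftrightarrow> u \<in> Lp_space lborel p"
    using u v by (simp add: Lp_space_def)
  have "(LINT x|lebesgue. norm (v x) powr p) = (LINT x|lebesgue. norm (u x) powr p)"
    by (rule integral_cong_AE[OF _ _ ae']) measurable
  also have "\<dots> = (LINT x|lborel. norm (u x) powr p)" by (rule integral_completion[OF um])
  finally show "Lp_norm lebesgue p v = Lp_norm lborel p u" by (simp add: Lp_norm_def)
qed

lemma lebesgue_measurable_complex_borel_version:
  fixes v :: "'a::euclidean_space \<Rightarrow> complex"
  assumes v: "v \<in> borel_measurable lebesgue"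
  shows "\<exists>u\<in>borel_measurable lborel. AE x in lborel. v x = u x"
proof -
  have "(\<lambda>x. Re (v x)) \<in> borel_measurable lebesgue" "(\<lambda>x. Im (v x)) \<in> borel_measurable lebesgue"
    using v by measurable
  note this[THEN completion_ex_borel_measurable_real]
  then obtain a b where a: "a \<in> borel_measurable lborel" "AE x in lborel. Re (v x) = a x"
    and b: "b \<in> borel_measurable lborel" "AE x in lborel. Im (v x) = b x"
    by blast
  show ?thesis
  proof (rule bexI[of _ "\<lambda>x. complex_of_real (a x) + \<i> * complex_of_real (b x)"])
    show "AE x in lborel. v x = complex_of_real (a x) + \<i> * complex_of_real (b x)"
      using a(2) b(2) by eventually_elim (simp add: complex_eq_iff)
    show "(\<lambda>x. complex_of_real (a x) + \<i> * complex_of_real (b x)) \<in> borel_measurable lborel"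
      using a(1) b(1) by measurable
  qed
qed

lemma measurable_shift_along_poly:
  "(\<lambda>z. fst z - axis i (poly P (snd z))) \<in> (lborel :: (real ^ 'k::finite) measure) \<Otimes>\<^sub>M (lborel :: real measure) \<rightarrow>\<^sub>M (lborel :: (real ^ 'k) measure)"
proof -
  have [measurable]: "poly P \<in> borel_measurable borel"
    by (intro borel_measurable_continuous_onI continuous_intros)
  have "axis i (poly P t) = poly P t *\<^sub>R (axis i 1 :: real ^ 'k)" for t
    by (simp add: vec_eq_iff axis_def)
  then show ?thesis by (simp only:) measurable
qed

lemma AE_lborel_translate:
  fixes c :: "'a::euclidean_space"
  assumes "N \<in> sets lborel" "emeasure lborel N = 0"
  shows "AE x in lborel. x - c \<notin> N"
proof -
  have "AE x in lborel. x \<notin> N" using assms by (intro AE_not_in) (auto simp: null_sets_def)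
  then have "AE x in distr lborel borel ((+) (- c)). x \<notin> N" unfolding lborel_distr_plus .
  then have "AE x in lborel. - c + x \<notin> N"
    by (subst (asm) AE_distr_iff) (use assms in auto)
  then show ?thesis by simp
qed

text \<open>For fixed \<open>t\<close> a shift preserves null sets; Fubini's theorem exchanges the order of \<open>x\<close> and \<open>t\<close>. It
  is applied to a Borel null set that contains the exceptional set.\<close>
lemma AE_avg_integrand_cong:
  fixes f g :: "'k::finite \<Rightarrow> real ^ 'k \<Rightarrow> complex"
  assumes "\<And>i. AE x in lborel. f i x = g i x"
  shows "AE x in lborel. AE t in lborel. avg_integrand P f x t = avg_integrand P g x t"
proof -
  have "AE x in lborel. AE t in lborel. f i (x - axis i (poly (P i) t)) = g i (x - axis i (poly (P i) t))" for i
  proof -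
    obtain N where N: "{x \<in> space lborel. f i x \<noteq> g i x} \<subseteq> N" "emeasure lborel N = 0" "N \<in> sets lborel"
      using assms[of i] by (rule AE_E)
    have "AE t in lborel. AE x in lborel. x - axis i (poly (P i) t) \<notin> N"
      by (intro AE_I2 AE_lborel_translate N)
    moreover have "{z \<in> space (lborel \<Otimes>\<^sub>M lborel). fst z - axis i (poly (P i) (snd z)) \<notin> N} \<in> sets (lborel \<Otimes>\<^sub>M lborel)"
      using measurable_sets[OF measurable_shift_along_poly, of "- N" i "P i"] N(3)
      by (simp add: vimage_def Int_def conj_commute)
    ultimately have "AE x in lborel. AE t in lborel. x - axis i (poly (P i) t) \<notin> N"
      by (subst lborel_pair.AE_commute) auto
    then show ?thesis
    proof eventually_elim
      case (elim x)
      then show ?case by eventually_elim (use N(1) in auto)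
    qed
  qed
  then have "AE x in lborel. \<forall>i\<in>UNIV. AE t in lborel. f i (x - axis i (poly (P i) t)) = g i (x - axis i (poly (P i) t))"
    by (intro AE_finite_allI) auto
  then show ?thesis
  proof eventually_elim
    case (elim x)
    then have "AE t in lborel. \<forall>i\<in>UNIV. f i (x - axis i (poly (P i) t)) = g i (x - axis i (poly (P i) t))"
      by (intro AE_finite_allI) auto
    then show ?case by eventually_elim (simp add: avg_integrand_def)
  qed
qed

lemma set_integral_lebesgue_cong:
  fixes u v :: "real \<Rightarrow> complex"
  assumes u: "u \<in> borel_measurable lborel" and ae: "AE t in lborel. v t = u t" and I: "I \<in> sets lborel"
  shows "set_integrable lebesgue I v \<longleftrightarrow> set_integrable lborel I u"
    "(LINT t:I|lebesgue. v t) = (LINT t:I|lborel. u t)"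
proof -
  have um: "(\<lambda>t. indicator I t *\<^sub>R u t) \<in> borel_measurable lborel"
    by (intro borel_measurable_scaleR borel_measurable_indicator u I)
  have ae1: "AE t in lborel. indicator I t *\<^sub>R v t = indicator I t *\<^sub>R u t"
    using ae by eventually_elim simp
  have vL: "(\<lambda>t. indicator I t *\<^sub>R v t) \<in> borel_measurable lebesgue"
    by (rule AE_eq_lebesgue_measurable[OF um ae1])
  have uL: "(\<lambda>t. indicator I t *\<^sub>R u t) \<in> borel_measurable lebesgue"
    by (rule measurable_completion[OF um])
  have ae2: "AE t in lebesgue. indicator I t *\<^sub>R v t = indicator I t *\<^sub>R u t"
    unfolding AE_completion_iff by (rule ae1)
  show "set_integrable lebesgue I v \<longleftrightarrow> set_integrable lborel I u"
    unfolding set_integrable_def integrable_cong_AE[OF vL uL ae2] by (rule integrable_completion[OF um])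
  show "(LINT t:I|lebesgue. v t) = (LINT t:I|lborel. u t)"
    unfolding set_lebesgue_integral_def integral_cong_AE[OF vL uL ae2] by (rule integral_completion[OF um])
qed

text \<open>The composition of a Lebesgue measurable \<open>f i\<close> with \<open>(x, t) \<mapsto> x - P i (t) e i\<close> need not be
  measurable for the product of the Borel algebras, so the estimate is proved for Borel versions
  of the \<open>f i\<close> and transferred: all quantities involved change on null sets only.\<close>
theorem improving_estimate_real:
  fixes P :: "'k::finite \<Rightarrow> real poly" and j :: 'k
  assumes card: "CARD('k) \<ge> 2" and deg: "\<And>i. 1 \<le> degree (P i)"
  shows "\<exists>p q r. admissible j p q r \<and> (\<exists>C. \<forall>N\<ge>1. \<forall>f :: 'k \<Rightarrow> real ^ 'k \<Rightarrow> complex.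
    (\<forall>i. f i \<in> Lp_space lebesgue (r i)) \<longrightarrow> avg_Lp_bound lebesgue lebesgue (real_window N) P f q r
      (C * N powr (- real (\<Sum>i\<in>UNIV. degree (P i)) * (1 / p - 1 / q))))"
proof -
  let ?c = "lborel :: real measure"
  let ?V = "lborel :: (real ^ 'k) measure"
  let ?\<nu> = "\<lambda>N. uniform_measure ?c (real_window N)"
  have w: "real_window N \<in> sets ?c" "emeasure ?c (real_window N) \<noteq> 0" "emeasure ?c (real_window N) < \<infinity>" if N: "1 \<le> N" for N
    using N by (auto simp: real_window_def)
  have pm [measurable]: "poly p \<in> borel_measurable borel" for p :: "real poly"
    by (intro borel_measurable_continuous_onI continuous_intros)
  have "\<exists>p q r. admissible j p q r \<and> (\<exists>C\<ge>0. \<forall>N\<ge>1. product_bound ?c (?\<nu> N)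
    (\<lambda>i x t. x - poly (P i) t) q r (C * N powr (- (\<Sum>i\<in>UNIV. real (degree (P i))) * (1 / p - 1 / q))))"
  proof (rule improving_bound)
    show "sigma_finite_measure ?c" by (rule sigma_finite_lborel)
    show "sigma_finite_measure (?\<nu> N)" if "1 \<le> N" for N using w[OF that] by (rule sigma_finite_uniform_measure)
    show "(\<lambda>(x, t). x - poly (P i) t) \<in> ?c \<Otimes>\<^sub>M ?\<nu> N \<rightarrow>\<^sub>M ?c" for i N by measurable
    show "\<exists>\<eta>>0. \<exists>C>0. \<forall>N\<ge>1. restricted_type ?c (?\<nu> N) (\<lambda>x t. x - poly (P i) t) (4 / 3) \<eta> (C * N powr (- real (degree (P i))))" for i
      by (rule restricted_type_real_poly[OF deg]) simp
  qed (rule card)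
  then obtain p q r C where adm: "admissible j p q r" and C: "0 \<le> C"
    and main: "\<forall>N\<ge>1. product_bound ?c (?\<nu> N) (\<lambda>i x t. x - poly (P i) t) q r
      (C * N powr (- (\<Sum>i\<in>UNIV. real (degree (P i))) * (1 / p - 1 / q)))"
    by (elim exE conjE) (rule that)
  have q: "0 < q" and r: "0 < r i" for i
    using adm less_trans[of 0 1 "r i"] by (auto simp: admissible_def)
  let ?B = "\<lambda>N. C * N powr (- real (\<Sum>i\<in>UNIV. degree (P i)) * (1 / p - 1 / q))"
  have bound: "product_bound ?c (?\<nu> N) (\<lambda>i x t. x - poly (P i) t) q r (?B N)" if "1 \<le> N" for N
    using main that by simp
  have key: "avg_Lp_bound lebesgue lebesgue (real_window N) P f q r (?B N)"
    if N: "1 \<le> N" and f: "\<forall>i. f i \<in> Lp_space lebesgue (r i)" for N and f :: "'k \<Rightarrow> real ^ 'k \<Rightarrow> complex"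
  proof -
    have fL: "f i \<in> borel_measurable lebesgue" for i using f by (simp add: Lp_space_def)
    have "\<forall>i. \<exists>u. u \<in> borel_measurable lborel \<and> (AE x in lborel. f i x = u x)"
      using lebesgue_measurable_complex_borel_version[OF fL] by blast
    then obtain g where g: "\<forall>i. g i \<in> borel_measurable lborel \<and> (AE x in lborel. f i x = g i x)"
      by (rule choice[THEN exE])
    then have gm [measurable]: "g i \<in> borel_measurable lborel" and fg: "AE x in lborel. f i x = g i x" for i
      by blast+
    have g_Lp: "g i \<in> Lp_space lborel (r i)" and g_norm: "Lp_norm lebesgue (r i) (f i) = Lp_norm lborel (r i) (g i)" for i
      using Lp_space_lebesgue_cong[OF gm fL fg] f by blast+
    have joint: "(\<lambda>(x, t). avg_integrand P g x t) \<in> borel_measurable (?V \<Otimes>\<^sub>M ?c)"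
    proof -
      have "(\<lambda>z. g i (fst z - axis i (poly (P i) (snd z)))) \<in> borel_measurable (?V \<Otimes>\<^sub>M ?c)" for i
        by (rule measurable_compose[OF measurable_shift_along_poly gm])
      then show ?thesis unfolding avg_integrand_def case_prod_unfold by measurable
    qed
    have joint': "(\<lambda>(x, t). avg_integrand P g x t) \<in> borel_measurable (?V \<Otimes>\<^sub>M ?\<nu> N)"
      using joint by (simp cong: measurable_cong_sets)
    interpret \<nu>: sigma_finite_measure "?\<nu> N" using w[OF N] by (rule sigma_finite_uniform_measure)
    have avg: "avg_Lp_bound ?V ?c (real_window N) P g q r (?B N)"
    proof (rule poly_avg_Lp_bound)
      show "(\<lambda>(x, t). avg_integrand P g x t) \<in> borel_measurable (?V \<Otimes>\<^sub>M ?c)" by (rule joint)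
      have "(\<lambda>(x, t). ennreal (norm (avg_integrand P g x t))) \<in> borel_measurable (?V \<Otimes>\<^sub>M ?\<nu> N)"
        using joint' unfolding case_prod_unfold by measurable
      then have "(\<lambda>x. \<integral>\<^sup>+t. ennreal (norm (avg_integrand P g x t)) \<partial>?\<nu> N) \<in> borel_measurable ?V"
        by (rule \<nu>.borel_measurable_nn_integral)
      then show "pow_integral ?V q (\<lambda>x. \<integral>\<^sup>+t. ennreal (norm (avg_integrand P g x t)) \<partial>?\<nu> N)
        \<le> ennreal (?B N powr q) * (\<Prod>i\<in>UNIV. epow (pow_integral ?V (r i) (\<lambda>x. ennreal (norm (g i x)))) (q / r i))"
        by (rule nn_integral_avg_integrand_le[OF lborel_vec_eq_distr gm bound[OF N]])
      show "0 < q" by (rule q)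
      show "0 < r i" for i by (rule r)
      show "0 \<le> ?B N" using C by simp
      show "g i \<in> Lp_space ?V (r i)" for i by (rule g_Lp)
    qed (use w[OF N] sigma_finite_lborel in auto)
    note avg = avg[unfolded avg_Lp_bound_def]
    have gx: "avg_integrand P g x \<in> borel_measurable ?c" for x
      using measurable_Pair2[OF joint, of x] by simp
    have eq: "AE x in ?V. AE t in ?c. avg_integrand P f x t = avg_integrand P g x t"
      by (rule AE_avg_integrand_cong[OF fg])
    have avg_eq: "AE x in ?V. poly_avg lebesgue (real_window N) P f x = poly_avg ?c (real_window N) P g x"
      using eq
    proof eventually_elim
      case (elim x)
      have "measure lebesgue (real_window N) = measure ?c (real_window N)"
        using w(1)[OF N] by (simp add: measure_completion)
      then show ?case
        using set_integral_lebesgue_cong(2)[OF gx elim w(1)[OF N]] by (simp add: poly_avg_def)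
    qed
    have gavg: "poly_avg ?c (real_window N) P g \<in> borel_measurable ?V" using avg by (simp add: Lp_space_def)
    have favg: "poly_avg lebesgue (real_window N) P f \<in> borel_measurable lebesgue"
      by (rule AE_eq_lebesgue_measurable[OF gavg avg_eq])
    show ?thesis
      unfolding avg_Lp_bound_def
    proof (intro conjI)
      have "AE x in ?V. set_integrable lebesgue (real_window N) (avg_integrand P f x)"
        using avg[THEN conjunct1] eq
      proof eventually_elim
        case (elim x)
        then show ?case using set_integral_lebesgue_cong(1)[OF gx elim(2) w(1)[OF N]] by simp
      qed
      then show "AE x in lebesgue. set_integrable lebesgue (real_window N) (avg_integrand P f x)"
        unfolding AE_completion_iff .
      show "poly_avg lebesgue (real_window N) P f \<in> Lp_space lebesgue q"
        using Lp_space_lebesgue_cong(1)[OF gavg favg avg_eq] avg by blast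
      show "Lp_norm lebesgue q (poly_avg lebesgue (real_window N) P f)
          \<le> ?B N * (\<Prod>i\<in>UNIV. Lp_norm lebesgue (r i) (f i))"
        unfolding g_norm Lp_space_lebesgue_cong(2)[OF gavg favg avg_eq] using avg by blast
    qed
  qed
  show ?thesis using adm key by blast
qed

theorem theorem5p2:
  fixes j :: "'k::finite"
  assumes "CARD('k) \<ge> 2"
  shows "(\<forall>P :: 'k \<Rightarrow> int poly. (\<forall>i. 1 \<le> degree (P i)) \<longrightarrow>
      (\<exists>(p::real) (q::real) (r :: 'k \<Rightarrow> real).
         1 < p \<and> p < q \<and> q < 2 \<and> (\<forall>i. 1 < r i) \<and>
         (\<Sum>i\<in>UNIV. 1 / r i) = 1 / p \<and> r j = 2 \<and>
         (\<exists>C::real. \<forall>N\<ge>1. \<forall>f :: 'k \<Rightarrow> int ^ 'k \<Rightarrow> complex.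
            (\<forall>i. f i \<in> Lp_space (count_space UNIV) (r i)) \<longrightarrow>
              (AE x in (count_space UNIV). set_integrable (count_space UNIV) (int_window N) (avg_integrand P f x)) \<and>
              poly_avg (count_space UNIV) (int_window N) P f \<in> Lp_space (count_space UNIV) q \<and>
              Lp_norm (count_space UNIV) q (poly_avg (count_space UNIV) (int_window N) P f)
                \<le> C * N powr (- real (\<Sum>i\<in>UNIV. degree (P i)) * (1 / p - 1 / q))
                    * (\<Prod>i\<in>UNIV. Lp_norm (count_space UNIV) (r i) (f i)))))
    \<and> (\<forall>P :: 'k \<Rightarrow> real poly. (\<forall>i. 1 \<le> degree (P i)) \<longrightarrow>
      (\<exists>(p::real) (q::real) (r :: 'k \<Rightarrow> real).
         1 < p \<and> p < q \<and> q < 2 \<and> (\<forall>i. 1 < r i) \<and>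
         (\<Sum>i\<in>UNIV. 1 / r i) = 1 / p \<and> r j = 2 \<and>
         (\<exists>C::real. \<forall>N\<ge>1. \<forall>f :: 'k \<Rightarrow> real ^ 'k \<Rightarrow> complex.
            (\<forall>i. f i \<in> Lp_space lebesgue (r i)) \<longrightarrow>
              (AE x in lebesgue. set_integrable lebesgue (real_window N) (avg_integrand P f x)) \<and>
              poly_avg lebesgue (real_window N) P f \<in> Lp_space lebesgue q \<and>
              Lp_norm lebesgue q (poly_avg lebesgue (real_window N) P f)
                \<le> C * N powr (- real (\<Sum>i\<in>UNIV. degree (P i)) * (1 / p - 1 / q))
                    * (\<Prod>i\<in>UNIV. Lp_norm lebesgue (r i) (f i)))))"
  using improving_estimate_int[OF assms, where j = j] improving_estimate_real[OF assms, where j = j]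
  unfolding admissible_def avg_Lp_bound_def conj_assoc by blast

end
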